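(* Let $P(D)=\frac{\partial^2}{\partial t^2}-\frac{\partial^2}{\partial x^2}$ be the wave operator on $\mathbb{R}^2$ and let $X\subseteq\mathbb{R}^2$ be open such that $X$ is $P$-convex for supports. Let $K\subseteq X$ be compact and let $Y\subseteq\mathbb{R}^2$ be open with $K\subseteq Y\subseteq X$ such that there is no $x=(x_1,x_2)\in\mathbb{R}^2$ such that $X$ contains a compact connected component of one of the sets $(\mathbb{R}^2\setminus Y)\cap\{(x_1+s,x_2+s): s\in\mathbb{R}\}$ or $(\mathbb{R}^2\setminus Y)\cap\{(x_1-s,x_2+s): s\in\mathbb{R}\}$. Then, for all compact $L\subseteq Y$ with $L=\overline{\operatorname{int}(L)}$ and $K\subseteq\operatorname{int}L$ such that there is no $x=(x_1,x_2)\in\mathbb{R}^2$ such that $Y$ contains a bounded connected component of one of the sets $(\mathbb{R}^2\setminus L)\cap\{(x_1+s,x_2+s): s\in\mathbb{R}\}$ or $(\mathbb{R}^2\setminus L)\cap\{(x_1-s,x_2+s): s\in\mathbb{R}\}$, for all compact $M\subseteq X$, and for all $r_1,r_2\in\mathbb{N}_0$ there are $s,C>0$ such that for all $f\in\mathscr{E}_P(Y)$ and all $\varepsilon\in(0,1)$ there exists $h_\varepsilon\in\mathscr{E}_P(X)$ with $$\|f-h_\varepsilon\|_{K,r_1}\leq\varepsilon\|f\|_{L,r_1+1}\quad\text{and}\quad\|h_\varepsilon\|_{M,r_2}\leq\frac{C}{\varepsilon^s}\|f\|_{L}.$$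
   Context: For a polynomial $P\in\mathbb{C}[\xi_1,\ldots,\xi_d]$, $P(D)=P(-i\frac{\partial}{\partial x_1},\ldots,-i\frac{\partial}{\partial x_d})$ and $\check{P}(\xi)=P(-\xi)$. An open set $X\subseteq\mathbb{R}^d$ is $P$-convex for supports if for every compact $K\subseteq X$ there is a compact $L\subseteq X$ such that for all $f\in\mathscr{E}'(X)$ (distributions with compact support in $X$): $\operatorname{supp}\check{P}(D)f\subseteq K$ implies $\operatorname{supp}f\subseteq L$. $\mathscr{E}_P(X)$ is the space of (complex-valued) smooth functions $f$ on $X$ with $P(D)f=0$. For $K\subseteq X$ compact and $r\in\mathbb{N}_0$, $\|f\|_{K,r}=\sup_{x\in K,|\alpha|\leq r}|\partial^\alpha f(x)|$ and $\|f\|_K=\|f\|_{K,0}$. *)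

theory Defs
  imports "HOL-Analysis.Analysis" "HOL-Library.Poly_Mapping"
begin

section \<open>Partial derivatives and smooth functions\<close>

text \<open>Functions on an open set \<open>X\<close> are represented by total functions whose values outside \<open>X\<close> are
  irrelevant: all derivatives below are only ever evaluated at points of open sets on which the
  function under consideration is smooth. The order on the index type of the coordinates only
  serves to fix the order in which the partial derivatives in \<open>\<partial>\<^sup>\<alpha>\<close> are taken.\<close>

definition partial_deriv :: "'n::finite \<Rightarrow> (real^'n \<Rightarrow> complex) \<Rightarrow> real^'n \<Rightarrow> complex" where
  "partial_deriv i f x = frechet_derivative f (at x) (axis i 1)"

definition mi_order :: "('n::finite \<Rightarrow>\<^sub>0 nat) \<Rightarrow> nat" where
  "mi_order \<alpha> = (\<Sum>i\<in>UNIV. Poly_Mapping.lookup \<alpha> i)"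

definition mi_deriv ::
  "('n::{finite,linorder} \<Rightarrow>\<^sub>0 nat) \<Rightarrow> (real^'n::_ \<Rightarrow> complex) \<Rightarrow> real^'n::_ \<Rightarrow> complex" where
  "mi_deriv \<alpha> f =
     fold (\<lambda>i. partial_deriv i ^^ Poly_Mapping.lookup \<alpha> i) (sorted_list_of_set UNIV) f"

primrec Ck_on :: "nat \<Rightarrow> (real^'n::finite) set \<Rightarrow> (real^'n \<Rightarrow> complex) \<Rightarrow> bool" where
  "Ck_on 0 X f \<longleftrightarrow> continuous_on X f"
| "Ck_on (Suc k) X f \<longleftrightarrow> (\<forall>x\<in>X. f differentiable (at x)) \<and> (\<forall>i. Ck_on k X (partial_deriv i f))"

definition smooth_on :: "(real^'n::finite) set \<Rightarrow> (real^'n \<Rightarrow> complex) \<Rightarrow> bool" where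
  "smooth_on X f \<longleftrightarrow> (\<forall>k. Ck_on k X f)"

text \<open>The element \<open>0\<close> is inserted so that the supremum over an empty compact set is \<open>0\<close>;
  it has no effect otherwise.\<close>

definition seminorm ::
  "(real^'n::{finite,linorder}) set \<Rightarrow> nat \<Rightarrow> (real^'n::_ \<Rightarrow> complex) \<Rightarrow> real" where
  "seminorm K r f = Sup (insert 0 {cmod (mi_deriv \<alpha> f x) | x \<alpha>. x \<in> K \<and> mi_order \<alpha> \<le> r})"


section \<open>Polynomials and constant coefficient differential operators\<close>

text \<open>A polynomial in the indeterminates \<open>\<xi>\<^sub>i\<close>, \<open>i :: 'n\<close>, is a finitely supported map from exponents to
  coefficients; the ring structure is the one of \<open>Poly_Mapping\<close>.\<close>

type_synonym 'n cpoly = "('n \<Rightarrow>\<^sub>0 nat) \<Rightarrow>\<^sub>0 complex"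

definition indet :: "'n \<Rightarrow> 'n cpoly" where
  "indet i = Poly_Mapping.single (Poly_Mapping.single i 1) 1"

text \<open>\<open>P(-\<xi>)\<close>\<close>

definition poly_reflect :: "'n::finite cpoly \<Rightarrow> 'n cpoly" where
  "poly_reflect P = Poly_Mapping.mapp (\<lambda>\<alpha> c. (- 1) ^ mi_order \<alpha> * c) P"

definition diff_op ::
  "'n::{finite,linorder} cpoly \<Rightarrow> (real^'n::_ \<Rightarrow> complex) \<Rightarrow> real^'n::_ \<Rightarrow> complex" where
  "diff_op P f x = (\<Sum>\<alpha>\<in>Poly_Mapping.keys P.
     Poly_Mapping.lookup P \<alpha> * (- \<i>) ^ mi_order \<alpha> * mi_deriv \<alpha> f x)"

definition kernel_space :: "'n::{finite,linorder} cpoly \<Rightarrow> (real^'n::_) set \<Rightarrow> (real^'n::_ \<Rightarrow> complex) set" where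
  "kernel_space P X = {f. smooth_on X f \<and> (\<forall>x\<in>X. diff_op P f x = 0)}"


section \<open>Distributions and convexity for supports\<close>

definition test_functions :: "(real^'n::finite) set \<Rightarrow> (real^'n \<Rightarrow> complex) set" where
  "test_functions X =
     {\<phi>. smooth_on UNIV \<phi> \<and> compact (closure {x. \<phi> x \<noteq> 0}) \<and> closure {x. \<phi> x \<noteq> 0} \<subseteq> X}"

text \<open>Only the values of a distribution on \<^term>\<open>test_functions X\<close> are relevant.\<close>

definition distribution_on ::
  "(real^'n::{finite,linorder}) set \<Rightarrow> ((real^'n::_ \<Rightarrow> complex) \<Rightarrow> complex) \<Rightarrow> bool" where
  "distribution_on X u \<longleftrightarrow>
     (\<forall>\<phi>\<in>test_functions X. \<forall>\<psi>\<in>test_functions X. u (\<lambda>x. \<phi> x + \<psi> x) = u \<phi> + u \<psi>) \<and>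
     (\<forall>c. \<forall>\<phi>\<in>test_functions X. u (\<lambda>x. c * \<phi> x) = c * u \<phi>) \<and>
     (\<forall>K. compact K \<and> K \<subseteq> X \<longrightarrow>
        (\<exists>C k. \<forall>\<phi>\<in>test_functions X. closure {x. \<phi> x \<noteq> 0} \<subseteq> K \<longrightarrow>
           cmod (u \<phi>) \<le> C * seminorm K k \<phi>))"

definition distr_support ::
  "(real^'n::finite) set \<Rightarrow> ((real^'n \<Rightarrow> complex) \<Rightarrow> complex) \<Rightarrow> (real^'n) set" where
  "distr_support X u = X - \<Union>{U. open U \<and> U \<subseteq> X \<and> (\<forall>\<phi>\<in>test_functions U. u \<phi> = 0)}"

definition compactly_supported_distributions ::
  "(real^'n::{finite,linorder}) set \<Rightarrow> ((real^'n::_ \<Rightarrow> complex) \<Rightarrow> complex) set" where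
  "compactly_supported_distributions X =
     {u. distribution_on X u \<and> compact (distr_support X u)}"

text \<open>The distributional derivative is \<open>(\<partial>\<^sup>\<alpha> u)(\<phi>) = (-1)\<^bsup>|\<alpha>|\<^esup> u(\<partial>\<^sup>\<alpha> \<phi>)\<close>.\<close>

definition distr_diff_op :: "'n::{finite,linorder} cpoly \<Rightarrow> ((real^'n::_ \<Rightarrow> complex) \<Rightarrow> complex) \<Rightarrow>
    (real^'n::_ \<Rightarrow> complex) \<Rightarrow> complex" where
  "distr_diff_op P u \<phi> = (\<Sum>\<alpha>\<in>Poly_Mapping.keys P.
     Poly_Mapping.lookup P \<alpha> * (- \<i>) ^ mi_order \<alpha> * ((- 1) ^ mi_order \<alpha> * u (mi_deriv \<alpha> \<phi>)))"

definition P_convex_for_supports :: "'n::{finite,linorder} cpoly \<Rightarrow> (real^'n::_) set \<Rightarrow> bool" where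
  "P_convex_for_supports P X \<longleftrightarrow>
     (\<forall>K. compact K \<and> K \<subseteq> X \<longrightarrow>
        (\<exists>L. compact L \<and> L \<subseteq> X \<and>
           (\<forall>u\<in>compactly_supported_distributions X.
              distr_support X (distr_diff_op (poly_reflect P) u) \<subseteq> K \<longrightarrow>
              distr_support X u \<subseteq> L)))"


section \<open>The wave operator\<close>

text \<open>The first coordinate is the time \<open>t\<close>, the second one the space variable \<open>x\<close>. Since
  \<open>P(D)\<close> is formed with \<open>-i\<partial>\<close>, the symbol of \<open>\<partial>\<^sub>t\<^sup>2 - \<partial>\<^sub>x\<^sup>2\<close> is \<open>\<xi>\<^sub>2\<^sup>2 - \<xi>\<^sub>1\<^sup>2\<close>;
  see \<open>diff_op_wave_poly\<close> below.\<close>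

definition wave_poly :: "2 cpoly" where
  "wave_poly = (indet 2)\<^sup>2 - (indet 1)\<^sup>2"

lemma indet_square: "(indet i)\<^sup>2 = Poly_Mapping.single (Poly_Mapping.single i 2) 1"
  by (simp add: indet_def power2_eq_square mult_single numeral_2_eq_2 flip: single_add)

lemma mi_order_single: "mi_order (Poly_Mapping.single i k) = k"
  by (simp add: mi_order_def lookup_single when_def)

lemma mi_deriv_single: "mi_deriv (Poly_Mapping.single i k) f = (partial_deriv i ^^ k) f"
proof -
  have "fold (\<lambda>j. partial_deriv j ^^ Poly_Mapping.lookup (Poly_Mapping.single i k) j) xs f =
      (if i \<in> set xs then (partial_deriv i ^^ k) f else f)" if "distinct xs" for xs f
    using that by (induction xs arbitrary: f) (auto simp: lookup_single when_def)
  then show ?thesis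
    by (simp add: mi_deriv_def)
qed

lemma diff_op_wave_poly:
  "diff_op wave_poly f x =
     partial_deriv 1 (partial_deriv 1 f) x - partial_deriv 2 (partial_deriv 2 f) x"
proof -
  let ?a = "Poly_Mapping.single (1::2) (2::nat)" and ?b = "Poly_Mapping.single (2::2) (2::nat)"
  have ne: "?a \<noteq> ?b"
  proof
    assume "?a = ?b"
    then have "Poly_Mapping.lookup ?a 1 = Poly_Mapping.lookup ?b 1"
      by simp
    then show False
      by (simp add: lookup_single)
  qed
  have P: "wave_poly = Poly_Mapping.single ?b 1 - Poly_Mapping.single ?a 1"
    by (simp add: wave_poly_def indet_square)
  have l: "Poly_Mapping.lookup wave_poly \<alpha> = (if \<alpha> = ?b then 1 else if \<alpha> = ?a then - 1 else 0)" for \<alpha>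
    using ne by (auto simp: P lookup_minus lookup_single when_def)
  then have "Poly_Mapping.keys wave_poly = {?a, ?b}"
    by (auto simp: in_keys_iff split: if_splits)
  then show ?thesis
    using ne by (simp add: diff_op_def l mi_order_single mi_deriv_single numeral_2_eq_2)
qed

end

theory Submission
  imports Defs
begin

text \<open>In the characteristic variables \<open>u = t + x\<close>, \<open>v = t - x\<close> the wave operator is \<open>4\<partial>\<^sub>u\<partial>\<^sub>v\<close>.
  Testing convexity for supports with the measure \<open>\<phi> \<mapsto> \<integral>\<phi>\<close> over a characteristic segment, whose image
  under \<open>P(D)\<close> is supported in the two end points, shows that characteristic lines meet each component
  of \<open>X\<close> in a connected set. The two conditions on gaps pass this on to \<open>int L\<close>: points of \<open>int L\<close> on a
  common characteristic line and in the same component of \<open>X\<close> are joined by a segment in \<open>int L\<close>.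
  Hence on each component \<open>W\<close> of \<open>int L\<close> a solution has the form \<open>a(u) + b(v)\<close>, and components \<open>W\<close>
  within one component of \<open>X\<close> have disjoint \<open>u\<close>- and \<open>v\<close>-projections. Cutting \<open>a\<close> and \<open>b\<close> off sharply and
  mollifying at scale \<open>\<delta> \<sim> \<epsilon>\<close> gives global solutions; the error in \<open>r\<^sub>1\<close> derivatives is
  \<open>O(\<delta>)\<close> times \<open>r\<^sub>1 + 1\<close> derivatives, and \<open>r\<^sub>2\<close> derivatives of the mollification cost
  \<open>\<delta>\<^bsup>-r\<^sub>2-1\<^esup>\<close> times the supremum.\<close>

section \<open>Partial derivatives and seminorms on the plane\<close>

text \<open>The sum a(u) + b(v) determines a and b only up to a constant, so a bound for f does not
  by itself bound a or b. The constant is fixed by making b vanish at the level of one point of K;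
  then a is controlled by its oscillation, which a chain of small balls bounds by the supremum of f.
  Derivatives of a and b of positive order need no such device, since they are combinations of
  derivatives of f. Mollification is preferred to multiplication by a smooth cutoff because the
  bound on M may only involve the supremum of f: all derivatives must fall on the kernel. Near K the
  same convolution is an average of translates, and there the derivatives may fall on a and b. X may
  be disconnected and int L may have infinitely many components. Only finitely many of these are
  needed to cover K, and their waves are summed separately on each component of X: one
  characteristic line can meet several components of X, and projections coming from different ones
  may overlap.\<close>

lemma partial_deriv_cong_open:
  assumes "open U" "x \<in> U" "\<And>y. y \<in> U \<Longrightarrow> f y = g y"
  shows "partial_deriv i f x = partial_deriv i g x"
proof -
  have "(f has_derivative D) (at x) \<longleftrightarrow> (g has_derivative D) (at x)" for D
    using assms by (metis has_derivative_transform_within_open)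
  then show ?thesis
    by (simp add: partial_deriv_def frechet_derivative_def)
qed

lemma iterated_partial_deriv_cong_open:
  assumes "open U" "x \<in> U" "\<And>y. y \<in> U \<Longrightarrow> f y = g y"
  shows "(partial_deriv i ^^ n) f x = (partial_deriv i ^^ n) g x"
  using assms(2)
proof (induction n arbitrary: x)
  case (Suc n)
  then show ?case
    using assms(1) by (auto intro: partial_deriv_cong_open)
qed (use assms in auto)

lemma has_partial_deriv:
  fixes f :: "real^'n::finite \<Rightarrow> complex"
  assumes "(f has_derivative D) (at x)"
  shows "partial_deriv i f x = D (axis i 1)"
  using assms by (metis frechet_derivative_at partial_deriv_def)

lemma has_derivative_partial_deriv_2:
  fixes f :: "real^2 \<Rightarrow> complex"
  assumes "f differentiable (at x)"
  shows "(f has_derivative (\<lambda>h. (h $ 1) *\<^sub>R partial_deriv 1 f x + (h $ 2) *\<^sub>R partial_deriv 2 f x)) (at x)"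
proof -
  let ?D = "frechet_derivative f (at x)"
  have D: "(f has_derivative ?D) (at x)"
    using assms frechet_derivative_works by blast
  have "?D h = (h $ 1) *\<^sub>R partial_deriv 1 f x + (h $ 2) *\<^sub>R partial_deriv 2 f x" for h
  proof -
    have "h = (h $ 1) *\<^sub>R axis 1 1 + (h $ 2) *\<^sub>R axis 2 1"
      by (simp add: vec_eq_iff forall_2 axis_def)
    then have "?D h = ?D ((h $ 1) *\<^sub>R axis 1 1 + (h $ 2) *\<^sub>R axis 2 1)"
      by (rule arg_cong)
    also have "\<dots> = (h $ 1) *\<^sub>R ?D (axis 1 1) + (h $ 2) *\<^sub>R ?D (axis 2 1)"
      by (simp only: linear_add[OF has_derivative_linear[OF D]] linear_scale[OF has_derivative_linear[OF D]])
    finally show ?thesis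
      by (simp only: partial_deriv_def)
  qed
  then show ?thesis
    by (intro has_derivative_eq_rhs[OF D] ext)
qed

lemma Ck_on_cong_open:
  assumes "open X" "\<And>y. y \<in> X \<Longrightarrow> f y = g y"
  shows "Ck_on k X f \<longleftrightarrow> Ck_on k X g"
  using assms(2)
proof (induction k arbitrary: f g)
  case 0
  then show ?case by (auto cong: continuous_on_cong)
next
  case (Suc k)
  have "f differentiable (at x) \<longleftrightarrow> g differentiable (at x)" if "x \<in> X" for x
  proof -
    have "(f has_derivative D) (at x) \<longleftrightarrow> (g has_derivative D) (at x)" for D
      using that Suc.prems assms(1) by (metis has_derivative_transform_within_open)
    then show ?thesis
      by (simp add: differentiable_def)
  qed
  moreover have "Ck_on k X (partial_deriv i f) \<longleftrightarrow> Ck_on k X (partial_deriv i g)" for i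
    by (rule Suc.IH) (rule partial_deriv_cong_open[OF assms(1)], use Suc.prems in auto)
  ultimately show ?case by simp
qed

text \<open>Allows a different formula for the function near each point, as is the case for the
  glued solution at the end.\<close>

lemma Ck_on_local:
  assumes "\<And>x. x \<in> X \<Longrightarrow> \<exists>U. open U \<and> x \<in> U \<and> Ck_on k U f"
  shows "Ck_on k X f"
  using assms
proof (induction k arbitrary: f)
  case 0
  have "isCont f x" if "x \<in> X" for x
    using 0[OF that] continuous_on_eq_continuous_at by fastforce
  then show ?case
    by (simp add: continuous_at_imp_continuous_on)
next
  case (Suc k)
  have "f differentiable (at x)" if "x \<in> X" for x
    using Suc.prems[OF that] by auto
  moreover have "Ck_on k X (partial_deriv i f)" for i
    by (rule Suc.IH) (use Suc.prems in force)
  ultimately show ?case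
    by simp
qed

lemma smooth_on_partial_deriv: "smooth_on X f \<Longrightarrow> smooth_on X (partial_deriv i f)"
  unfolding smooth_on_def by (metis Ck_on.simps(2))

lemma smooth_on_iterated_partial_deriv: "smooth_on X f \<Longrightarrow> smooth_on X ((partial_deriv i ^^ n) f)"
  by (induction n) (auto intro: smooth_on_partial_deriv)

lemma smooth_on_differentiable: "smooth_on X f \<Longrightarrow> x \<in> X \<Longrightarrow> f differentiable (at x)"
  unfolding smooth_on_def by (metis Ck_on.simps(2))

lemma smooth_on_continuous: "smooth_on X f \<Longrightarrow> continuous_on X f"
  unfolding smooth_on_def by (metis Ck_on.simps(1))

lemma mi_deriv_2:
  fixes f :: "real^2 \<Rightarrow> complex"
  shows "mi_deriv \<alpha> f = (partial_deriv 1 ^^ Poly_Mapping.lookup \<alpha> 1)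
    ((partial_deriv 2 ^^ Poly_Mapping.lookup \<alpha> 2) f)"
proof -
  have "sorted_list_of_set (UNIV :: 2 set) = [2, 1]"
  proof (rule sorted_list_of_set_unique[THEN iffD1])
    \<comment> \<open>In the two-element index type the numeral 2 is represented by 0 and so comes
      first; the derivatives in the second coordinate are therefore applied before those in the
      first.\<close>
    have "(2::2) < 1"
      by (simp add: less_bit0_def bit0.Rep_numeral bit0.Rep_1)
    then show "sorted_wrt (<) [2, 1::2] \<and> set [2, 1] = (UNIV :: 2 set) \<and> length [2, 1::2] = card (UNIV :: 2 set)"
      by (auto simp: UNIV_2)
  qed auto
  then show ?thesis
    by (simp add: mi_deriv_def)
qed

lemma mi_order_2: "mi_order (\<alpha> :: 2 \<Rightarrow>\<^sub>0 nat) = Poly_Mapping.lookup \<alpha> 1 + Poly_Mapping.lookup \<alpha> 2"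
  by (simp add: mi_order_def sum_2)

lemma multi_index_2: "\<exists>\<alpha> :: 2 \<Rightarrow>\<^sub>0 nat. Poly_Mapping.lookup \<alpha> 1 = i \<and> Poly_Mapping.lookup \<alpha> 2 = j"
  by (rule exI[where x = "Poly_Mapping.single 1 i + Poly_Mapping.single 2 j"])
    (simp add: lookup_add lookup_single)

lemma smooth_on_mi_deriv:
  fixes f :: "real^2 \<Rightarrow> complex"
  shows "smooth_on X f \<Longrightarrow> smooth_on X (mi_deriv \<alpha> f)"
  by (simp add: mi_deriv_2 smooth_on_iterated_partial_deriv)

lemma mi_deriv_cong_open:
  fixes f :: "real^2 \<Rightarrow> complex"
  assumes "open U" "x \<in> U" "\<And>y. y \<in> U \<Longrightarrow> f y = g y"
  shows "mi_deriv \<alpha> f x = mi_deriv \<alpha> g x"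
  unfolding mi_deriv_2
  by (rule iterated_partial_deriv_cong_open[OF assms(1,2)])
    (rule iterated_partial_deriv_cong_open[OF assms(1)], use assms(3) in auto)

section \<open>Bounds through the seminorms\<close>

lemma finite_mi_order_le: "finite {\<alpha> :: 2 \<Rightarrow>\<^sub>0 nat. mi_order \<alpha> \<le> r}"
proof (rule finite_imageD)
  let ?f = "\<lambda>\<alpha> :: 2 \<Rightarrow>\<^sub>0 nat. (Poly_Mapping.lookup \<alpha> 1, Poly_Mapping.lookup \<alpha> 2)"
  have "?f ` {\<alpha>. mi_order \<alpha> \<le> r} \<subseteq> {..r} \<times> {..r}"
    by (auto simp: mi_order_2)
  then show "finite (?f ` {\<alpha>. mi_order \<alpha> \<le> r})"
    by (rule finite_subset) simp
  have "\<alpha> = \<beta>" if "?f \<alpha> = ?f \<beta>" for \<alpha> \<beta>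
  proof (rule poly_mapping_eqI)
    fix k :: 2
    show "Poly_Mapping.lookup \<alpha> k = Poly_Mapping.lookup \<beta> k"
      using exhaust_2[of k] that by auto
  qed
  then show "inj_on ?f {\<alpha>. mi_order \<alpha> \<le> r}"
    by (rule inj_onI)
qed

text \<open>An upper bound by \<open>Sup\<close> requires the set to be bounded: finitely many
  multi-indices occur, and each derivative is continuous on the compact set.\<close>

lemma seminorm_upper:
  fixes f :: "real^2 \<Rightarrow> complex"
  assumes "smooth_on Y f" "compact L" "L \<subseteq> Y" "x \<in> L" "mi_order \<alpha> \<le> r"
  shows "cmod (mi_deriv \<alpha> f x) \<le> seminorm L r f"
proof -
  let ?S = "{cmod (mi_deriv \<alpha> f x) | x \<alpha>. x \<in> L \<and> mi_order \<alpha> \<le> r}"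
  have eq: "?S = (\<Union>\<alpha>\<in>{\<alpha>. mi_order \<alpha> \<le> r}. (\<lambda>x. cmod (mi_deriv \<alpha> f x)) ` L)"
    by auto
  have "bdd_above ((\<lambda>x. cmod (mi_deriv \<alpha> f x)) ` L)" for \<alpha>
    using assms smooth_on_continuous[OF smooth_on_mi_deriv[OF assms(1)]]
    by (intro bounded_imp_bdd_above compact_imp_bounded compact_continuous_image)
      (auto intro!: continuous_intros intro: continuous_on_subset)
  then have "bdd_above ?S"
    unfolding eq by (simp add: finite_mi_order_le)
  then show ?thesis
    unfolding seminorm_def using assms by (intro cSup_upper) auto
qed

lemma seminorm_least:
  assumes "0 \<le> B" "\<And>x \<alpha>. x \<in> K \<Longrightarrow> mi_order \<alpha> \<le> r \<Longrightarrow> cmod (mi_deriv \<alpha> f x) \<le> B"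
  shows "seminorm K r f \<le> B"
  unfolding seminorm_def using assms by (intro cSup_least) auto

lemma seminorm_nonneg:
  fixes f :: "real^2 \<Rightarrow> complex"
  assumes "smooth_on Y f" "compact L" "L \<subseteq> Y"
  shows "0 \<le> seminorm L r f"
proof (cases "L = {}")
  case True
  then show ?thesis by (simp add: seminorm_def)
next
  case False
  then obtain x where "x \<in> L" by auto
  then have "cmod (mi_deriv 0 f x) \<le> seminorm L r f"
    using assms by (intro seminorm_upper) (auto simp: mi_order_def)
  then show ?thesis
    by (meson norm_ge_zero order_trans)
qed

lemma mi_deriv_zero: "mi_deriv 0 (f :: real^2 \<Rightarrow> complex) = f"
  by (simp add: mi_deriv_2)

section \<open>Line derivatives, mixed partials and functions of a characteristic variable\<close>

lemma has_vector_derivative_line: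
  fixes f :: "real^2 \<Rightarrow> complex"
  assumes "f differentiable (at (p + t *\<^sub>R d))"
  shows "((\<lambda>t. f (p + t *\<^sub>R d)) has_vector_derivative
    (d $ 1) *\<^sub>R partial_deriv 1 f (p + t *\<^sub>R d) + (d $ 2) *\<^sub>R partial_deriv 2 f (p + t *\<^sub>R d)) (at t)"
proof -
  have 1: "((\<lambda>t. p + t *\<^sub>R d) has_derivative (\<lambda>h. h *\<^sub>R d)) (at t)"
    by (auto intro!: derivative_eq_intros)
  show ?thesis
    unfolding has_vector_derivative_def
    using has_derivative_compose[OF 1 has_derivative_partial_deriv_2[OF assms]]
    by (simp add: scaleR_add_right)
qed

text \<open>\<open>Ck_on\<close> does not build in the symmetry of mixed partials. The increment of
  f in the second direction is an integral of the second partial; differentiating it in the first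
  direction under the integral sign, and then in the second direction at the base point, exchanges
  the two derivatives.\<close>

lemma partial_deriv_commute:
  fixes f :: "real^2 \<Rightarrow> complex"
  assumes "open Y" "smooth_on Y f" "x \<in> Y"
  shows "partial_deriv 2 (partial_deriv 1 f) x = partial_deriv 1 (partial_deriv 2 f) x"
proof -
  let ?e1 = "axis 1 1 :: real^2" and ?e2 = "axis 2 1 :: real^2"
  let ?f1 = "partial_deriv 1 f" and ?f2 = "partial_deriv 2 f"
  let ?f12 = "partial_deriv 1 ?f2" and ?f21 = "partial_deriv 2 ?f1"
  note sm = smooth_on_partial_deriv[OF assms(2), of 1] smooth_on_partial_deriv[OF assms(2), of 2]
  note sm' = smooth_on_partial_deriv[OF sm(2), of 1]
  obtain R where R: "0 < R" "cball x R \<subseteq> Y"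
    using assms open_contains_cball by blast
  \<comment> \<open>Half the radius, so that all points \<open>pt s t\<close> with both parameters
    at most \<open>r\<close> in absolute value lie in the ball.\<close>
  define r where "r = R / 2"
  have r: "0 < r" using R by (simp add: r_def)
  define pt where "pt s t = x + s *\<^sub>R ?e1 + t *\<^sub>R ?e2" for s t
  have ptY: "pt s t \<in> Y" if "\<bar>s\<bar> \<le> r" "\<bar>t\<bar> \<le> r" for s t
  proof -
    have "norm (s *\<^sub>R ?e1 + t *\<^sub>R ?e2) \<le> norm (s *\<^sub>R ?e1) + norm (t *\<^sub>R ?e2)"
      by (rule norm_triangle_ineq)
    also have "\<dots> \<le> R"
      using that by (simp add: r_def norm_axis_1)
    finally have "norm (s *\<^sub>R ?e1 + t *\<^sub>R ?e2) \<le> R" .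
    moreover have "dist x (x + z) = norm z" for z
      by (simp add: dist_norm)
    ultimately have "pt s t \<in> cball x R"
      by (simp only: pt_def add.assoc mem_cball)
    then show ?thesis using R by blast
  qed
  have cont: "continuous_on S (\<lambda>z. g (pt (a z) (b z)))"
    if "continuous_on Y g" "continuous_on S a" "continuous_on S b"
      "\<And>z. z \<in> S \<Longrightarrow> \<bar>a z\<bar> \<le> r \<and> \<bar>b z\<bar> \<le> r"
    for g :: "real^2 \<Rightarrow> complex" and S and a b :: "'b::topological_space \<Rightarrow> real"
    by (rule continuous_on_compose2[OF that(1)])
      (use that ptY in \<open>auto simp: pt_def intro!: continuous_intros\<close>)
  have d2: "((\<lambda>t. g (pt s t)) has_vector_derivative partial_deriv 2 g (pt s t)) (at t within T)"
    if "smooth_on Y g" "\<bar>s\<bar> \<le> r" "\<bar>t\<bar> \<le> r" for g s t T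
    using has_vector_derivative_line[of g "x + s *\<^sub>R ?e1" t ?e2]
      smooth_on_differentiable[OF that(1) ptY[OF that(2,3)]]
    by (auto simp: pt_def axis_def intro: has_vector_derivative_at_within)
  have d1: "((\<lambda>s. g (pt s t)) has_vector_derivative partial_deriv 1 g (pt s t)) (at s within T)"
    if "smooth_on Y g" "\<bar>s\<bar> \<le> r" "\<bar>t\<bar> \<le> r" for g s t T
    using has_vector_derivative_line[of g "x + t *\<^sub>R ?e2" s ?e1]
      smooth_on_differentiable[OF that(1) ptY[OF that(2,3)]]
    by (auto simp: pt_def axis_def algebra_simps intro: has_vector_derivative_at_within)
  have ftc: "integral {0..t} (\<lambda>\<tau>. ?f2 (pt s \<tau>)) = f (pt s t) - f (pt s 0)"
    if "t \<in> {0..r}" "s \<in> {-r..r}" for s t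
    using that assms(2) by (intro integral_unique fundamental_theorem_of_calculus d2) auto
  have f1: "?f1 (pt 0 t) - ?f1 (pt 0 0) = integral {0..t} (\<lambda>\<tau>. ?f12 (pt 0 \<tau>))" if t: "t \<in> {0..r}" for t
  proof -
    \<comment> \<open>The increment is differentiated in s twice, here under the integral sign and
      afterwards term by term; uniqueness of the derivative gives the identity.\<close>
    have "((\<lambda>s. integral (cbox 0 t) (\<lambda>\<tau>. ?f2 (pt s \<tau>))) has_vector_derivative
        integral (cbox 0 t) (\<lambda>\<tau>. ?f12 (pt 0 \<tau>))) (at 0 within {-r..r})"
    proof (rule leibniz_rule_vector_derivative)
      show "((\<lambda>s. ?f2 (pt s \<tau>)) has_vector_derivative ?f12 (pt s \<tau>)) (at s within {-r..r})"
        if "s \<in> {-r..r}" "\<tau> \<in> cbox 0 t" for s \<tau>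
        using that t sm by (intro d1) auto
      show "(\<lambda>\<tau>. ?f2 (pt s \<tau>)) integrable_on cbox 0 t" if "s \<in> {-r..r}" for s
        using that t sm by (intro integrable_continuous cont smooth_on_continuous) auto
      show "continuous_on ({-r..r} \<times> cbox 0 t) (\<lambda>(s, \<tau>). ?f12 (pt s \<tau>))"
        unfolding split_beta
        using t sm' by (intro cont smooth_on_continuous) (auto intro!: continuous_intros)
    qed (use r in auto)
    from this[unfolded cbox_interval] have "((\<lambda>s. f (pt s t) - f (pt s 0)) has_vector_derivative
        integral {0..t} (\<lambda>\<tau>. ?f12 (pt 0 \<tau>))) (at 0 within {-r..r})"
      by (rule has_vector_derivative_transform[rotated 2]) (use r ftc[OF t] in auto)
    moreover have "((\<lambda>s. f (pt s t) - f (pt s 0)) has_vector_derivative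
        ?f1 (pt 0 t) - ?f1 (pt 0 0)) (at 0 within {-r..r})"
      using r t assms(2) by (intro has_vector_derivative_diff d1) auto
    ultimately show ?thesis
      using r vector_derivative_unique_within_closed_interval[of "-r" r 0] by auto
  qed
  \<comment> \<open>Both sides of \<open>f1\<close> are differentiated at t = 0; one-sided
    derivatives suffice, being unique on a nondegenerate interval.\<close>
  have "((\<lambda>t. integral {0..t} (\<lambda>\<tau>. ?f12 (pt 0 \<tau>))) has_vector_derivative ?f12 (pt 0 0)) (at 0 within {0..r})"
    using r sm' by (intro integral_has_vector_derivative cont smooth_on_continuous)
      (auto intro!: continuous_intros)
  then have "((\<lambda>t. ?f1 (pt 0 t) - ?f1 (pt 0 0)) has_vector_derivative ?f12 (pt 0 0)) (at 0 within {0..r})"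
    by (rule has_vector_derivative_transform[rotated 2]) (use r f1 in auto)
  moreover have "((\<lambda>t. ?f1 (pt 0 t) - ?f1 (pt 0 0)) has_vector_derivative ?f21 (pt 0 0) - 0) (at 0 within {0..r})"
    using r sm by (intro has_vector_derivative_diff d2 has_vector_derivative_const) auto
  ultimately have "?f12 (pt 0 0) = ?f21 (pt 0 0)"
    using r vector_derivative_unique_within_closed_interval[of 0 r 0] by auto
  then show ?thesis
    by (simp add: pt_def)
qed

lemma Ck_on_lincomb:
  assumes "open X"
  shows "Ck_on k X f \<Longrightarrow> Ck_on k X g \<Longrightarrow> Ck_on k X (\<lambda>x. a * f x + b * g x)"
proof (induction k arbitrary: f g)
  case 0
  then show ?case by (auto intro!: continuous_intros)
next
  case (Suc k)
  have D: "((\<lambda>x. a * f x + b * g x) has_derivative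
      (\<lambda>h. a * frechet_derivative f (at x) h + b * frechet_derivative g (at x) h)) (at x)"
    if "x \<in> X" for x
    using Suc.prems that frechet_derivative_works
    by (intro has_derivative_add has_derivative_mult_right) auto
  then have "partial_deriv i (\<lambda>x. a * f x + b * g x) x = a * partial_deriv i f x + b * partial_deriv i g x"
    if "x \<in> X" for x i
    using has_partial_deriv[OF D[OF that], of i] by (simp add: partial_deriv_def)
  then have "Ck_on k X (partial_deriv i (\<lambda>x. a * f x + b * g x)) \<longleftrightarrow>
      Ck_on k X (\<lambda>x. a * partial_deriv i f x + b * partial_deriv i g x)" for i
    by (rule Ck_on_cong_open[OF assms])
  moreover have "(\<lambda>x. a * f x + b * g x) differentiable (at x)" if "x \<in> X" for x
    using D[OF that] by (auto simp: differentiable_def)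
  ultimately show ?case
    using Suc by simp
qed

lemma smooth_on_lincomb:
  "open X \<Longrightarrow> smooth_on X f \<Longrightarrow> smooth_on X g \<Longrightarrow> smooth_on X (\<lambda>x. a * f x + b * g x)"
  by (simp add: smooth_on_def Ck_on_lincomb)

section \<open>Smooth functions of one characteristic variable\<close>

text \<open>A smooth function carried together with all its derivatives, so that the n-th derivative
  is an entry of a sequence and mollifications can be specified at all orders at once.\<close>

definition deriv_seq :: "real set \<Rightarrow> (nat \<Rightarrow> real \<Rightarrow> complex) \<Rightarrow> bool" where
  "deriv_seq T G \<longleftrightarrow> (\<forall>n. \<forall>t\<in>T. (G n has_vector_derivative G (Suc n) t) (at t))"

text \<open>The values \<sigma> = 1 and \<sigma> = -1 give the characteristic variables u and v,
  whose level lines are the two families of characteristics; the parameter lets one argument serve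
  both.\<close>

definition lev :: "real \<Rightarrow> real^2 \<Rightarrow> real" where
  "lev \<sigma> x = x $ 1 + \<sigma> * x $ 2"

lemma bounded_linear_lev: "bounded_linear (lev \<sigma>)"
  unfolding lev_def[abs_def] by (auto intro!: bounded_linear_intros)

lemma continuous_on_lev: "continuous_on S (lev \<sigma>)"
  by (simp add: bounded_linear_lev linear_continuous_on)

lemma open_lev_image: "open W \<Longrightarrow> open (lev \<sigma> ` W)"
proof (rule open_surjective_linear_image)
  show "surj (lev \<sigma>)"
    by (rule surjI[of _ "\<lambda>u. vector [u, 0]"]) (simp add: lev_def)
qed (use bounded_linear_lev bounded_linear.linear in auto)

lemma lev_add_scale: "lev \<sigma> (x + c *\<^sub>R y) = lev \<sigma> x + c * lev \<sigma> y"
  by (simp add: lev_def algebra_simps)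

text \<open>The derivative of \<open>\<beta>\<close> at the level of a point is a directional
  derivative of its lift \<open>D\<close> there. This is again smooth and again depends on the level
  only, so the argument iterates.\<close>

lemma deriv_seq_of_level_function:
  fixes D :: "real^2 \<Rightarrow> complex"
  assumes W: "open W" and \<sigma>: "\<sigma>\<^sup>2 = 1" and D: "smooth_on W D" "\<And>x. x \<in> W \<Longrightarrow> D x = \<beta> (lev \<sigma> x)"
  shows "\<exists>G. G 0 = \<beta> \<and> deriv_seq (lev \<sigma> ` W) G"
proof -
  define G where "G n = ((\<lambda>g u. vector_derivative g (at u)) ^^ n) \<beta>" for n
  \<comment> \<open>Moving along \<open>e\<close> raises the level at unit speed, which turns the
    derivative of a function of the level into a directional derivative on \<open>W\<close>.\<close>
  define e :: "real^2" where "e = vector [1/2, \<sigma>/2]"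
  have e: "lev \<sigma> e = 1"
    using \<sigma> by (simp add: e_def lev_def power2_eq_square)
  have step: "(g has_vector_derivative (1/2) * partial_deriv 1 E x + (\<sigma>/2) * partial_deriv 2 E x) (at (lev \<sigma> x))"
    if E: "smooth_on W E" "\<And>x. x \<in> W \<Longrightarrow> E x = g (lev \<sigma> x)" and x: "x \<in> W" for E g x
  proof -
    define T where "T = (\<lambda>u. x + (u - lev \<sigma> x) *\<^sub>R e) -` W"
    have T: "open T"
      unfolding T_def using W by (intro open_vimage) (auto intro!: continuous_intros)
    have "((\<lambda>t. E (x + t *\<^sub>R e)) has_vector_derivative
        (e $ 1) *\<^sub>R partial_deriv 1 E x + (e $ 2) *\<^sub>R partial_deriv 2 E x) (at 0)"
      using has_vector_derivative_line[of E x 0 e] smooth_on_differentiable[OF E(1) x] by simp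
    then have "((\<lambda>t. E (x + t *\<^sub>R e)) has_vector_derivative
        (1/2) * partial_deriv 1 E x + (\<sigma>/2) * partial_deriv 2 E x) (at (lev \<sigma> x - lev \<sigma> x))"
      by (simp add: e_def scaleR_conv_of_real)
    moreover have "((\<lambda>u. u - lev \<sigma> x) has_vector_derivative 1) (at (lev \<sigma> x))"
      by (auto intro!: derivative_eq_intros)
    ultimately have "((\<lambda>u. E (x + (u - lev \<sigma> x) *\<^sub>R e)) has_vector_derivative
        (1/2) * partial_deriv 1 E x + (\<sigma>/2) * partial_deriv 2 E x) (at (lev \<sigma> x))"
      using vector_diff_chain_at[of "\<lambda>u. u - lev \<sigma> x" 1 "lev \<sigma> x" "\<lambda>t. E (x + t *\<^sub>R e)"]
      by (simp add: o_def)
    then show ?thesis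
      by (rule has_vector_derivative_transform_within_open[OF _ T])
        (use x E(2) e in \<open>auto simp: T_def lev_add_scale\<close>)
  qed
  \<comment> \<open>The induction carries a smooth lift to \<open>W\<close>; its existence is what
    makes the next derivative available.\<close>
  have lift: "\<exists>E. smooth_on W E \<and> (\<forall>x\<in>W. E x = G n (lev \<sigma> x))" for n
  proof (induction n)
    case 0
    then show ?case using D by (auto simp: G_def)
  next
    case (Suc n)
    then obtain E where E: "smooth_on W E" "\<And>x. x \<in> W \<Longrightarrow> E x = G n (lev \<sigma> x)"
      by auto
    have "G (Suc n) (lev \<sigma> x) = (1/2) * partial_deriv 1 E x + (\<sigma>/2) * partial_deriv 2 E x"
      if "x \<in> W" for x
      using vector_derivative_at[OF step[OF E that]] by (simp add: G_def)
    moreover have "smooth_on W (\<lambda>x. (1/2) * partial_deriv 1 E x + (\<sigma>/2) * partial_deriv 2 E x)"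
      by (intro smooth_on_lincomb W smooth_on_partial_deriv E)
    ultimately show ?case
      by (intro exI[of _ "\<lambda>x. (1/2) * partial_deriv 1 E x + (\<sigma>/2) * partial_deriv 2 E x"]) auto
  qed
  have "(G n has_vector_derivative G (Suc n) (lev \<sigma> x)) (at (lev \<sigma> x))" if "x \<in> W" for n x
  proof -
    obtain E where E: "smooth_on W E" "\<And>x. x \<in> W \<Longrightarrow> E x = G n (lev \<sigma> x)"
      using lift by blast
    have "G (Suc n) (lev \<sigma> x) = vector_derivative (G n) (at (lev \<sigma> x))"
      by (simp add: G_def)
    with step[OF E that] show ?thesis
      by (simp add: vector_derivative_at)
  qed
  then show ?thesis
    by (intro exI[of _ G]) (auto simp: deriv_seq_def G_def)
qed

lemma open_connected_primitive:
  fixes g :: "real \<Rightarrow> 'a::euclidean_space"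
  assumes "open T" "connected T" "continuous_on T g"
  shows "\<exists>F. \<forall>u\<in>T. (F has_vector_derivative g u) (at u)"
proof (cases "T = {}")
  case False
  then obtain c where c: "c \<in> T" by auto
  have "((\<lambda>u. LBINT y=c..u. g y) has_vector_derivative g u) (at u)" if u: "u \<in> T" for u
  proof -
    obtain r where r: "0 < r" "cball u r \<subseteq> T"
      using assms u open_contains_cball by blast
    \<comment> \<open>The interval contains both the fixed base point \<open>c\<close> and a
      neighbourhood of \<open>u\<close>, so the one-sided fundamental theorem yields a two-sided
      derivative at \<open>u\<close>.\<close>
    define a b where "a = min c (u - r)" and "b = max c (u + r)"
    have "u - r \<in> T" "u + r \<in> T"
      using r by (auto simp: subset_iff dist_real_def)
    then have "a \<in> T" "b \<in> T"
      using c by (auto simp: a_def b_def min_def max_def)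
    then have "{a..b} \<subseteq> T"
      using assms(2) by (rule_tac connected_contains_Icc)
    then have "((\<lambda>u. LBINT y=c..u. g y) has_vector_derivative g u) (at u within {a..b})"
      using r by (intro interval_integral_FTC2 continuous_on_subset[OF assms(3)]) (auto simp: a_def b_def)
    moreover have "at u within {a..b} = at u"
      using r by (intro at_within_Icc_at) (auto simp: a_def b_def)
    ultimately show ?thesis by simp
  qed
  then show ?thesis by blast
qed auto

section \<open>Decomposition of solutions into travelling waves\<close>

lemma has_derivative_level_function:
  assumes "(g has_vector_derivative g') (at (lev \<sigma> x))"
  shows "((\<lambda>x. g (lev \<sigma> x)) has_derivative (\<lambda>h. lev \<sigma> h *\<^sub>R g')) (at x)"
  using has_derivative_compose[OF bounded_linear_imp_has_derivative[OF bounded_linear_lev]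
      assms[unfolded has_vector_derivative_def]] .

lemma lev_axis [simp]: "lev \<sigma> (axis 1 1) = 1" "lev \<sigma> (axis 2 1) = \<sigma>"
  by (auto simp: lev_def axis_def)

text \<open>The factor \<open>c\<close> collects the signs that \<open>\<partial>\<^sub>2\<close> produces on functions of \<open>x\<^sub>1 - x\<^sub>2\<close>.\<close>

definition wave_sum ::
  "(nat \<Rightarrow> real \<Rightarrow> complex) \<Rightarrow> (nat \<Rightarrow> real \<Rightarrow> complex) \<Rightarrow> nat \<Rightarrow> complex \<Rightarrow> real^2 \<Rightarrow> complex" where
  "wave_sum G H n c x = G n (lev 1 x) + c * H n (lev (-1) x)"

context
  fixes W :: "(real^2) set" and G H :: "nat \<Rightarrow> real \<Rightarrow> complex"
  assumes W: "open W" and G: "deriv_seq (lev 1 ` W) G" and H: "deriv_seq (lev (-1) ` W) H"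
begin

lemma wave_sum_has_derivative:
  assumes "x \<in> W"
  shows "(wave_sum G H n c has_derivative
    (\<lambda>h. lev 1 h *\<^sub>R G (Suc n) (lev 1 x) + c * (lev (-1) h *\<^sub>R H (Suc n) (lev (-1) x)))) (at x)"
  unfolding wave_sum_def[abs_def]
  using assms G H by (intro has_derivative_add has_derivative_mult_right has_derivative_level_function)
    (auto simp: deriv_seq_def)

lemma partial_deriv_wave_sum:
  assumes "x \<in> W"
  shows "partial_deriv 1 (wave_sum G H n c) x = wave_sum G H (Suc n) c x"
    and "partial_deriv 2 (wave_sum G H n c) x = wave_sum G H (Suc n) (- c) x"
  by (simp_all add: has_partial_deriv[OF wave_sum_has_derivative[OF assms]] wave_sum_def)

text \<open>Both partial derivatives stay in the family of wave sums with a shifted index and a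
  changed sign, so the induction runs over all \<open>n\<close> and \<open>c\<close>
  simultaneously.\<close>

lemma Ck_on_wave_sum: "Ck_on k W (wave_sum G H n c)"
proof (induction k arbitrary: n c)
  case 0
  have "isCont (wave_sum G H n c) x" if "x \<in> W" for x
    using wave_sum_has_derivative[OF that] has_derivative_continuous by blast
  then show ?case
    by (simp add: continuous_at_imp_continuous_on)
next
  case (Suc k)
  have "wave_sum G H n c differentiable (at x)" if "x \<in> W" for x
    using wave_sum_has_derivative[OF that] differentiable_def by blast
  moreover have "Ck_on k W (partial_deriv i (wave_sum G H n c))" for i
  proof (cases "i = 1")
    case True
    then show ?thesis
      using Ck_on_cong_open[OF W, of "partial_deriv 1 (wave_sum G H n c)"] Suc.IH
        partial_deriv_wave_sum(1) by blast
  next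
    case False
    then have "i = 2" using exhaust_2[of i] by auto
    then show ?thesis
      using Ck_on_cong_open[OF W, of "partial_deriv 2 (wave_sum G H n c)"] Suc.IH
        partial_deriv_wave_sum(2) by blast
  qed
  ultimately show ?case by simp
qed

lemma smooth_on_wave_sum: "smooth_on W (wave_sum G H n c)"
  by (simp add: smooth_on_def Ck_on_wave_sum)

lemma iterated_partial_deriv_wave_sum:
  assumes "x \<in> W"
  shows "(partial_deriv 1 ^^ i) ((partial_deriv 2 ^^ j) (wave_sum G H n c)) x =
    wave_sum G H (n + i + j) ((- 1) ^ j * c) x"
proof -
  have 2: "(partial_deriv 2 ^^ j) (wave_sum G H n c) x = wave_sum G H (n + j) ((- 1) ^ j * c) x"
    if "x \<in> W" for x
    using that
  proof (induction j arbitrary: x)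
    case (Suc j)
    have "partial_deriv 2 ((partial_deriv 2 ^^ j) (wave_sum G H n c)) x =
        partial_deriv 2 (wave_sum G H (n + j) ((- 1) ^ j * c)) x"
      by (rule partial_deriv_cong_open[OF W Suc.prems Suc.IH])
    with Suc.prems show ?case
      by (simp add: partial_deriv_wave_sum)
  qed simp
  show ?thesis
    using assms
  proof (induction i arbitrary: x)
    case 0
    then show ?case by (simp add: 2)
  next
    case (Suc i)
    have "partial_deriv 1 ((partial_deriv 1 ^^ i) ((partial_deriv 2 ^^ j) (wave_sum G H n c))) x =
        partial_deriv 1 (wave_sum G H (n + i + j) ((- 1) ^ j * c)) x"
      by (rule partial_deriv_cong_open[OF W Suc.prems Suc.IH])
    with Suc.prems show ?case
      by (simp add: partial_deriv_wave_sum)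
  qed
qed

lemma mi_deriv_wave_sum:
  assumes "x \<in> W"
  shows "mi_deriv \<alpha> (wave_sum G H 0 1) x =
    wave_sum G H (mi_order \<alpha>) ((- 1) ^ Poly_Mapping.lookup \<alpha> 2) x"
  using iterated_partial_deriv_wave_sum[OF assms, where n = 0 and c = 1]
  by (simp add: mi_deriv_2 mi_order_2)

end

lemma smooth_on_cong_open:
  "open X \<Longrightarrow> (\<And>x. x \<in> X \<Longrightarrow> f x = g x) \<Longrightarrow> smooth_on X f \<longleftrightarrow> smooth_on X g"
  unfolding smooth_on_def using Ck_on_cong_open[of X f g] by auto

lemma deriv_seq_subset: "deriv_seq T G \<Longrightarrow> S \<subseteq> T \<Longrightarrow> deriv_seq S G"
  by (auto simp: deriv_seq_def)

lemma kernel_space_wave_iff: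
  "f \<in> kernel_space wave_poly Y \<longleftrightarrow> smooth_on Y f \<and>
    (\<forall>x\<in>Y. partial_deriv 1 (partial_deriv 1 f) x = partial_deriv 2 (partial_deriv 2 f) x)"
  by (auto simp: kernel_space_def diff_op_wave_poly)

text \<open>The first-order equation says that the derivative of \<open>D\<close> along the level
  lines of \<open>lev \<sigma>\<close> vanishes.\<close>

lemma constant_on_segment:
  fixes D :: "real^2 \<Rightarrow> complex"
  assumes "open W" "smooth_on W D" "closed_segment p q \<subseteq> W" "lev \<sigma> p = lev \<sigma> q" "\<sigma>\<^sup>2 = 1"
    and eq: "\<And>x. x \<in> W \<Longrightarrow> partial_deriv 1 D x = \<sigma> * partial_deriv 2 D x"
  shows "D p = D q"
proof -
  define d where "d = q - p"
  have "\<sigma> * (\<sigma> * d $ 2) = d $ 2"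
    using \<open>\<sigma>\<^sup>2 = 1\<close> by (simp add: power2_eq_square mult.assoc[symmetric])
  moreover have "d $ 1 = - \<sigma> * d $ 2"
    using assms(4) by (simp add: lev_def d_def algebra_simps)
  ultimately have d: "complex_of_real (d $ 1) * \<sigma> + d $ 2 = 0"
    by (simp add: algebra_simps flip: of_real_mult of_real_add)
  have "((\<lambda>t. D (p + t *\<^sub>R d)) has_vector_derivative 0) (at t within {0..1})"
    if t: "t \<in> {0..1}" for t
  proof -
    have "p + t *\<^sub>R d \<in> closed_segment p q"
      using t by (auto simp: closed_segment_def d_def algebra_simps intro!: exI[of _ t])
    then have x: "p + t *\<^sub>R d \<in> W" using assms by blast
    have "(d $ 1) *\<^sub>R partial_deriv 1 D (p + t *\<^sub>R d) + (d $ 2) *\<^sub>R partial_deriv 2 D (p + t *\<^sub>R d)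
        = (complex_of_real (d $ 1) * \<sigma> + d $ 2) * partial_deriv 2 D (p + t *\<^sub>R d)"
      unfolding eq[OF x] by (simp add: scaleR_conv_of_real algebra_simps)
    then show ?thesis
      using has_vector_derivative_line[OF smooth_on_differentiable[OF assms(2) x]] d
      by (auto intro: has_vector_derivative_at_within)
  qed
  then obtain c where c: "\<And>t. t \<in> {0..1} \<Longrightarrow> D (p + t *\<^sub>R d) = c"
    using has_vector_derivative_zero_constant[of "{0..1}" "\<lambda>t. D (p + t *\<^sub>R d)"] by auto
  have "D (p + 0 *\<^sub>R d) = D (p + 1 *\<^sub>R d)"
    using c[of 0] c[of 1] by simp
  then show ?thesis by (simp add: d_def)
qed

definition char_convex :: "(real^2) set \<Rightarrow> bool" where
  "char_convex W \<longleftrightarrow> (\<forall>\<sigma>\<in>{1, -1}. \<forall>p\<in>W. \<forall>q\<in>W. lev \<sigma> p = lev \<sigma> q \<longrightarrow> closed_segment p q \<subseteq> W)"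

lemma char_convexD:
  "char_convex W \<Longrightarrow> \<sigma> = 1 \<or> \<sigma> = -1 \<Longrightarrow> p \<in> W \<Longrightarrow> q \<in> W \<Longrightarrow> lev \<sigma> p = lev \<sigma> q \<Longrightarrow> closed_segment p q \<subseteq> W"
  unfolding char_convex_def by blast

text \<open>The wave equation factors: each half-sum \<open>(1/2) * partial_deriv 1 f x +
  (\<sigma>/2) * partial_deriv 2 f x\<close> is annihilated by the opposite first-order factor,
  hence is a function of \<open>lev \<sigma>\<close> alone. Primitives of these two functions give
  the travelling waves up to a constant. The normalisation at \<open>x0\<close> fixes this constant
  for the later estimates.\<close>

lemma wave_decomposition:
  assumes W: "open W" "connected W" "char_convex W" and x0: "x0 \<in> W"
    and f: "f \<in> kernel_space wave_poly W"
  obtains G H where "deriv_seq (lev 1 ` W) G" "deriv_seq (lev (-1) ` W) H"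
    "\<And>x. x \<in> W \<Longrightarrow> f x = wave_sum G H 0 1 x" "H 0 (lev (-1) x0) = 0"
proof -
  have sf: "smooth_on W f"
    and wv: "\<And>x. x \<in> W \<Longrightarrow> partial_deriv 1 (partial_deriv 1 f) x = partial_deriv 2 (partial_deriv 2 f) x"
    using f by (auto simp: kernel_space_wave_iff)
  note sm = smooth_on_partial_deriv[OF sf, of 1] smooth_on_partial_deriv[OF sf, of 2]
  have half: "\<exists>A. deriv_seq (lev \<sigma> ` W) A \<and>
      (\<forall>x\<in>W. A 1 (lev \<sigma> x) = (1/2) * partial_deriv 1 f x + (\<sigma>/2) * partial_deriv 2 f x)"
    if \<sigma>: "\<sigma> = 1 \<or> \<sigma> = -1" for \<sigma> :: real
  proof -
    let ?D = "\<lambda>x. (1/2) * partial_deriv 1 f x + (\<sigma>/2) * partial_deriv 2 f x"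
    have \<sigma>2: "\<sigma>\<^sup>2 = 1" using \<sigma> by auto
    have sD: "smooth_on W ?D"
      by (intro smooth_on_lincomb W sm)
    have pD: "partial_deriv i ?D x = (1/2) * partial_deriv i (partial_deriv 1 f) x
        + (\<sigma>/2) * partial_deriv i (partial_deriv 2 f) x" if x: "x \<in> W" for i x
    proof -
      have "(?D has_derivative (\<lambda>h. (1/2) * frechet_derivative (partial_deriv 1 f) (at x) h
          + (\<sigma>/2) * frechet_derivative (partial_deriv 2 f) (at x) h)) (at x)"
        using sm x by (intro has_derivative_add has_derivative_mult_right)
          (meson smooth_on_differentiable frechet_derivative_works)+
      from has_partial_deriv[OF this, of i] show ?thesis
        by (simp add: partial_deriv_def)
    qed
    have eq: "partial_deriv 1 ?D x = \<sigma> * partial_deriv 2 ?D x" if x: "x \<in> W" for x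
      using \<sigma> pD[OF x] wv[OF x] partial_deriv_commute[OF W(1) sf x]
      by (auto simp: algebra_simps)
    \<comment> \<open>Any point of the level may be chosen: two of them are joined by a segment in
      \<open>W\<close>, along which \<open>?D\<close> is constant.\<close>
    define \<beta> where "\<beta> u = ?D (SOME x. x \<in> W \<and> lev \<sigma> x = u)" for u
    have \<beta>: "?D x = \<beta> (lev \<sigma> x)" if x: "x \<in> W" for x
    proof -
      let ?y = "SOME y. y \<in> W \<and> lev \<sigma> y = lev \<sigma> x"
      have y: "?y \<in> W \<and> lev \<sigma> ?y = lev \<sigma> x"
        by (rule someI[of _ x]) (use x in auto)
      then have "closed_segment x ?y \<subseteq> W"
        using char_convexD[OF W(3) \<sigma> x] by simp
      then show ?thesis
        unfolding \<beta>_def using y by (intro constant_on_segment[OF W(1) sD _ _ \<sigma>2 eq]) auto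
    qed
    obtain B where B: "B 0 = \<beta>" "deriv_seq (lev \<sigma> ` W) B"
      using deriv_seq_of_level_function[OF W(1) \<sigma>2 sD \<beta>] by blast
    have "continuous_on (lev \<sigma> ` W) (B 0)"
      using B(2) by (auto simp: deriv_seq_def intro!: continuous_at_imp_continuous_on
          has_vector_derivative_continuous)
    moreover have "open (lev \<sigma> ` W)"
      by (rule open_lev_image[OF W(1)])
    moreover have "connected (lev \<sigma> ` W)"
      using W continuous_on_lev by (intro connected_continuous_image)
    ultimately have "\<exists>F. \<forall>u\<in>lev \<sigma> ` W. (F has_vector_derivative B 0 u) (at u)"
      by (intro open_connected_primitive)
    then obtain F where F: "\<forall>u\<in>lev \<sigma> ` W. (F has_vector_derivative B 0 u) (at u)" ..
    \<comment> \<open>The primitive becomes entry 0 and the old sequence moves up by one, so that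
      entry 1 is \<open>\<beta>\<close>.\<close>
    have "deriv_seq (lev \<sigma> ` W) (\<lambda>n. case n of 0 \<Rightarrow> F | Suc m \<Rightarrow> B m)"
      using F B(2) by (auto simp: deriv_seq_def split: nat.splits)
    then show ?thesis
      using B(1) \<beta> by (intro exI[of _ "\<lambda>n. case n of 0 \<Rightarrow> F | Suc m \<Rightarrow> B m"]) auto
  qed
  obtain A where A: "deriv_seq (lev 1 ` W) A"
    and A1: "\<And>x. x \<in> W \<Longrightarrow> A 1 (lev 1 x) = (1/2) * partial_deriv 1 f x + (1/2) * partial_deriv 2 f x"
    using half[of 1] by auto
  obtain B where B: "deriv_seq (lev (-1) ` W) B"
    and B1: "\<And>x. x \<in> W \<Longrightarrow> B 1 (lev (-1) x) = (1/2) * partial_deriv 1 f x + (-1/2) * partial_deriv 2 f x"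
    using half[of "-1"] by auto
  \<comment> \<open>The first derivatives of the two waves add up to one partial of \<open>f\<close>
    and differ by the other, so the gradient of the difference cancels.\<close>
  have "((\<lambda>x. f x - wave_sum A B 0 1 x) has_derivative (\<lambda>h. 0)) (at x)" if x: "x \<in> W" for x
  proof (rule has_derivative_eq_rhs)
    show "((\<lambda>x. f x - wave_sum A B 0 1 x) has_derivative
        (\<lambda>h. ((h $ 1) *\<^sub>R partial_deriv 1 f x + (h $ 2) *\<^sub>R partial_deriv 2 f x) -
          (lev 1 h *\<^sub>R A (Suc 0) (lev 1 x) + 1 * (lev (-1) h *\<^sub>R B (Suc 0) (lev (-1) x))))) (at x)"
      using x sf by (intro has_derivative_diff wave_sum_has_derivative[OF W(1) A B]
          has_derivative_partial_deriv_2 smooth_on_differentiable) auto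
    show "(\<lambda>h. ((h $ 1) *\<^sub>R partial_deriv 1 f x + (h $ 2) *\<^sub>R partial_deriv 2 f x) -
          (lev 1 h *\<^sub>R A (Suc 0) (lev 1 x) + 1 * (lev (-1) h *\<^sub>R B (Suc 0) (lev (-1) x)))) = (\<lambda>h. 0)"
      by (rule ext, simp only: A1[OF x, unfolded One_nat_def] B1[OF x, unfolded One_nat_def])
        (simp add: lev_def scaleR_conv_of_real field_simps)
  qed
  then have c: "f x - wave_sum A B 0 1 x = f x0 - wave_sum A B 0 1 x0" if "x \<in> W" for x
    by (rule has_derivative_zero_unique_connected[OF W(1,2)]) (use that x0 in auto)
  \<comment> \<open>The constant \<open>b\<close> is moved from the second wave to the first;
    \<open>a\<close> also absorbs the constant of integration.\<close>
  define b where "b = B 0 (lev (-1) x0)"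
  define a where "a = f x0 - wave_sum A B 0 1 x0 + b"
  show thesis
  proof (rule that)
    show "deriv_seq (lev 1 ` W) (\<lambda>n u. A n u + (if n = 0 then a else 0))"
      using A by (auto simp: deriv_seq_def intro!: derivative_eq_intros)
    show "deriv_seq (lev (-1) ` W) (\<lambda>n u. B n u - (if n = 0 then b else 0))"
      using B by (auto simp: deriv_seq_def intro!: derivative_eq_intros)
    show "f x = wave_sum (\<lambda>n u. A n u + (if n = 0 then a else 0)) (\<lambda>n u. B n u - (if n = 0 then b else 0)) 0 1 x"
      if "x \<in> W" for x
      using c[OF that] by (auto simp: wave_sum_def a_def algebra_simps)
    show "B 0 (lev (-1) x0) - (if (0::nat) = 0 then b else 0) = 0"
      by (simp add: b_def)
  qed
qed

section \<open>Bump functions and mollification\<close>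

text \<open>The standard function exp(-1/x) with a polynomial factor in 1/x: a family closed under
  differentiation, including at the origin.\<close>

definition flat :: "real poly \<Rightarrow> real \<Rightarrow> real" where
  "flat p x = (if x > 0 then poly p (1 / x) * exp (- (1 / x)) else 0)"

text \<open>In the variable y = 1/x, differentiation in x sends p(y) exp(-y) to y^2 (p(y) - p'(y))
  exp(-y).\<close>

definition flat_deriv :: "real poly \<Rightarrow> real poly" where
  "flat_deriv p = [:0, 0, 1:] * (p - pderiv p)"

lemma poly_div_exp_tendsto_0: "((\<lambda>y. poly p y / exp y) \<longlongrightarrow> (0::real)) at_top"
proof -
  have "((\<lambda>y. \<Sum>i\<le>degree p. coeff p i * (y ^ i / exp y)) \<longlongrightarrow> (\<Sum>i\<le>degree p. coeff p i * 0)) at_top"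
    by (intro tendsto_intros tendsto_power_div_exp_0)
  then show ?thesis
    by (simp add: poly_altdef sum_divide_distrib)
qed

lemma flat_has_derivative: "(flat p has_real_derivative flat (flat_deriv p) x) (at x)"
proof (cases x "0::real" rule: linorder_cases)
  case less
  have "((\<lambda>x. 0) has_real_derivative 0) (at x)" by simp
  then have "(flat p has_real_derivative 0) (at x)"
    by (rule has_field_derivative_transform_within_open[where S = "{..<0}"])
      (use less in \<open>auto simp: flat_def\<close>)
  then show ?thesis using less by (simp add: flat_def)
next
  case greater
  have "((\<lambda>x. poly p (1 / x) * exp (- (1 / x))) has_real_derivative
      (poly (pderiv p) (1 / x) * (- 1 / x\<^sup>2)) * exp (- (1 / x)) +
      poly p (1 / x) * (exp (- (1 / x)) * (1 / x\<^sup>2))) (at x)"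
    using greater
    by (auto intro!: derivative_eq_intros DERIV_chain2[where f = "poly p"] poly_DERIV
        simp: power2_eq_square field_simps)
  then have "(flat p has_real_derivative (poly (pderiv p) (1 / x) * (- 1 / x\<^sup>2)) * exp (- (1 / x)) +
      poly p (1 / x) * (exp (- (1 / x)) * (1 / x\<^sup>2))) (at x)"
    by (rule has_field_derivative_transform_within_open[where S = "{0<..}"])
      (use greater in \<open>auto simp: flat_def\<close>)
  moreover have "(poly (pderiv p) (1 / x) * (- 1 / x\<^sup>2)) * exp (- (1 / x)) +
      poly p (1 / x) * (exp (- (1 / x)) * (1 / x\<^sup>2)) = flat (flat_deriv p) x"
    using greater by (simp add: flat_def flat_deriv_def power2_eq_square field_simps)
  ultimately show ?thesis by simp
next
  case equal
  have "((\<lambda>h. flat p h / h) \<longlongrightarrow> 0) (at_left 0)"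
    by (rule tendsto_eventually) (auto simp: eventually_at_filter flat_def)
  moreover have "((\<lambda>h. flat p h / h) \<longlongrightarrow> 0) (at_right 0)"
  proof (rule Lim_transform_eventually)
    \<comment> \<open>With y = 1/h the right difference quotient at the origin is y p(y) / exp(y),
      which tends to 0.\<close>
    show "((\<lambda>h. poly ([:0, 1:] * p) (inverse h) / exp (inverse h)) \<longlongrightarrow> 0) (at_right (0::real))"
      by (rule filterlim_compose[OF poly_div_exp_tendsto_0 filterlim_inverse_at_top_right])
    show "\<forall>\<^sub>F h in at_right 0. poly ([:0, 1:] * p) (inverse h) / exp (inverse h) = flat p h / h"
      by (auto simp: eventually_at_filter flat_def exp_minus field_simps)
  qed
  ultimately have "((\<lambda>h. flat p h / h) \<longlongrightarrow> 0) (at 0)"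
    by (simp add: filterlim_at_split)
  then show ?thesis
    using equal by (simp add: DERIV_def flat_def)
qed

text \<open>A bump function is a product of two flat functions; the lists of pairs represent sums of such
  products, a class closed under differentiation.\<close>

definition flat_products :: "(real poly \<times> real poly) list \<Rightarrow> real \<Rightarrow> real" where
  "flat_products l x = (\<Sum>(p, q)\<leftarrow>l. flat p (1 + x) * flat q (1 - x))"

lemma flat_products_has_derivative:
  "(flat_products l has_real_derivative
    flat_products (concat (map (\<lambda>(p, q). [(flat_deriv p, q), (p, - flat_deriv q)]) l)) x) (at x)"
proof (induction l)
  case Nil
  then show ?case by (simp add: flat_products_def)
next
  case (Cons a l)
  obtain p q where a: "a = (p, q)" by force
  have m: "flat (- q) y = - flat q y" for q y
    by (simp add: flat_def)
  have 1: "((\<lambda>x. flat p (1 + x)) has_real_derivative flat (flat_deriv p) (1 + x)) (at x)"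
    by (rule DERIV_cong[OF DERIV_chain2[OF flat_has_derivative]]) (auto intro!: derivative_eq_intros)
  have 2: "((\<lambda>x. flat q (1 - x)) has_real_derivative - flat (flat_deriv q) (1 - x)) (at x)"
    by (rule DERIV_cong[OF DERIV_chain2[OF flat_has_derivative]]) (auto intro!: derivative_eq_intros)
  have "((\<lambda>x. flat p (1 + x) * flat q (1 - x) + flat_products l x) has_real_derivative
      (flat (flat_deriv p) (1 + x) * flat q (1 - x) + - flat (flat_deriv q) (1 - x) * flat p (1 + x)) +
      flat_products (concat (map (\<lambda>(p, q). [(flat_deriv p, q), (p, - flat_deriv q)]) l)) x) (at x)"
    by (intro DERIV_add DERIV_mult 1 2 Cons.IH)
  then show ?case
    by (simp add: a flat_products_def[abs_def] m algebra_simps)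
qed

text \<open>The profile is exp(-1/(1+x)) exp(-1/(1-x)) on the open interval, divided by its
  integral. All derivatives are listed at once, each with its own bound from compactness of the
  support.\<close>

lemma bump_function:
  obtains B :: "nat \<Rightarrow> real \<Rightarrow> real" and C where
    "\<And>n x. (B n has_real_derivative B (Suc n) x) (at x)"
    "\<And>n x. \<bar>x\<bar> \<ge> 1 \<Longrightarrow> B n x = 0"
    "\<And>x. 0 \<le> B 0 x" "\<And>x. \<bar>x\<bar> < 1 \<Longrightarrow> 0 < B 0 x"
    "(B 0 has_integral 1) {-1..1}"
    "\<And>n x. \<bar>B n x\<bar> \<le> C n"
proof -
  define D where "D n = flat_products (((\<lambda>l. concat (map (\<lambda>(p, q). [(flat_deriv p, q), (p, - flat_deriv q)]) l)) ^^ n) [(1, 1)])" for n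
  have D: "(D n has_real_derivative D (Suc n) x) (at x)" for n x
    using flat_products_has_derivative by (simp add: D_def)
  have D0: "D n x = 0" if "\<bar>x\<bar> \<ge> 1" for n x
  proof -
    have "flat_products l x = 0" for l
      using that by (induction l) (auto simp: flat_products_def flat_def)
    then show ?thesis by (simp add: D_def)
  qed
  have Dpos: "D 0 x > 0" if "\<bar>x\<bar> < 1" for x
    using that by (simp add: D_def flat_products_def flat_def)
  have Dnn: "D 0 x \<ge> 0" for x
    using Dpos[of x] D0[of x 0] by (cases "\<bar>x\<bar> < 1") auto
  have cont: "continuous_on S (D n)" for n S
    using D by (intro continuous_at_imp_continuous_on) (auto intro: DERIV_isCont)
  define I where "I = integral {-1..1} (D 0)"
  have "integral {-1..1} (\<lambda>x::real. 0) < integral {-1..1} (D 0)"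
    using Dpos by (intro integral_less_real cont) auto
  then have I: "I > 0" by (simp add: I_def)
  have "\<exists>C. \<forall>x. \<bar>D n x / I\<bar> \<le> C" for n
  proof -
    have "bounded (D n ` {-1..1})"
      by (intro compact_imp_bounded compact_continuous_image cont) auto
    then obtain C where C: "\<forall>x\<in>{-1..1}. \<bar>D n x\<bar> \<le> C"
      by (auto simp: bounded_iff)
    have "\<bar>D n x\<bar> \<le> C" for x
      using C[rule_format, of x] C[rule_format, of 0] D0[of x n] by (cases "x \<in> {-1..1}") auto
    then show ?thesis
      using I by (intro exI[of _ "C / I"]) (auto simp: divide_simps)
  qed
  then obtain C where C: "\<And>n x. \<bar>D n x / I\<bar> \<le> C n"
    by metis
  show thesis
  proof (rule that[of "\<lambda>n x. D n x / I" C])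
    show "((\<lambda>x. D n x / I) has_real_derivative D (Suc n) x / I) (at x)" for n x
      by (rule DERIV_cdivide[OF D])
    have "(D 0 has_integral I) {-1..1}"
      unfolding I_def by (intro integrable_integral integrable_continuous_real cont)
    then show "((\<lambda>x. D 0 x / I) has_integral 1) {-1..1}"
      using has_integral_divide[of "D 0" I "{-1..1}" I] I by simp
  qed (use C I D0 Dnn Dpos in auto)
qed

section \<open>Convolution with a kernel of width \<delta>\<close>

lemma deriv_seq_continuous_on: "deriv_seq T a \<Longrightarrow> S \<subseteq> T \<Longrightarrow> continuous_on S (a n)"
  by (auto simp: deriv_seq_def intro!: continuous_at_imp_continuous_on has_vector_derivative_continuous)

lemma deriv_seq_lipschitz:
  assumes "deriv_seq T a" "{c..d} \<subseteq> T" "\<And>s. s \<in> {c..d} \<Longrightarrow> cmod (a (Suc n) s) \<le> S"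
    and "x \<in> {c..d}" "y \<in> {c..d}"
  shows "cmod (a n x - a n y) \<le> S * \<bar>x - y\<bar>"
proof -
  have "norm (a n x - a n y) \<le> S * norm (x - y)"
  proof (rule differentiable_bound[where S = "{c..d}" and f' = "\<lambda>s h. h *\<^sub>R a (Suc n) s"])
    show "(a n has_derivative (\<lambda>h. h *\<^sub>R a (Suc n) s)) (at s within {c..d})" if "s \<in> {c..d}" for s
      using assms(1,2) that unfolding deriv_seq_def has_vector_derivative_def
      by (blast intro: has_derivative_at_withinI)
    show "onorm (\<lambda>h. h *\<^sub>R a (Suc n) s) \<le> S" if "s \<in> {c..d}" for s
      using assms(3)[OF that] by (intro onorm_le) (simp add: mult.commute[of S] mult_left_mono)
  qed (use assms in auto)
  then show ?thesis by simp
qed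

text \<open>On an open set the zeroth entry determines the whole sequence; this identifies two
  differently constructed sequences of derivatives in the mollification.\<close>

lemma deriv_seq_eqI:
  assumes "deriv_seq T a" "deriv_seq T b" "open T" "\<And>t. t \<in> T \<Longrightarrow> a 0 t = b 0 t" "t \<in> T"
  shows "a n t = b n t"
  using \<open>t \<in> T\<close>
proof (induction n arbitrary: t)
  case 0
  then show ?case using assms by auto
next
  case (Suc n)
  have "(a n has_vector_derivative a (Suc n) t) (at t)"
    using assms(1) Suc.prems by (auto simp: deriv_seq_def)
  then have "(b n has_vector_derivative a (Suc n) t) (at t)"
    by (rule has_vector_derivative_transform_within_open[OF _ assms(3) Suc.prems Suc.IH])
  moreover have "(b n has_vector_derivative b (Suc n) t) (at t)"
    using assms(2) Suc.prems by (auto simp: deriv_seq_def)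
  ultimately show ?case
    by (rule vector_derivative_unique_at)
qed

text \<open>One function is written in two ways. With the derivatives on the kernel it is smooth
  everywhere and bounded by the supremum of \<open>a 0\<close>; with the derivatives on
  \<open>a\<close> it is an average of translates, close to \<open>a\<close> at every order by the
  mean value inequality. The constants \<open>BB\<close> come from the bump alone and so precede the
  interval, the function and the scale.\<close>

lemma mollify:
  obtains BB :: "nat \<Rightarrow> real" where "\<And>n. 0 \<le> BB n"
    "\<And>T a c d \<delta>. deriv_seq T a \<Longrightarrow> {c..d} \<subseteq> T \<Longrightarrow> c \<le> d \<Longrightarrow> 0 < \<delta> \<Longrightarrow> \<exists>A. deriv_seq UNIV A \<and>
      (\<forall>n x. x \<notin> {c - \<delta><..<d + \<delta>} \<longrightarrow> A n x = 0) \<and>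
      (\<forall>n x S. (\<forall>s\<in>{c..d}. cmod (a 0 s) \<le> S) \<longrightarrow> cmod (A n x) \<le> (d - c) * BB n * S / \<delta> ^ Suc n) \<and>
      (\<forall>n x S. x \<in> {c + \<delta><..<d - \<delta>} \<longrightarrow> (\<forall>s\<in>{c..d}. cmod (a (Suc n) s) \<le> S) \<longrightarrow>
        cmod (A n x - a n x) \<le> \<delta> * S)"
proof -
  obtain B :: "nat \<Rightarrow> real \<Rightarrow> real" and C where
    B: "\<And>n x. (B n has_real_derivative B (Suc n) x) (at x)"
    and B0: "\<And>n x. \<bar>x\<bar> \<ge> 1 \<Longrightarrow> B n x = 0"
    and Bnn: "\<And>x. 0 \<le> B 0 x"
    and BI: "(B 0 has_integral 1) {-1..1}"
    and C: "\<And>n x. \<bar>B n x\<bar> \<le> C n"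
    by (rule bump_function) blast
  have contB: "continuous_on S (\<lambda>x. B n (g x))" if "continuous_on S g" for n S and g :: "'b::topological_space \<Rightarrow> real"
  proof -
    have "continuous_on UNIV (B n)"
      using B by (intro continuous_at_imp_continuous_on) (auto intro: DERIV_isCont)
    then show ?thesis
      using continuous_on_compose2[of UNIV "B n" S g] that by auto
  qed
  have "\<exists>A. deriv_seq UNIV A \<and>
      (\<forall>n x. x \<notin> {c - \<delta><..<d + \<delta>} \<longrightarrow> A n x = 0) \<and>
      (\<forall>n x S. (\<forall>s\<in>{c..d}. cmod (a 0 s) \<le> S) \<longrightarrow> cmod (A n x) \<le> (d - c) * C n * S / \<delta> ^ Suc n) \<and>
      (\<forall>n x S. x \<in> {c + \<delta><..<d - \<delta>} \<longrightarrow> (\<forall>s\<in>{c..d}. cmod (a (Suc n) s) \<le> S) \<longrightarrow>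
        cmod (A n x - a n x) \<le> \<delta> * S)"
    if a: "deriv_seq T a" and cd: "{c..d} \<subseteq> T" "c \<le> d" and \<delta>: "0 < \<delta>" for T a c d \<delta>
  proof -
    \<comment> \<open>Of the n + 1 powers of \<delta>, one normalises the scaled kernel and n come
      from differentiating it. Integrating over \<open>{c..d}\<close> only is the sharp
      cutoff.\<close>
    define k where "k n x s = (B n ((x - s) / \<delta>) / \<delta> ^ Suc n) *\<^sub>R a 0 s" for n x s
    define A where "A n x = integral (cbox c d) (k n x)" for n x
    \<comment> \<open>The form after the substitution s = x - \<delta> t, meaningful only where all
      translates stay in \<open>{c..d}\<close>, that is on \<open>U\<close>.\<close>
    define N where "N n x = integral (cbox (-1) 1) (\<lambda>t. B 0 t *\<^sub>R a n (x - \<delta> * t))" for n x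
    define U where "U = {c + \<delta><..<d - \<delta>}"
    have ca: "continuous_on {c..d} (a n)" for n
      by (rule deriv_seq_continuous_on[OF a cd(1)])
    have ck: "continuous_on {c..d} (k n x)" for n x
      unfolding k_def[abs_def] using \<delta> by (intro continuous_intros contB ca) auto
    have A: "deriv_seq UNIV A"
      unfolding deriv_seq_def
    proof (intro allI ballI)
      fix n x
      have "(A n has_vector_derivative A (Suc n) x) (at x within UNIV)"
        unfolding A_def[abs_def]
      proof (rule leibniz_rule_vector_derivative)
        fix y s :: real
        show "((\<lambda>x. k n x s) has_vector_derivative k (Suc n) y s) (at y within UNIV)"
        proof -
          have "((\<lambda>x. B n ((x - s) / \<delta>)) has_real_derivative B (Suc n) ((y - s) / \<delta>) * (1 / \<delta>)) (at y)"
            using \<delta> by (intro DERIV_chain2[OF B]) (auto intro!: derivative_eq_intros)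
          then have "((\<lambda>x. B n ((x - s) / \<delta>) / \<delta> ^ Suc n) has_real_derivative
              B (Suc n) ((y - s) / \<delta>) * (1 / \<delta>) / \<delta> ^ Suc n) (at y)"
            by (rule DERIV_cdivide)
          then have "((\<lambda>x. B n ((x - s) / \<delta>) / \<delta> ^ Suc n) has_vector_derivative
              B (Suc n) ((y - s) / \<delta>) / \<delta> ^ Suc (Suc n)) (at y)"
            using \<delta> by (simp add: has_real_derivative_iff_has_vector_derivative field_simps)
          from has_vector_derivative_scaleR[OF this[folded has_real_derivative_iff_has_vector_derivative]
              has_vector_derivative_const[of "a 0 s"]]
          show ?thesis by (simp add: k_def)
        qed
        show "k n y integrable_on cbox c d"
          using ck by (intro integrable_continuous) auto
        have "continuous_on (UNIV \<times> {c..d}) (\<lambda>z. a 0 (snd z))"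
          by (rule continuous_on_compose2[OF ca]) (auto intro!: continuous_intros)
        then show "continuous_on (UNIV \<times> cbox c d) (\<lambda>(x, s). k (Suc n) x s)"
          unfolding split_beta k_def using \<delta> by (intro continuous_intros contB) auto
      qed auto
      then show "(A n has_vector_derivative A (Suc n) x) (at x)" by simp
    qed
    have far: "A n x = 0" if "x \<notin> {c - \<delta><..<d + \<delta>}" for n x
    proof -
      have "k n x s = 0" if "s \<in> {c..d}" for s
      proof -
        have "\<bar>(x - s) / \<delta>\<bar> \<ge> 1"
          using \<open>x \<notin> _\<close> that \<delta> by (auto simp: abs_if field_simps)
        then show ?thesis by (simp add: k_def B0)
      qed
      then have "A n x = integral (cbox c d) (\<lambda>s. 0)"
        unfolding A_def by (intro integral_cong) auto
      then show ?thesis by simp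
    qed
    have bound: "cmod (A n x) \<le> (d - c) * C n * S / \<delta> ^ Suc n" if S: "\<forall>s\<in>{c..d}. cmod (a 0 s) \<le> S" for n x S
    proof -
      have "cmod (k n x s) \<le> C n * S / \<delta> ^ Suc n" if "s \<in> {c..d}" for s
      proof -
        have "cmod (k n x s) = \<bar>B n ((x - s) / \<delta>)\<bar> * cmod (a 0 s) / \<delta> ^ Suc n"
          using \<delta> by (simp add: k_def abs_mult power_abs)
        also have "\<dots> \<le> C n * S / \<delta> ^ Suc n"
          using \<delta> S that C[of n "(x - s) / \<delta>"] by (intro divide_right_mono mult_mono) auto
        finally show ?thesis .
      qed
      then have "norm (integral {c..d} (k n x)) \<le> (C n * S / \<delta> ^ Suc n) * (d - c)"
        by (intro integral_bound cd ck)
      then show ?thesis by (simp add: A_def algebra_simps)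
    qed
    have Ut: "x - \<delta> * t \<in> {c..d}" if "x \<in> U" "t \<in> {-1..1}" for x t
    proof -
      have "\<delta> * t \<le> \<delta> * 1" "\<delta> * (-1) \<le> \<delta> * t"
        using that \<delta> by (intro mult_left_mono; auto)+
      then show ?thesis using that by (auto simp: U_def)
    qed
    have N: "deriv_seq U N"
      unfolding deriv_seq_def
    proof (intro allI ballI)
      fix n x assume x: "x \<in> U"
      have "(N n has_vector_derivative N (Suc n) x) (at x within U)"
        unfolding N_def[abs_def]
      proof (rule leibniz_rule_vector_derivative)
        fix y t :: real assume y: "y \<in> U" and t: "t \<in> cbox (-1) 1"
        have "y - \<delta> * t \<in> T" using Ut[OF y] t cd by auto
        then have "(a n has_vector_derivative a (Suc n) (y - \<delta> * t)) (at (y - \<delta> * t))"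
          using a by (auto simp: deriv_seq_def)
        moreover have "((\<lambda>y. y - \<delta> * t) has_vector_derivative 1) (at y)"
          by (auto intro!: derivative_eq_intros)
        ultimately have "((\<lambda>y. a n (y - \<delta> * t)) has_vector_derivative a (Suc n) (y - \<delta> * t)) (at y)"
          using vector_diff_chain_at[of "\<lambda>y. y - \<delta> * t" 1 y "a n"] by (simp add: o_def)
        then have "((\<lambda>y. B 0 t *\<^sub>R a n (y - \<delta> * t)) has_vector_derivative B 0 t *\<^sub>R a (Suc n) (y - \<delta> * t)) (at y)"
          by (auto intro!: derivative_eq_intros)
        then show "((\<lambda>y. B 0 t *\<^sub>R a n (y - \<delta> * t)) has_vector_derivative B 0 t *\<^sub>R a (Suc n) (y - \<delta> * t)) (at y within U)"
          by (rule has_vector_derivative_at_within)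
      next
        fix y assume "y \<in> U"
        then have "continuous_on {-1..1} (\<lambda>t. a n (y - \<delta> * t))"
          using Ut by (intro continuous_on_compose2[OF ca]) (auto intro!: continuous_intros)
        then show "(\<lambda>t. B 0 t *\<^sub>R a n (y - \<delta> * t)) integrable_on cbox (-1) 1"
          by (intro integrable_continuous continuous_intros contB) auto
      next
        have "continuous_on (U \<times> {-1..1}) (\<lambda>z. a (Suc n) (fst z - \<delta> * snd z))"
          using Ut by (intro continuous_on_compose2[OF ca]) (auto intro!: continuous_intros)
        then show "continuous_on (U \<times> cbox (-1) 1) (\<lambda>(y, t). B 0 t *\<^sub>R a (Suc n) (y - \<delta> * t))"
          unfolding split_beta by (intro continuous_intros contB) auto
      qed (use x in \<open>auto simp: U_def\<close>)
      then show "(N n has_vector_derivative N (Suc n) x) (at x)"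
        using at_within_open[OF x] by (simp add: U_def)
    qed
    have AN0: "A 0 x = N 0 x" if x: "x \<in> U" for x
    proof -
      have sub: "{x - \<delta>..x + \<delta>} \<subseteq> {c..d}"
        using x by (auto simp: U_def)
      define i where "i = integral (cbox (x - \<delta>) (x + \<delta>)) (k 0 x)"
      have i: "(k 0 x has_integral i) (cbox (x - \<delta>) (x + \<delta>))"
        unfolding i_def using sub
        by (intro integrable_integral integrable_continuous continuous_on_subset[OF ck]) auto
      have "k 0 x s = 0" if "s \<notin> cbox (x - \<delta>) (x + \<delta>)" for s
      proof -
        have "\<bar>(x - s) / \<delta>\<bar> \<ge> 1"
          using that \<delta> by (auto simp: abs_if field_simps)
        then show ?thesis by (simp add: k_def B0)
      qed
      then have "(k 0 x has_integral i) (cbox c d)"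
        using has_integral_on_superset[OF i] sub by auto
      then have A0: "A 0 x = i"
        unfolding A_def by (rule integral_unique)
      \<comment> \<open>The affine substitution carries the support of the scaled kernel to
        \<open>{-1..1}\<close>; its Jacobian cancels the normalising power of \<delta>.\<close>
      have "((\<lambda>t. k 0 x (- \<delta> * t + x)) has_integral (1 / \<delta>) *\<^sub>R i) {-1..1}"
      proof -
        have "(\<lambda>y. (1 / (- \<delta>)) * y + x / \<delta>) ` {x - \<delta>..x + \<delta>} = {-1..1}"
          using \<delta> by (subst image_affinity_atLeastAtMost) (auto simp: field_simps)
        then have eq: "(\<lambda>y. x / \<delta> - y / \<delta>) ` {x - \<delta>..x + \<delta>} = {-1..1}"
          by simp
        show ?thesis
          using has_integral_affinity[OF i, of "- \<delta>" x] \<delta> by (simp add: eq)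
      qed
      from has_integral_cmul[OF this, of \<delta>]
      have "((\<lambda>t. \<delta> *\<^sub>R k 0 x (- \<delta> * t + x)) has_integral \<delta> *\<^sub>R (1 / \<delta>) *\<^sub>R i) {-1..1}" .
      then have "((\<lambda>t. B 0 t *\<^sub>R a 0 (x - \<delta> * t)) has_integral i) {-1..1}"
        using \<delta> by (simp add: k_def)
      then have "N 0 x = i"
        unfolding N_def by (intro integral_unique) simp
      with A0 show ?thesis by simp
    qed
    \<comment> \<open>Equality of the functions on the open set \<open>U\<close> passes to every
      derivative, which transfers the comparison estimate from \<open>N\<close> to
      \<open>A\<close>.\<close>
    have AN: "A n x = N n x" if "x \<in> U" for n x
      by (rule deriv_seq_eqI[OF deriv_seq_subset[OF A] N _ AN0 that]) (auto simp: U_def)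
    have near: "cmod (A n x - a n x) \<le> \<delta> * S" if x: "x \<in> U" and S: "\<forall>s\<in>{c..d}. cmod (a (Suc n) s) \<le> S" for n x S
    proof -
      have x0: "x \<in> {c..d}"
        using Ut[OF x, of 0] by simp
      then have S0: "0 \<le> S"
        using S norm_ge_zero order_trans by blast
      have c1: "continuous_on {-1..1} (\<lambda>t. a n (x - \<delta> * t))"
        using Ut[OF x] by (intro continuous_on_compose2[OF ca]) (auto intro!: continuous_intros)
      have "((\<lambda>t. B 0 t *\<^sub>R a n x) has_integral 1 *\<^sub>R a n x) {-1..1}"
        by (rule has_integral_scaleR_left[OF BI])
      moreover have "((\<lambda>t. B 0 t *\<^sub>R a n (x - \<delta> * t)) has_integral N n x) {-1..1}"
        unfolding N_def cbox_interval
        by (intro integrable_integral integrable_continuous_real continuous_intros contB c1)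
      ultimately have I: "((\<lambda>t. B 0 t *\<^sub>R a n (x - \<delta> * t) - B 0 t *\<^sub>R a n x) has_integral N n x - 1 *\<^sub>R a n x) {-1..1}"
        by (intro has_integral_diff)
      have J: "((\<lambda>t. B 0 t * (\<delta> * S)) has_integral 1 * (\<delta> * S)) {-1..1}"
        by (rule has_integral_mult_left[OF BI])
      have "norm (integral {-1..1} (\<lambda>t. B 0 t *\<^sub>R a n (x - \<delta> * t) - B 0 t *\<^sub>R a n x))
          \<le> integral {-1..1} (\<lambda>t. B 0 t * (\<delta> * S))"
      proof (rule integral_norm_bound_integral)
        fix t :: real assume t: "t \<in> {-1..1}"
        have "cmod (a n (x - \<delta> * t) - a n x) \<le> S * \<bar>(x - \<delta> * t) - x\<bar>"
          by (rule deriv_seq_lipschitz[OF a cd(1) _ Ut[OF x t] x0]) (use S in auto)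
        also have "\<dots> = S * (\<delta> * \<bar>t\<bar>)"
          using \<delta> by (simp add: abs_mult)
        also have "\<dots> \<le> S * (\<delta> * 1)"
          using t \<delta> S0 by (intro mult_left_mono) auto
        finally have "B 0 t * cmod (a n (x - \<delta> * t) - a n x) \<le> B 0 t * (\<delta> * S)"
          using Bnn by (intro mult_left_mono) (auto simp: mult.commute)
        then show "norm (B 0 t *\<^sub>R a n (x - \<delta> * t) - B 0 t *\<^sub>R a n x) \<le> B 0 t * (\<delta> * S)"
          using Bnn by (simp flip: scaleR_diff_right)
      qed (use I J in blast)+
      then show ?thesis
        by (simp only: integral_unique[OF I] integral_unique[OF J] AN[OF x]) simp
    qed
    show ?thesis
      using A far bound near unfolding U_def by (intro exI[of _ A]) auto
  qed
  moreover have "0 \<le> C n" for n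
    using C[of n 0] by linarith
  ultimately show thesis
    using that[of C] by blast
qed

section \<open>Convexity for supports and characteristic segments\<close>

lemma lookup_wave_poly:
  "Poly_Mapping.lookup wave_poly \<alpha> =
    (if \<alpha> = Poly_Mapping.single 2 2 then 1 else if \<alpha> = Poly_Mapping.single 1 2 then - 1 else 0)"
  and wave_indices_distinct: "Poly_Mapping.single (1::2) (2::nat) \<noteq> Poly_Mapping.single 2 2"
proof -
  show ne: "Poly_Mapping.single (1::2) (2::nat) \<noteq> Poly_Mapping.single 2 2"
  proof
    assume "Poly_Mapping.single (1::2) (2::nat) = Poly_Mapping.single 2 2"
    then have "Poly_Mapping.lookup (Poly_Mapping.single (1::2) (2::nat)) 1 =
        Poly_Mapping.lookup (Poly_Mapping.single (2::2) (2::nat)) 1"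
      by simp
    then show False
      by (simp add: lookup_single)
  qed
  then show "Poly_Mapping.lookup wave_poly \<alpha> =
    (if \<alpha> = Poly_Mapping.single 2 2 then 1 else if \<alpha> = Poly_Mapping.single 1 2 then - 1 else 0)"
    by (auto simp: wave_poly_def indet_square lookup_minus lookup_single when_def)
qed

lemma keys_wave_poly: "Poly_Mapping.keys wave_poly = {Poly_Mapping.single 1 2, Poly_Mapping.single 2 2}"
  by (auto simp: in_keys_iff lookup_wave_poly split: if_splits)

text \<open>Both monomials have even order, so the operator equals its transpose.\<close>

lemma poly_reflect_wave_poly: "poly_reflect wave_poly = wave_poly"
proof (rule poly_mapping_eqI)
  fix \<alpha>
  show "Poly_Mapping.lookup (poly_reflect wave_poly) \<alpha> = Poly_Mapping.lookup wave_poly \<alpha>"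
    by (auto simp: poly_reflect_def mapp.rep_eq keys_wave_poly lookup_wave_poly mi_order_single when_def)
qed

lemma distr_diff_op_wave_poly:
  "distr_diff_op wave_poly u \<phi> =
    u (partial_deriv 1 (partial_deriv 1 \<phi>)) - u (partial_deriv 2 (partial_deriv 2 \<phi>))"
  using wave_indices_distinct
  by (simp add: distr_diff_op_def keys_wave_poly lookup_wave_poly mi_order_single mi_deriv_single
      numeral_2_eq_2)

section \<open>Explicit test functions in the plane\<close>

lemma smooth_on_product:
  fixes G H :: "nat \<Rightarrow> real \<Rightarrow> real"
  assumes G: "\<And>n x. (G n has_real_derivative G (Suc n) x) (at x)"
    and H: "\<And>n x. (H n has_real_derivative H (Suc n) x) (at x)"
  shows "smooth_on UNIV (\<lambda>x :: real^2. complex_of_real (G 0 (x $ 1) * H 0 (x $ 2)))"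
proof -
  \<comment> \<open>A doubly indexed family makes the induction close: each partial derivative
    raises one of the two indices.\<close>
  define F where "F i j = (\<lambda>x :: real^2. complex_of_real (G i (x $ 1) * H j (x $ 2)))" for i j
  have D: "(F i j has_derivative (\<lambda>h. complex_of_real (G i (x $ 1) * (H (Suc j) (x $ 2) * h $ 2) +
      G (Suc i) (x $ 1) * h $ 1 * H j (x $ 2)))) (at x)" for i j x
  proof -
    have c: "((\<lambda>x :: real^2. x $ k) has_derivative (\<lambda>h. h $ k)) (at x)" for k
      by (rule bounded_linear_imp_has_derivative[OF bounded_linear_vec_nth])
    have "((\<lambda>x. G i (x $ 1)) has_derivative (\<lambda>h. G (Suc i) (x $ 1) * h $ 1)) (at x)"
      using has_derivative_compose[OF c G[unfolded has_field_derivative_def]] by simp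
    moreover have "((\<lambda>x. H j (x $ 2)) has_derivative (\<lambda>h. H (Suc j) (x $ 2) * h $ 2)) (at x)"
      using has_derivative_compose[OF c H[unfolded has_field_derivative_def]] by simp
    ultimately show ?thesis
      unfolding F_def by (intro has_derivative_of_real has_derivative_mult)
  qed
  have p: "partial_deriv 1 (F i j) = F (Suc i) j" "partial_deriv 2 (F i j) = F i (Suc j)" for i j
    by (intro ext, subst has_partial_deriv[OF D], simp add: F_def axis_def)+
  have "Ck_on k UNIV (F i j)" for k i j
  proof (induction k arbitrary: i j)
    case 0
    then show ?case
      using has_derivative_continuous[OF D] by (simp add: continuous_at_imp_continuous_on)
  next
    case (Suc k)
    have "Ck_on k UNIV (partial_deriv m (F i j))" for m
      using Suc exhaust_2[of m] by (auto simp: p)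
    then show ?case
      using differentiableI[OF D] by simp
  qed
  then show ?thesis
    unfolding smooth_on_def F_def by blast
qed

lemma bump_test_function:
  fixes x :: "real^2"
  assumes "open U" "x \<in> U"
  obtains \<rho> :: "real^2 \<Rightarrow> real" where "(\<lambda>y. complex_of_real (\<rho> y)) \<in> test_functions U"
    "\<And>y. 0 \<le> \<rho> y" "0 < \<rho> x" "continuous_on UNIV \<rho>"
proof -
  obtain B :: "nat \<Rightarrow> real \<Rightarrow> real" where
    B: "\<And>n x. (B n has_real_derivative B (Suc n) x) (at x)"
    and B0: "\<And>n x. \<bar>x\<bar> \<ge> 1 \<Longrightarrow> B n x = 0"
    and Bnn: "\<And>x. 0 \<le> B 0 x" and Bpos: "\<And>x. \<bar>x\<bar> < 1 \<Longrightarrow> 0 < B 0 x"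
    by (rule bump_function) blast
  obtain r where r: "0 < r" "cball x r \<subseteq> U"
    using assms open_contains_cball by blast
  \<comment> \<open>The bump lives on a square of half-side \<open>s\<close>, and the l1 bound of
    the norm puts this square inside the ball of radius \<open>r\<close>.\<close>
  define s where "s = r / 2"
  have s: "0 < s" using r by (simp add: s_def)
  define G where "G k n u = B n ((u - x $ k) / s) / s ^ n" for k :: 2 and n u
  define \<rho> where "\<rho> y = G 1 0 (y $ 1) * G 2 0 (y $ 2)" for y :: "real^2"
  have G: "(G k n has_real_derivative G k (Suc n) u) (at u)" for k n u
  proof -
    have "((\<lambda>u. B n ((u - x $ k) / s)) has_real_derivative B (Suc n) ((u - x $ k) / s) * (1 / s)) (at u)"
      using s by (intro DERIV_chain2[OF B]) (auto intro!: derivative_eq_intros)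
    from DERIV_cdivide[OF this, of "s ^ n"] show ?thesis
      by (simp add: G_def[abs_def])
  qed
  have sm: "smooth_on UNIV (\<lambda>y. complex_of_real (\<rho> y))"
    unfolding \<rho>_def by (rule smooth_on_product[of "G 1" "G 2", OF G G])
  have supp: "closure {y. complex_of_real (\<rho> y) \<noteq> 0} \<subseteq> cball x r"
  proof (rule closure_minimal)
    show "{y. complex_of_real (\<rho> y) \<noteq> 0} \<subseteq> cball x r"
    proof
      fix y assume "y \<in> {y. complex_of_real (\<rho> y) \<noteq> 0}"
      then have "B 0 ((y $ k - x $ k) / s) \<noteq> 0" for k
        using exhaust_2[of k] by (auto simp: \<rho>_def G_def)
      then have "\<not> \<bar>(y $ k - x $ k) / s\<bar> \<ge> 1" for k
        using B0 by blast
      then have "\<bar>(y - x) $ k\<bar> / s < 1" for k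
        using s by (simp add: not_le)
      then have k: "\<bar>(y - x) $ k\<bar> \<le> s" for k
        using s by (simp add: divide_less_eq less_imp_le)
      have "norm (y - x) \<le> \<bar>(y - x) $ 1\<bar> + \<bar>(y - x) $ 2\<bar>"
        using norm_le_l1_cart[of "y - x"] by (simp add: sum_2)
      also have "\<dots> \<le> r"
        using k[of 1] k[of 2] by (simp add: s_def)
      finally show "y \<in> cball x r"
        by (simp add: dist_norm norm_minus_commute)
    qed
  qed auto
  show thesis
  proof (rule that)
    show "(\<lambda>y. complex_of_real (\<rho> y)) \<in> test_functions U"
      using sm supp r bounded_subset[OF bounded_cball supp]
      by (auto simp: test_functions_def compact_eq_bounded_closed)
    show "0 \<le> \<rho> y" for y
      using Bnn s by (simp add: \<rho>_def G_def)
    show "0 < \<rho> x"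
      using Bpos[of 0] by (simp add: \<rho>_def G_def)
    have "continuous_on UNIV (\<lambda>y. Re (complex_of_real (\<rho> y)))"
      by (rule continuous_on_Re[OF smooth_on_continuous[OF sm]])
    then show "continuous_on UNIV \<rho>" by simp
  qed
qed

section \<open>Integration over a characteristic segment as a distribution\<close>

definition segment_functional :: "real^2 \<Rightarrow> real^2 \<Rightarrow> (real^2 \<Rightarrow> complex) \<Rightarrow> complex" where
  "segment_functional p q \<phi> = integral {0..1} (\<lambda>t. \<phi> (p + t *\<^sub>R (q - p)))"

lemma closed_segment_param: "closed_segment p q = (\<lambda>t. p + t *\<^sub>R (q - p)) ` {0..1}"
proof -
  have "(1 - t) *\<^sub>R p + t *\<^sub>R q = p + t *\<^sub>R (q - p)" for t
    by (simp add: algebra_simps)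
  then show ?thesis
    by (auto simp: closed_segment_def)
qed

lemma continuous_on_segment_param:
  fixes \<phi> :: "real^2 \<Rightarrow> complex"
  shows "continuous_on UNIV \<phi> \<Longrightarrow> continuous_on S (\<lambda>t. \<phi> (p + t *\<^sub>R (q - p)))"
  by (rule continuous_on_compose2[of UNIV \<phi>]) (auto intro!: continuous_intros)

lemma test_functions_smooth: "\<phi> \<in> test_functions X \<Longrightarrow> smooth_on UNIV \<phi>"
  by (simp add: test_functions_def)

lemma distribution_on_segment_functional:
  "distribution_on X (segment_functional p q)"
  unfolding distribution_on_def
proof (intro conjI ballI allI impI)
  fix \<phi> \<psi> assume "\<phi> \<in> test_functions X" "\<psi> \<in> test_functions X"
  then show "segment_functional p q (\<lambda>x. \<phi> x + \<psi> x) = segment_functional p q \<phi> + segment_functional p q \<psi>"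
    unfolding segment_functional_def
    by (intro integral_add integrable_continuous_real continuous_on_segment_param
        smooth_on_continuous test_functions_smooth)
next
  fix c \<phi>
  show "segment_functional p q (\<lambda>x. c * \<phi> x) = c * segment_functional p q \<phi>"
    by (simp add: segment_functional_def)
next
  fix K :: "(real^2) set" assume K: "compact K \<and> K \<subseteq> X"
  show "\<exists>C k. \<forall>\<phi>\<in>test_functions X. closure {x. \<phi> x \<noteq> 0} \<subseteq> K \<longrightarrow>
      cmod (segment_functional p q \<phi>) \<le> C * seminorm K k \<phi>"
  proof (rule exI[of _ 1], rule exI[of _ 0], intro ballI impI)
    fix \<phi> assume \<phi>: "\<phi> \<in> test_functions X" and supp: "closure {x. \<phi> x \<noteq> 0} \<subseteq> K"
    note sm = test_functions_smooth[OF \<phi>]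
    have "cmod (\<phi> x) \<le> seminorm K 0 \<phi>" for x
    proof (cases "\<phi> x = 0")
      case True
      then show ?thesis
        using seminorm_nonneg[OF sm] K by simp
    next
      case False
      then have "x \<in> K" using supp closure_subset by fastforce
      then show ?thesis
        using seminorm_upper[OF sm, of K x 0 0] K by (simp add: mi_deriv_zero mi_order_2)
    qed
    then have "norm (integral {0..1} (\<lambda>t. \<phi> (p + t *\<^sub>R (q - p)))) \<le> seminorm K 0 \<phi> * (1 - 0)"
      by (intro integral_bound continuous_on_segment_param smooth_on_continuous sm) auto
    then show "cmod (segment_functional p q \<phi>) \<le> 1 * seminorm K 0 \<phi>"
      by (simp add: segment_functional_def)
  qed
qed

text \<open>A test function supported off the segment vanishes on it. Conversely, a nonnegative
  continuous bump that is positive at a point of the segment cannot have integral zero.\<close>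

lemma distr_support_segment_functional:
  assumes "open X" "closed_segment p q \<subseteq> X"
  shows "distr_support X (segment_functional p q) = closed_segment p q"
proof
  have "segment_functional p q \<phi> = 0" if "\<phi> \<in> test_functions (X - closed_segment p q)" for \<phi>
  proof -
    have "\<phi> x = 0" if "x \<in> closed_segment p q" for x
      using that \<open>\<phi> \<in> _\<close> closure_subset[of "{x. \<phi> x \<noteq> 0}"] by (auto simp: test_functions_def)
    then have "\<phi> (p + t *\<^sub>R (q - p)) = 0" if "t \<in> {0..1}" for t
      using that imageI[OF that, of "\<lambda>t. p + t *\<^sub>R (q - p)"] unfolding closed_segment_param by blast
    then have "segment_functional p q \<phi> = integral {0..1} (\<lambda>t::real. 0)"
      unfolding segment_functional_def by (intro integral_cong) auto
    then show ?thesis by simp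
  qed
  moreover have "open (X - closed_segment p q)"
    using assms(1) closed_segment by blast
  ultimately show "distr_support X (segment_functional p q) \<subseteq> closed_segment p q"
    unfolding distr_support_def by blast
next
  have "x \<notin> U" if x: "x \<in> closed_segment p q" and U: "open U"
    and 0: "\<forall>\<phi>\<in>test_functions U. segment_functional p q \<phi> = 0" for x U
  proof
    assume "x \<in> U"
    then obtain \<rho> where \<rho>: "(\<lambda>y. complex_of_real (\<rho> y)) \<in> test_functions U"
      "\<And>y. 0 \<le> \<rho> y" "0 < \<rho> x" "continuous_on UNIV \<rho>"
      using bump_test_function[OF U] by metis
    have cont: "continuous_on {0..1} (\<lambda>t. \<rho> (p + t *\<^sub>R (q - p)))"
      by (rule continuous_on_compose2[OF \<rho>(4)]) (auto intro!: continuous_intros)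
    have "((\<lambda>t. complex_of_real (\<rho> (p + t *\<^sub>R (q - p)))) has_integral
        complex_of_real (integral {0..1} (\<lambda>t. \<rho> (p + t *\<^sub>R (q - p))))) {0..1}"
      by (intro has_integral_of_real integrable_integral integrable_continuous_real cont)
    then have "integral {0..1} (\<lambda>t. \<rho> (p + t *\<^sub>R (q - p))) = 0"
      using 0 \<rho>(1) by (auto simp: segment_functional_def dest!: integral_unique)
    then have "\<forall>t\<in>{0..1}. \<rho> (p + t *\<^sub>R (q - p)) = 0"
      using integral_eq_0_iff[OF cont] \<rho>(2) by simp
    with x \<rho>(3) show False
      by (auto simp: closed_segment_param)
  qed
  then show "closed_segment p q \<subseteq> distr_support X (segment_functional p q)"
    unfolding distr_support_def using assms(2) by blast
qed

text \<open>Restricted to a characteristic line, the wave operator is up to a nonzero factor the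
  derivative along the line of a first-order expression in the test function. Its integral is thus a
  difference of end point values.\<close>

lemma distr_support_wave_segment_functional:
  assumes X: "open X" and \<sigma>: "\<sigma> = 1 \<or> \<sigma> = -1" and lev: "lev \<sigma> p = lev \<sigma> q" and "p \<noteq> q"
  shows "distr_support X (distr_diff_op wave_poly (segment_functional p q)) \<subseteq> {p, q}"
proof -
  define d where "d = q - p"
  have d1: "d $ 1 = - \<sigma> * d $ 2"
    using lev by (simp add: lev_def d_def algebra_simps)
  \<comment> \<open>This makes the factor in front of the integral nonzero, so that it can be
    divided out below.\<close>
  have d2: "d $ 2 \<noteq> 0"
  proof
    assume "d $ 2 = 0"
    then have "d = 0" using d1 by (simp add: vec_eq_iff forall_2)
    then show False using \<open>p \<noteq> q\<close> by (simp add: d_def)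
  qed
  have "distr_diff_op wave_poly (segment_functional p q) \<phi> = 0" if \<phi>: "\<phi> \<in> test_functions (X - {p, q})" for \<phi>
  proof -
    note sm = test_functions_smooth[OF \<phi>]
    note sm1 = smooth_on_partial_deriv[OF sm, of 1] and sm2 = smooth_on_partial_deriv[OF sm, of 2]
    \<comment> \<open>The test function vanishes in a neighbourhood of each end point, not merely at
      it, so its derivatives vanish there too.\<close>
    have z: "partial_deriv k \<phi> x = 0" if "x \<in> {p, q}" for k x
    proof -
      have x: "x \<in> - closure {x. \<phi> x \<noteq> 0}"
        using that \<phi> by (auto simp: test_functions_def)
      have y: "\<phi> y = 0" if "y \<in> - closure {x. \<phi> x \<noteq> 0}" for y
        using that closure_subset[of "{x. \<phi> x \<noteq> 0}"] by auto
      have "partial_deriv k \<phi> x = partial_deriv k (\<lambda>x. 0) x"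
        by (rule partial_deriv_cong_open[OF open_Compl[OF closed_closure] x y])
      then show ?thesis
        using has_partial_deriv[OF has_derivative_const, of k 0 x] by simp
    qed
    define \<psi> where "\<psi> x = partial_deriv 1 \<phi> x + complex_of_real \<sigma> * partial_deriv 2 \<phi> x" for x
    define w where "w x = partial_deriv 1 (partial_deriv 1 \<phi>) x - partial_deriv 2 (partial_deriv 2 \<phi>) x" for x
    have "((\<lambda>t. \<psi> (p + t *\<^sub>R d)) has_vector_derivative (- \<sigma> * d $ 2) *\<^sub>R w (p + t *\<^sub>R d)) (at t)" for t
    proof -
      let ?x = "p + t *\<^sub>R d"
      have 1: "((\<lambda>t. partial_deriv 1 \<phi> (p + t *\<^sub>R d)) has_vector_derivative
          (d $ 1) *\<^sub>R partial_deriv 1 (partial_deriv 1 \<phi>) ?x + (d $ 2) *\<^sub>R partial_deriv 2 (partial_deriv 1 \<phi>) ?x) (at t)"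
        by (intro has_vector_derivative_line smooth_on_differentiable[OF sm1]) auto
      have 2: "((\<lambda>t. partial_deriv 2 \<phi> (p + t *\<^sub>R d)) has_vector_derivative
          (d $ 1) *\<^sub>R partial_deriv 1 (partial_deriv 2 \<phi>) ?x + (d $ 2) *\<^sub>R partial_deriv 2 (partial_deriv 2 \<phi>) ?x) (at t)"
        by (intro has_vector_derivative_line smooth_on_differentiable[OF sm2]) auto
      have 12: "partial_deriv 2 (partial_deriv 1 \<phi>) ?x = partial_deriv 1 (partial_deriv 2 \<phi>) ?x"
        using partial_deriv_commute[OF open_UNIV sm] by simp
      have "((\<lambda>t. \<psi> (p + t *\<^sub>R d)) has_vector_derivative
          ((d $ 1) *\<^sub>R partial_deriv 1 (partial_deriv 1 \<phi>) ?x + (d $ 2) *\<^sub>R partial_deriv 2 (partial_deriv 1 \<phi>) ?x) +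
          complex_of_real \<sigma> * ((d $ 1) *\<^sub>R partial_deriv 1 (partial_deriv 2 \<phi>) ?x + (d $ 2) *\<^sub>R partial_deriv 2 (partial_deriv 2 \<phi>) ?x)) (at t)"
        unfolding \<psi>_def by (intro has_vector_derivative_add has_vector_derivative_mult_right 1 2)
      moreover have "((d $ 1) *\<^sub>R partial_deriv 1 (partial_deriv 1 \<phi>) ?x + (d $ 2) *\<^sub>R partial_deriv 2 (partial_deriv 1 \<phi>) ?x) +
          complex_of_real \<sigma> * ((d $ 1) *\<^sub>R partial_deriv 1 (partial_deriv 2 \<phi>) ?x + (d $ 2) *\<^sub>R partial_deriv 2 (partial_deriv 2 \<phi>) ?x)
          = (- \<sigma> * d $ 2) *\<^sub>R w ?x"
        unfolding 12 d1 using \<sigma> by (auto simp: w_def scaleR_diff_right)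
      ultimately show ?thesis by simp
    qed
    then have "((\<lambda>t. (- \<sigma> * d $ 2) *\<^sub>R w (p + t *\<^sub>R d)) has_integral \<psi> (p + 1 *\<^sub>R d) - \<psi> (p + 0 *\<^sub>R d)) {0..1}"
      by (intro fundamental_theorem_of_calculus) (auto intro: has_vector_derivative_at_within)
    moreover have "\<psi> (p + 1 *\<^sub>R d) - \<psi> (p + 0 *\<^sub>R d) = 0"
      by (simp add: d_def \<psi>_def z)
    ultimately have "((\<lambda>t. (- \<sigma> * d $ 2) *\<^sub>R w (p + t *\<^sub>R d)) has_integral 0) {0..1}"
      by (simp only:)
    then have "integral {0..1} (\<lambda>t. (- \<sigma> * d $ 2) *\<^sub>R w (p + t *\<^sub>R d)) = 0"
      by (rule integral_unique)
    then have "(- \<sigma> * d $ 2) *\<^sub>R integral {0..1} (\<lambda>t. w (p + t *\<^sub>R d)) = 0"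
      by (simp only: integral_cmul)
    then have "integral {0..1} (\<lambda>t. w (p + t *\<^sub>R d)) = 0"
      using d2 \<sigma> by auto
    moreover have "integral {0..1} (\<lambda>t. w (p + t *\<^sub>R d)) =
        segment_functional p q (partial_deriv 1 (partial_deriv 1 \<phi>)) -
        segment_functional p q (partial_deriv 2 (partial_deriv 2 \<phi>))"
      unfolding w_def segment_functional_def d_def
      by (intro integral_diff integrable_continuous_real continuous_on_segment_param
          smooth_on_continuous smooth_on_partial_deriv sm)
    ultimately show ?thesis
      by (simp add: distr_diff_op_wave_poly)
  qed
  moreover have "open (X - {p, q})"
    using X by (intro open_Diff) auto
  ultimately show ?thesis
    unfolding distr_support_def by blast
qed

text \<open>The point is uniformity: a single compact set contains all characteristic segments in
  \<open>X\<close> with end points in \<open>K\<close>. This is what later prevents such segments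
  from approaching the boundary of \<open>X\<close>.\<close>

lemma P_convex_for_supports_segments:
  assumes X: "open X" "P_convex_for_supports wave_poly X" and K: "compact K" "K \<subseteq> X"
  shows "\<exists>L. compact L \<and> L \<subseteq> X \<and> (\<forall>\<sigma>\<in>{1, -1}. \<forall>p\<in>K. \<forall>q\<in>K. lev \<sigma> p = lev \<sigma> q \<longrightarrow>
    closed_segment p q \<subseteq> X \<longrightarrow> closed_segment p q \<subseteq> L)"
proof -
  have "\<exists>L. compact L \<and> L \<subseteq> X \<and> (\<forall>u\<in>compactly_supported_distributions X.
      distr_support X (distr_diff_op wave_poly u) \<subseteq> K \<longrightarrow> distr_support X u \<subseteq> L)"
    using X(2)[unfolded P_convex_for_supports_def poly_reflect_wave_poly, rule_format, OF conjI, OF K] .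
  then obtain L where L: "compact L \<and> L \<subseteq> X \<and> (\<forall>u\<in>compactly_supported_distributions X.
      distr_support X (distr_diff_op wave_poly u) \<subseteq> K \<longrightarrow> distr_support X u \<subseteq> L)" ..
  \<comment> \<open>\<open>K\<close> is adjoined to cover the degenerate segments consisting of one
    point.\<close>
  show ?thesis
  proof (intro exI[of _ "L \<union> K"] conjI ballI impI)
    fix \<sigma> p q
    assume "\<sigma> \<in> {1, -1 :: real}" "p \<in> K" "q \<in> K" "lev \<sigma> p = lev \<sigma> q" "closed_segment p q \<subseteq> X"
    then have h: "\<sigma> = 1 \<or> \<sigma> = -1" "p \<in> K" "q \<in> K" "lev \<sigma> p = lev \<sigma> q" "closed_segment p q \<subseteq> X"
      by simp_all
    show "closed_segment p q \<subseteq> L \<union> K"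
    proof (cases "p = q")
      case True
      then show ?thesis using h by simp
    next
      case False
      have "segment_functional p q \<in> compactly_supported_distributions X"
        using distribution_on_segment_functional distr_support_segment_functional[OF X(1) h(5)]
        by (simp add: compactly_supported_distributions_def)
      moreover have "distr_support X (distr_diff_op wave_poly (segment_functional p q)) \<subseteq> K"
        using distr_support_wave_segment_functional[OF X(1) h(1,4) False] h by blast
      ultimately have "distr_support X (segment_functional p q) \<subseteq> L"
        using L by simp
      then show ?thesis
        using distr_support_segment_functional[OF X(1) h(5)] by auto
    qed
  qed (use L K in auto)
qed

section \<open>Characteristic convexity of components\<close>

lemma lev_eqI:
  assumes "\<sigma> = 1 \<or> \<sigma> = -1" "lev \<sigma> x = lev \<sigma> y" "lev (- \<sigma>) x = lev (- \<sigma>) y"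
  shows "x = y"
  using assms by (auto simp: lev_def vec_eq_iff forall_2)

text \<open>Reduces segments on a characteristic line to real intervals in the other characteristic
  variable.\<close>

lemma mem_char_segment_iff:
  assumes \<sigma>: "\<sigma> = 1 \<or> \<sigma> = -1" and pq: "lev \<sigma> p = lev \<sigma> q"
  shows "x \<in> closed_segment p q \<longleftrightarrow>
    lev \<sigma> x = lev \<sigma> p \<and> lev (- \<sigma>) x \<in> closed_segment (lev (- \<sigma>) p) (lev (- \<sigma>) q)"
proof -
  have l: "lev \<tau> (p + t *\<^sub>R (q - p)) = lev \<tau> p + t *\<^sub>R (lev \<tau> q - lev \<tau> p)" for \<tau> t
    by (simp add: lev_def algebra_simps)
  show ?thesis
  proof
    assume "x \<in> closed_segment p q"
    then obtain t where "t \<in> {0..1}" "x = p + t *\<^sub>R (q - p)"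
      by (auto simp: closed_segment_param)
    then show "lev \<sigma> x = lev \<sigma> p \<and> lev (- \<sigma>) x \<in> closed_segment (lev (- \<sigma>) p) (lev (- \<sigma>) q)"
      unfolding closed_segment_param using pq l by auto
  next
    assume x: "lev \<sigma> x = lev \<sigma> p \<and> lev (- \<sigma>) x \<in> closed_segment (lev (- \<sigma>) p) (lev (- \<sigma>) q)"
    then obtain t where t: "t \<in> {0..1}" "lev (- \<sigma>) x = lev (- \<sigma>) p + t *\<^sub>R (lev (- \<sigma>) q - lev (- \<sigma>) p)"
      unfolding closed_segment_param by auto
    have "x = p + t *\<^sub>R (q - p)"
      by (rule lev_eqI[OF \<sigma>]) (use x t l pq in auto)
    then show "x \<in> closed_segment p q"
      using t by (auto simp: closed_segment_param)
  qed
qed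

lemma char_segment_triangle:
  assumes \<sigma>: "\<sigma> = 1 \<or> \<sigma> = -1" and "lev \<sigma> p = lev \<sigma> r" "lev \<sigma> r = lev \<sigma> q"
  shows "closed_segment p q \<subseteq> closed_segment p r \<union> closed_segment r q"
  using assms(2,3) by (auto simp: mem_char_segment_iff[OF \<sigma>] closed_segment_eq_real_ivl split: if_splits)

section \<open>Pairs of points joined by a segment\<close>

lemma closed_segments_subset: "closed L \<Longrightarrow> closed {z :: (real^2) \<times> (real^2). closed_segment (fst z) (snd z) \<subseteq> L}"
proof -
  assume L: "closed L"
  have "{z :: (real^2) \<times> (real^2). closed_segment (fst z) (snd z) \<subseteq> L} =
      (\<Inter>t\<in>{0..1}. (\<lambda>z. fst z + t *\<^sub>R (snd z - fst z)) -` L)"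
    unfolding closed_segment_param by blast
  then show ?thesis
    using L by (auto intro!: closed_INT closed_vimage continuous_intros)
qed

text \<open>The pairs whose segment leaves \<open>X\<close> form the projection of a closed set
  along the compact parameter interval.\<close>

lemma open_segments_subset: "open X \<Longrightarrow> open {z :: (real^2) \<times> (real^2). closed_segment (fst z) (snd z) \<subseteq> X}"
proof -
  assume X: "open X"
  let ?f = "\<lambda>w :: real \<times> ((real^2) \<times> (real^2)). fst (snd w) + fst w *\<^sub>R (snd (snd w) - fst (snd w))"
  have "closed (?f -` (- X))"
    using X by (intro closed_vimage) (auto intro!: continuous_intros)
  moreover have "compact {0..1::real}" by simp
  ultimately have "closed {z. \<exists>t. t \<in> {0..1} \<and> (t, z) \<in> ?f -` (- X)}"
    by (intro closed_compact_projection)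
  then have "open (- {z. \<exists>t. t \<in> {0..1} \<and> (t, z) \<in> ?f -` (- X)})"
    by (rule open_Compl)
  moreover have "- {z. \<exists>t. t \<in> {0..1} \<and> (t, z) \<in> ?f -` (- X)} = {z. closed_segment (fst z) (snd z) \<subseteq> X}"
    by (rule set_eqI) (simp add: closed_segment_param image_subset_iff Ball_def, blast)
  ultimately show ?thesis
    by simp
qed

text \<open>A compact section of the foliation by the level lines of \<open>lev \<sigma>\<close>: any two of its
  points on the same leaf are joined by the leaf inside \<open>X\<close>. The union of two sections with a common
  point is again a section because the set of good levels is closed, by convexity for supports,
  and open.\<close>

definition char_section :: "real \<Rightarrow> (real^2) set \<Rightarrow> (real^2) set \<Rightarrow> bool" where
  "char_section \<sigma> X S \<longleftrightarrow> compact S \<and> S \<subseteq> X \<and> connected (lev \<sigma> ` S) \<and>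
    (\<forall>p\<in>S. \<forall>q\<in>S. lev \<sigma> p = lev \<sigma> q \<longrightarrow> closed_segment p q \<subseteq> X)"

lemma char_section_Un:
  assumes X: "open X" "P_convex_for_supports wave_poly X" and \<sigma>: "\<sigma> = 1 \<or> \<sigma> = -1"
    and S: "char_section \<sigma> X S" and T: "char_section \<sigma> X T" and z: "z \<in> S" "z \<in> T"
  shows "char_section \<sigma> X (S \<union> T)"
proof -
  have cS: "compact S" "S \<subseteq> X" "connected (lev \<sigma> ` S)" and cT: "compact T" "T \<subseteq> X" "connected (lev \<sigma> ` T)"
    using S T by (auto simp: char_section_def)
  have sS: "closed_segment p q \<subseteq> X" if "p \<in> S" "q \<in> S" "lev \<sigma> p = lev \<sigma> q" for p q
    using S that unfolding char_section_def by blast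
  have sT: "closed_segment p q \<subseteq> X" if "p \<in> T" "q \<in> T" "lev \<sigma> p = lev \<sigma> q" for p q
    using T that unfolding char_section_def by blast
  have K: "compact (S \<union> T)" "S \<union> T \<subseteq> X"
    using cS cT by auto
  obtain L where L: "compact L \<and> L \<subseteq> X \<and> (\<forall>\<sigma>\<in>{1, -1}. \<forall>p\<in>S \<union> T. \<forall>q\<in>S \<union> T. lev \<sigma> p = lev \<sigma> q \<longrightarrow>
      closed_segment p q \<subseteq> X \<longrightarrow> closed_segment p q \<subseteq> L)"
    using P_convex_for_supports_segments[OF X K] ..
  have segL: "closed_segment p q \<subseteq> L"
    if "p \<in> S \<union> T" "q \<in> S \<union> T" "lev \<sigma> p = lev \<sigma> q" "closed_segment p q \<subseteq> X" for p q
    using L[THEN conjunct2, THEN conjunct2, rule_format, of \<sigma> p q] \<sigma> that by auto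
  \<comment> \<open>\<open>R\<close> collects the pairs from \<open>S\<close> and \<open>T\<close>
    on a common leaf, and \<open>G\<close> below the pairs whose segment stays in
    \<open>X\<close>.\<close>
  define R where "R = {w \<in> S \<times> T. lev \<sigma> (fst w) = lev \<sigma> (snd w)}"
  have "closed {w :: (real^2) \<times> (real^2). lev \<sigma> (fst w) = lev \<sigma> (snd w)}"
    by (intro closed_Collect_eq continuous_on_compose2[OF continuous_on_lev]) (auto intro!: continuous_intros)
  moreover have "R = S \<times> T \<inter> {w. lev \<sigma> (fst w) = lev \<sigma> (snd w)}"
    by (auto simp: R_def)
  ultimately have R: "compact R"
    using compact_Int_closed[OF compact_Times[OF cS(1) cT(1)]] by simp
  define G where "G = {w :: (real^2) \<times> (real^2). closed_segment (fst w) (snd w) \<subseteq> X}"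
  \<comment> \<open>Convexity for supports enters here: replacing the open set \<open>X\<close> by
    the fixed compact \<open>L\<close> makes the good pairs a closed subset of \<open>R\<close>. The
    bad pairs are closed because \<open>X\<close> is open.\<close>
  have "R \<inter> G = R \<inter> {w. closed_segment (fst w) (snd w) \<subseteq> L}"
  proof (intro equalityI subsetI)
    fix w assume w: "w \<in> R \<inter> G"
    then have "closed_segment (fst w) (snd w) \<subseteq> L"
      by (intro segL) (auto simp: R_def G_def)
    with w show "w \<in> R \<inter> {w. closed_segment (fst w) (snd w) \<subseteq> L}" by simp
  next
    fix w assume "w \<in> R \<inter> {w. closed_segment (fst w) (snd w) \<subseteq> L}"
    with L show "w \<in> R \<inter> G" by (auto simp: G_def)
  qed
  then have RG: "compact (R \<inter> G)"
    using compact_Int_closed[OF R closed_segments_subset[OF compact_imp_closed[of L]]] L by simp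
  have RN: "compact (R - G)"
    unfolding G_def by (rule compact_diff[OF R open_segments_subset[OF X(1)]])
  let ?l = "\<lambda>w :: (real^2) \<times> (real^2). lev \<sigma> (fst w)"
  have cl: "closed (?l ` A)" if "compact A" for A
    by (intro compact_imp_closed compact_continuous_image that continuous_on_compose2[OF continuous_on_lev])
      (auto intro!: continuous_intros)
  \<comment> \<open>Goodness is a property of the level: any pair on the leaf of a good pair is
    joined through that pair, the outer pieces being supplied by the sections \<open>S\<close> and
    \<open>T\<close>.\<close>
  have good: "closed_segment p q \<subseteq> X"
    if h: "(p', q') \<in> R \<inter> G" "p \<in> S" "q \<in> T" "lev \<sigma> p = lev \<sigma> p'" "lev \<sigma> p = lev \<sigma> q" for p q p' q'
  proof -
    have h': "p' \<in> S" "q' \<in> T" "lev \<sigma> p' = lev \<sigma> q'" "closed_segment p' q' \<subseteq> X"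
      using h by (auto simp: R_def G_def)
    have "closed_segment p q \<subseteq> closed_segment p p' \<union> (closed_segment p' q' \<union> closed_segment q' q)"
      using char_segment_triangle[OF \<sigma>, of p p' q] char_segment_triangle[OF \<sigma>, of p' q' q] h h' by auto
    then show ?thesis
      using sS[of p p'] sT[of q' q] h h' by auto
  qed
  \<comment> \<open>The common levels form an interval, so they cannot split into two nonempty
    closed sets of good and bad levels.\<close>
  have I: "connected (lev \<sigma> ` S \<inter> lev \<sigma> ` T)"
    using cS(3) cT(3) by (simp add: is_interval_Int flip: is_interval_connected_1)
  have un: "lev \<sigma> ` S \<inter> lev \<sigma> ` T \<subseteq> ?l ` (R \<inter> G) \<union> ?l ` (R - G)"
  proof
    fix u assume "u \<in> lev \<sigma> ` S \<inter> lev \<sigma> ` T"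
    then obtain p q where "p \<in> S" "q \<in> T" "lev \<sigma> p = u" "lev \<sigma> q = u"
      by auto
    then have "(p, q) \<in> R" "u = ?l (p, q)"
      by (auto simp: R_def)
    then show "u \<in> ?l ` (R \<inter> G) \<union> ?l ` (R - G)"
      by blast
  qed
  have disj: "?l ` (R \<inter> G) \<inter> ?l ` (R - G) = {}"
  proof -
    have False if "(p', q') \<in> R \<inter> G" "(p, q) \<in> R - G" "lev \<sigma> p = lev \<sigma> p'" for p q p' q'
      using good[OF that(1), of p q] that by (auto simp: R_def G_def)
    then show ?thesis
      by force
  qed
  \<comment> \<open>The common point gives a degenerate segment, hence at least one good
    level.\<close>
  have zz: "lev \<sigma> z \<in> ?l ` (R \<inter> G)"
    using z cS by (intro image_eqI[of _ _ "(z, z)"]) (auto simp: R_def G_def)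
  have empty: "(lev \<sigma> ` S \<inter> lev \<sigma> ` T) \<inter> ?l ` (R - G) = {}"
  proof (rule ccontr)
    assume "(lev \<sigma> ` S \<inter> lev \<sigma> ` T) \<inter> ?l ` (R - G) \<noteq> {}"
    moreover have "(lev \<sigma> ` S \<inter> lev \<sigma> ` T) \<inter> ?l ` (R \<inter> G) \<noteq> {}"
      using zz z by blast
    ultimately show False
      using I cl[OF RG] cl[OF RN] un disj unfolding connected_closed by blast
  qed
  have cross: "closed_segment p q \<subseteq> X" if "p \<in> S" "q \<in> T" "lev \<sigma> p = lev \<sigma> q" for p q
  proof -
    have "lev \<sigma> p \<in> lev \<sigma> ` S" "lev \<sigma> q \<in> lev \<sigma> ` T"
      by (rule imageI[OF that(1)], rule imageI[OF that(2)])
    then have "lev \<sigma> p \<in> lev \<sigma> ` S \<inter> lev \<sigma> ` T"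
      using that by simp
    then have "lev \<sigma> p \<in> ?l ` (R \<inter> G)"
      using un empty by blast
    then obtain w where "w \<in> R \<inter> G" "lev \<sigma> p = lev \<sigma> (fst w)"
      by blast
    then show ?thesis
      using good[of "fst w" "snd w" p q] that by simp
  qed
  have "connected (lev \<sigma> ` (S \<union> T))"
    unfolding image_Un using z by (intro connected_Un cS cT) auto
  moreover have "closed_segment p q \<subseteq> X" if "p \<in> S \<union> T" "q \<in> S \<union> T" "lev \<sigma> p = lev \<sigma> q" for p q
    using that sS[of p q] sT[of p q] cross[of p q] cross[of q p] by (auto simp: closed_segment_commute)
  ultimately show ?thesis
    using cS cT by (auto simp: char_section_def)
qed

text \<open>Lying in a common section is a symmetric and transitive relation by the union lemma, and
  it holds locally because closed balls in \<open>X\<close> are sections; connectedness extends it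
  to all of \<open>C\<close>.\<close>

lemma char_segment_subset_of_connected:
  assumes X: "open X" "P_convex_for_supports wave_poly X" and \<sigma>: "\<sigma> = 1 \<or> \<sigma> = -1"
    and C: "connected C" "C \<subseteq> X" "p \<in> C" "q \<in> C" and "lev \<sigma> p = lev \<sigma> q"
  shows "closed_segment p q \<subseteq> X"
proof -
  have ball: "char_section \<sigma> X (cball x r)" if "cball x r \<subseteq> X" for x r
  proof -
    have "closed_segment p q \<subseteq> cball x r" if "p \<in> cball x r" "q \<in> cball x r" for p q
      using that by (intro closed_segment_subset) auto
    then have "closed_segment p q \<subseteq> X" if "p \<in> cball x r" "q \<in> cball x r" for p q
      using that \<open>cball x r \<subseteq> X\<close> by blast
    moreover have "connected (lev \<sigma> ` cball x r)"
      by (intro connected_continuous_image continuous_on_lev) simp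
    ultimately show ?thesis
      using that by (simp add: char_section_def del: mem_cball)
  qed
  have "\<exists>S. char_section \<sigma> X S \<and> p \<in> S \<and> q \<in> S"
  proof (rule connected_equivalence_relation[where R = "\<lambda>p q. \<exists>S. char_section \<sigma> X S \<and> p \<in> S \<and> q \<in> S", OF C(1,3,4)])
    fix x y z
    assume "\<exists>S. char_section \<sigma> X S \<and> x \<in> S \<and> y \<in> S" "\<exists>S. char_section \<sigma> X S \<and> y \<in> S \<and> z \<in> S"
    then obtain S T where "char_section \<sigma> X S" "x \<in> S" "y \<in> S" "char_section \<sigma> X T" "y \<in> T" "z \<in> T"
      by blast
    then show "\<exists>S. char_section \<sigma> X S \<and> x \<in> S \<and> z \<in> S"
      using char_section_Un[OF X \<sigma>, of S T y] by blast
  next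
    fix x assume x: "x \<in> C"
    then obtain r where r: "0 < r" "cball x r \<subseteq> X"
      using X(1) C open_contains_cball by blast
    have "openin (top_of_set C) (C \<inter> ball x r)"
      by (simp add: openin_open_Int)
    moreover have "\<exists>S. char_section \<sigma> X S \<and> x \<in> S \<and> y \<in> S" if "y \<in> C \<inter> ball x r" for y
      using ball[OF r(2)] r that by (intro exI[of _ "cball x r"]) auto
    ultimately show "\<exists>T. openin (top_of_set C) T \<and> x \<in> T \<and> (\<forall>y\<in>T. \<exists>S. char_section \<sigma> X S \<and> x \<in> S \<and> y \<in> S)"
      using x r by (intro exI[of _ "C \<inter> ball x r"]) auto
  qed blast
  then show ?thesis
    using assms(8) unfolding char_section_def by blast
qed

section \<open>Gaps on characteristic lines\<close>

text \<open>If the segment left \<open>S\<close>, the component of the complement on the line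
  through a missing point would be an interval in the other characteristic variable avoiding both
  end points, hence trapped between them.\<close>

lemma segment_subset_if_no_gap:
  assumes \<sigma>: "\<sigma> = 1 \<or> \<sigma> = -1" and p: "p \<in> S" and q: "q \<in> S" and pq: "lev \<sigma> p = lev \<sigma> q"
    and gap: "\<And>A. A \<in> components (- S \<inter> {y. lev \<sigma> y = lev \<sigma> p}) \<Longrightarrow> A \<subseteq> closed_segment p q \<Longrightarrow> False"
  shows "closed_segment p q \<subseteq> S"
proof (rule ccontr)
  assume "\<not> closed_segment p q \<subseteq> S"
  then obtain z where z: "z \<in> closed_segment p q" "z \<notin> S" by blast
  let ?Z = "- S \<inter> {y. lev \<sigma> y = lev \<sigma> p}"
  let ?A = "connected_component_set ?Z z"
  let ?m = "lev (- \<sigma>)"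
  have zZ: "z \<in> ?Z"
    using z by (simp add: mem_char_segment_iff[OF \<sigma> pq])
  have A: "?A \<in> components ?Z"
    using zZ by (auto simp: components_def)
  have AZ: "?A \<subseteq> ?Z"
    by (rule connected_component_subset)
  have zA: "z \<in> ?A"
    using zZ by simp
  have "is_interval (?m ` ?A)"
    by (simp add: is_interval_connected_1 connected_continuous_image continuous_on_lev)
  then have ivl: "b \<in> ?m ` ?A" if "a \<in> ?m ` ?A" "c \<in> ?m ` ?A" "a \<le> b" "b \<le> c" for a b c
    using that unfolding is_interval_1 by blast
  have notin: "?m w \<notin> ?m ` ?A" if "w \<in> {p, q}" for w
  proof
    assume "?m w \<in> ?m ` ?A"
    then obtain y where y: "y \<in> ?A" "?m w = ?m y" by auto
    then have "lev \<sigma> y = lev \<sigma> p" "y \<notin> S" using AZ by auto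
    then have "y = w"
      using y that pq by (intro lev_eqI[OF \<sigma>]) auto
    then show False
      using \<open>y \<notin> S\<close> that p q by auto
  qed
  have "?A \<subseteq> closed_segment p q"
  proof
    fix y assume y: "y \<in> ?A"
    then have my: "?m y \<in> ?m ` ?A" and mz: "?m z \<in> ?m ` ?A"
      using zA by auto
    have "?m z \<in> closed_segment (?m p) (?m q)"
      using z by (simp add: mem_char_segment_iff[OF \<sigma> pq])
    then have "?m y \<in> closed_segment (?m p) (?m q)"
      using ivl[OF my mz, of "?m p"] ivl[OF my mz, of "?m q"] ivl[OF mz my, of "?m p"] ivl[OF mz my, of "?m q"]
        notin[of p] notin[of q]
      by (auto simp: closed_segment_eq_real_ivl split: if_splits)
    then show "y \<in> closed_segment p q"
      using y AZ by (auto simp: mem_char_segment_iff[OF \<sigma> pq])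
  qed
  with gap[OF A] show False .
qed

lemma char_line_1: "{vector [x $ 1 + s, x $ 2 + s] | s. True} = {y :: real^2. lev (-1) y = lev (-1) x}"
proof -
  have "y = vector [x $ 1 + (y $ 1 - x $ 1), x $ 2 + (y $ 1 - x $ 1)]" if "lev (-1) y = lev (-1) x" for y :: "real^2"
    using that by (simp add: vec_eq_iff forall_2 lev_def)
  moreover have "lev (-1) (vector [x $ 1 + s, x $ 2 + s] :: real^2) = lev (-1) x" for s
    by (simp add: lev_def)
  ultimately show ?thesis
    by blast
qed

lemma char_line_2: "{vector [x $ 1 - s, x $ 2 + s] | s. True} = {y :: real^2. lev 1 y = lev 1 x}"
proof -
  have "y = vector [x $ 1 - (x $ 1 - y $ 1), x $ 2 + (x $ 1 - y $ 1)]" if "lev 1 y = lev 1 x" for y :: "real^2"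
    using that by (simp add: vec_eq_iff forall_2 lev_def)
  moreover have "lev 1 (vector [x $ 1 - s, x $ 2 + s] :: real^2) = lev 1 x" for s
    by (simp add: lev_def)
  ultimately show ?thesis
    by blast
qed

text \<open>The segment is placed in \<open>X\<close>, then in \<open>Y\<close>, then in
  \<open>L\<close>, each time because a gap would lie inside the previous set. To reach the
  interior, the whole segment is translated by small vectors: its end points remain in
  \<open>L\<close>, and the argument applies again.\<close>

lemma interior_char_segment:
  fixes X Y L :: "(real^2) set"
  assumes X: "open X" "P_convex_for_supports wave_poly X" and "open Y" "Y \<subseteq> X" "L \<subseteq> Y"
    and gapY: "\<And>\<tau> x A. \<tau> = 1 \<or> \<tau> = -1 \<Longrightarrow> A \<in> components (- Y \<inter> {y. lev \<tau> y = lev \<tau> x}) \<Longrightarrow>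
      compact A \<Longrightarrow> A \<subseteq> X \<Longrightarrow> False"
    and gapL: "\<And>\<tau> x A. \<tau> = 1 \<or> \<tau> = -1 \<Longrightarrow> A \<in> components (- L \<inter> {y. lev \<tau> y = lev \<tau> x}) \<Longrightarrow>
      bounded A \<Longrightarrow> A \<subseteq> Y \<Longrightarrow> False"
    and \<sigma>: "\<sigma> = 1 \<or> \<sigma> = -1" and pq: "p \<in> interior L" "q \<in> interior L" "lev \<sigma> p = lev \<sigma> q"
    and C: "connected C" "C \<subseteq> X" "p \<in> C" "q \<in> C"
  shows "closed_segment p q \<subseteq> interior L"
proof
  have seg: "closed_segment p q \<subseteq> L"
    if C: "connected C" "C \<subseteq> X" "p \<in> C" "q \<in> C" and p: "p \<in> L" and q: "q \<in> L" and l: "lev \<sigma> p = lev \<sigma> q"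
    for p q C
  proof -
    have sX: "closed_segment p q \<subseteq> X"
      by (rule char_segment_subset_of_connected[OF X \<sigma> C l])
    have sY: "closed_segment p q \<subseteq> Y"
    proof (rule segment_subset_if_no_gap[OF \<sigma> _ _ l])
      fix A assume A: "A \<in> components (- Y \<inter> {y. lev \<sigma> y = lev \<sigma> p})" "A \<subseteq> closed_segment p q"
      \<comment> \<open>As \<open>Y\<close> is open, the gap is a component of a closed set and so
        closed; lying in a segment it is compact, as \<open>gapY\<close> demands.\<close>
      have "closed {y. lev \<sigma> y = lev \<sigma> p}"
        by (intro closed_Collect_eq continuous_on_lev continuous_on_const)
      then have "closed A"
        using \<open>open Y\<close> by (intro closed_components[OF _ A(1)] closed_Int) auto
      moreover have "bounded A"
        using A(2) bounded_closed_segment bounded_subset by blast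
      ultimately show False
        using gapY[OF \<sigma> A(1)] order_trans[OF A(2) sX] by (simp add: compact_eq_bounded_closed)
    qed (use p q \<open>L \<subseteq> Y\<close> in auto)
    show "closed_segment p q \<subseteq> L"
    proof (rule segment_subset_if_no_gap[OF \<sigma> p q l])
      fix A assume A: "A \<in> components (- L \<inter> {y. lev \<sigma> y = lev \<sigma> p})" "A \<subseteq> closed_segment p q"
      have "bounded A"
        using A(2) bounded_closed_segment bounded_subset by blast
      then show False
        using gapL[OF \<sigma> A(1)] order_trans[OF A(2) sY] by simp
    qed
  qed
  obtain r1 where r1: "0 < r1" "ball p r1 \<subseteq> L"
    using pq(1) by (auto simp: mem_interior)
  obtain r2 where r2: "0 < r2" "ball q r2 \<subseteq> L"
    using pq(2) by (auto simp: mem_interior)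
  define r where "r = min r1 r2"
  have r: "0 < r" "ball p r \<subseteq> L" "ball q r \<subseteq> L"
    using r1 r2 by (auto simp: r_def)
  fix x assume "x \<in> closed_segment p q"
  then obtain t where t: "t \<in> {0..1}" "x = p + t *\<^sub>R (q - p)"
    by (auto simp: closed_segment_param)
  have "y \<in> L" if y: "y \<in> ball x r" for y
  proof -
    define w where "w = y - x"
    have w: "norm w < r"
      using y by (simp add: w_def dist_norm norm_minus_commute)
    have pw: "p + w \<in> ball p r" and qw: "q + w \<in> ball q r"
      using w by (simp_all add: dist_norm)
    \<comment> \<open>The translated end points may leave \<open>C\<close>, so \<open>C\<close> is
      enlarged by two balls contained in \<open>L\<close>, which meet it in \<open>p\<close> and
      \<open>q\<close>.\<close>
    have "p \<in> ball p r \<inter> C" "q \<in> (ball p r \<union> C) \<inter> ball q r"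
      using C r(1) by auto
    then have "connected (ball p r \<union> C \<union> ball q r)"
      using C by (intro connected_Un connected_ball) blast+
    moreover have "ball p r \<union> C \<union> ball q r \<subseteq> X"
      using r C assms by auto
    moreover have "lev \<sigma> (p + w) = lev \<sigma> (q + w)"
      using pq(3) by (simp add: lev_def algebra_simps)
    ultimately have "closed_segment (p + w) (q + w) \<subseteq> L"
      using pw qw r by (intro seg[of "ball p r \<union> C \<union> ball q r"]) auto
    moreover have "y = (p + w) + t *\<^sub>R ((q + w) - (p + w))"
      by (simp add: w_def t)
    ultimately show ?thesis
      using t unfolding closed_segment_param by blast
  qed
  then show "x \<in> interior L"
    using r(1) by (auto simp: mem_interior)
qed

section \<open>Approximation on one component\<close>

text \<open>If u varies over a short interval while v is fixed, the other wave cancels in the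
  difference and twice the bound remains. Bisection chains finitely many short intervals together;
  the resulting constant depends on \<open>W\<close> and the interval but not on the waves.\<close>

lemma level_oscillation:
  assumes \<sigma>: "\<sigma> = 1 \<or> \<sigma> = -1" and W: "open W" and cd: "c \<le> d" "{c..d} \<subseteq> lev \<sigma> ` W"
  shows "\<exists>C\<ge>0. \<forall>a b S. 0 \<le> S \<longrightarrow> (\<forall>x\<in>W. cmod (a (lev \<sigma> x) + b (lev (- \<sigma>) x)) \<le> S) \<longrightarrow>
    (\<forall>u\<in>{c..d}. \<forall>v\<in>{c..d}. cmod (a u - a v) \<le> C * S)"
  using cd(1)
proof (induction rule: Bolzano)
  case (trans x y z)
  obtain C1 where C1: "C1 \<ge> 0" "\<And>a b S u v. 0 \<le> S \<Longrightarrow> (\<forall>x\<in>W. cmod (a (lev \<sigma> x) + b (lev (- \<sigma>) x)) \<le> S) \<Longrightarrow>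
      u \<in> {x..y} \<Longrightarrow> v \<in> {x..y} \<Longrightarrow> cmod (a u - a v) \<le> C1 * S"
    using trans(1) by blast
  obtain C2 where C2: "C2 \<ge> 0" "\<And>a b S u v. 0 \<le> S \<Longrightarrow> (\<forall>x\<in>W. cmod (a (lev \<sigma> x) + b (lev (- \<sigma>) x)) \<le> S) \<Longrightarrow>
      u \<in> {y..z} \<Longrightarrow> v \<in> {y..z} \<Longrightarrow> cmod (a u - a v) \<le> C2 * S"
    using trans(2) by blast
  show ?case
  proof (intro exI[of _ "C1 + C2"] conjI allI impI ballI)
    fix a b :: "real \<Rightarrow> complex" and S u v :: real
    assume S: "0 \<le> S" and h: "\<forall>x\<in>W. cmod (a (lev \<sigma> x) + b (lev (- \<sigma>) x)) \<le> S"
      and u: "u \<in> {x..z}" and v: "v \<in> {x..z}"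
    note c1 = C1(2)[OF S h] and c2 = C2(2)[OF S h]
    have nn: "0 \<le> C1 * S" "0 \<le> C2 * S"
      using C1(1) C2(1) S by simp_all
    have tri: "cmod (a u - a v) \<le> cmod (a u - a y) + cmod (a y - a v)"
      using norm_triangle_ineq[of "a u - a y" "a y - a v"] by simp
    have "cmod (a u - a v) \<le> C1 * S + C2 * S"
    proof (cases "u \<le> y"; cases "v \<le> y")
      assume "u \<le> y" "v \<le> y"
      then show ?thesis using c1[of u v] u v nn by auto
    next
      assume "u \<le> y" "\<not> v \<le> y"
      then show ?thesis using c1[of u y] c2[of y v] u v tri trans by auto
    next
      assume "\<not> u \<le> y" "v \<le> y"
      then show ?thesis using c2[of u y] c1[of y v] u v tri trans by auto
    next
      assume "\<not> u \<le> y" "\<not> v \<le> y"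
      then show ?thesis using c2[of u v] u v nn by auto
    qed
    then show "cmod (a u - a v) \<le> (C1 + C2) * S"
      by (simp add: algebra_simps)
  qed (use C1 C2 in simp)
next
  case (local u0)
  then obtain z where z: "z \<in> W" "lev \<sigma> z = u0"
    using cd(2) by auto
  then obtain r where r: "0 < r" "ball z r \<subseteq> W"
    using W open_contains_ball by blast
  \<comment> \<open>This direction changes \<open>lev \<sigma>\<close> at unit speed and leaves
    \<open>lev (- \<sigma>)\<close> fixed; its norm is at most 1, so short moves stay in the
    ball.\<close>
  define e :: "real^2" where "e = vector [1/2, \<sigma>/2]"
  have e: "lev \<sigma> e = 1" "lev (- \<sigma>) e = 0"
    using \<sigma> by (auto simp: e_def lev_def)
  have "norm e \<le> \<bar>e $ 1\<bar> + \<bar>e $ 2\<bar>"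
    using norm_le_l1_cart[of e] by (simp add: sum_2)
  also have "\<dots> = 1"
    using \<sigma> by (auto simp: e_def)
  finally have ne: "norm e \<le> 1" .
  show ?case
  proof (rule exI[of _ r], rule conjI[OF r(1)], intro allI impI)
    fix s t assume st: "s \<le> u0 \<and> u0 \<le> t \<and> t - s < r"
    show "\<exists>C\<ge>0. \<forall>a b S. 0 \<le> S \<longrightarrow> (\<forall>x\<in>W. cmod (a (lev \<sigma> x) + b (lev (- \<sigma>) x)) \<le> S) \<longrightarrow>
      (\<forall>u\<in>{s..t}. \<forall>v\<in>{s..t}. cmod (a u - a v) \<le> C * S)"
    proof (intro exI[of _ 2] conjI allI impI ballI)
      fix a b :: "real \<Rightarrow> complex" and S u v :: real
      assume S: "0 \<le> S" and h: "\<forall>x\<in>W. cmod (a (lev \<sigma> x) + b (lev (- \<sigma>) x)) \<le> S"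
        and u: "u \<in> {s..t}" and v: "v \<in> {s..t}"
      have b: "cmod (a w + b (lev (- \<sigma>) z)) \<le> S" if w: "w \<in> {s..t}" for w
      proof -
        have "norm ((w - u0) *\<^sub>R e) \<le> \<bar>w - u0\<bar> * 1"
          using mult_left_mono[OF ne, of "\<bar>w - u0\<bar>"] by simp
        also have "\<dots> < r"
          using w st by auto
        finally have "z + (w - u0) *\<^sub>R e \<in> W"
          using r(2) by (auto simp: dist_norm subset_iff)
        from h[rule_format, OF this] show ?thesis
          by (simp add: lev_add_scale e z)
      qed
      have "cmod (a u - a v) \<le> cmod (a u + b (lev (- \<sigma>) z)) + cmod (a v + b (lev (- \<sigma>) z))"
        using norm_triangle_ineq4[of "a u + b (lev (- \<sigma>) z)" "a v + b (lev (- \<sigma>) z)"] by simp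
      then show "cmod (a u - a v) \<le> 2 * S"
        using b[OF u] b[OF v] by simp
    qed simp
  qed
qed

lemma interval_margin:
  fixes J K :: "real set"
  assumes "open J" "connected J" "compact K" "K \<subseteq> J" "K \<noteq> {}"
  shows "\<exists>c d \<eta>. 0 < \<eta> \<and> c \<le> d \<and> K \<subseteq> {c + \<eta><..<d - \<eta>} \<and> {c - \<eta>..d + \<eta>} \<subseteq> J"
proof -
  obtain m where m: "m \<in> K" "\<And>x. x \<in> K \<Longrightarrow> m \<le> x"
    using compact_attains_inf[OF assms(3,5)] by blast
  obtain M where M: "M \<in> K" "\<And>x. x \<in> K \<Longrightarrow> x \<le> M"
    using compact_attains_sup[OF assms(3,5)] by blast
  obtain r where r: "0 < r" "cball m r \<subseteq> J"
    using assms m open_contains_cball by blast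
  obtain r' where r': "0 < r'" "cball M r' \<subseteq> J"
    using assms M open_contains_cball by blast
  \<comment> \<open>Three equal margins: one keeps \<open>K\<close> well inside the cutoff interval,
    one is slack that keeps the inclusion strict, and one leaves room for the mollification to
    spread inside \<open>J\<close>.\<close>
  define \<eta> where "\<eta> = min r r' / 3"
  have \<eta>: "0 < \<eta>" "3 * \<eta> \<le> r" "3 * \<eta> \<le> r'"
    using r r' by (auto simp: \<eta>_def)
  have "m - 3 * \<eta> \<in> cball m r" "M + 3 * \<eta> \<in> cball M r'"
    using \<eta> by (auto simp: dist_real_def)
  then have "m - 3 * \<eta> \<in> J" "M + 3 * \<eta> \<in> J"
    using r r' by blast+
  then have "{m - 3 * \<eta>..M + 3 * \<eta>} \<subseteq> J"
    by (rule connected_contains_Icc[OF assms(2)])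
  then have "{(m - 2 * \<eta>) - \<eta>..(M + 2 * \<eta>) + \<eta>} \<subseteq> J"
    by (simp add: add.commute)
  moreover have "K \<subseteq> {(m - 2 * \<eta>) + \<eta><..<(M + 2 * \<eta>) - \<eta>}"
  proof
    fix x assume "x \<in> K"
    then show "x \<in> {(m - 2 * \<eta>) + \<eta><..<(M + 2 * \<eta>) - \<eta>}"
      using m(2)[of x] M(2)[of x] \<eta>(1) by simp
  qed
  moreover have "m - 2 * \<eta> \<le> M + 2 * \<eta>"
    using m(1) M(2)[of m] \<eta>(1) by simp
  ultimately show ?thesis
    using \<eta>(1) by blast
qed

lemma deriv_seq_diff: "deriv_seq T A \<Longrightarrow> deriv_seq T B \<Longrightarrow> deriv_seq T (\<lambda>n t. A n t - B n t)"
  unfolding deriv_seq_def by (auto intro: has_vector_derivative_diff)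

lemma deriv_seq_sum: "(\<And>i. i \<in> I \<Longrightarrow> deriv_seq T (A i)) \<Longrightarrow> deriv_seq T (\<lambda>n t. \<Sum>i\<in>I. A i n t)"
  unfolding deriv_seq_def by (auto intro!: has_vector_derivative_sum)

lemma smooth_on_subset: "smooth_on Y f \<Longrightarrow> W \<subseteq> Y \<Longrightarrow> smooth_on W f"
proof -
  have "Ck_on k Y f \<Longrightarrow> W \<subseteq> Y \<Longrightarrow> Ck_on k W f" for k f
    by (induction k arbitrary: f) (auto intro: continuous_on_subset)
  then show "smooth_on Y f \<Longrightarrow> W \<subseteq> Y \<Longrightarrow> smooth_on W f"
    unfolding smooth_on_def by blast
qed

lemma kernel_space_wave_subset: "f \<in> kernel_space wave_poly Y \<Longrightarrow> W \<subseteq> Y \<Longrightarrow> f \<in> kernel_space wave_poly W"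
  unfolding kernel_space_wave_iff using smooth_on_subset by blast

text \<open>For order n at least 1, trading one derivative in the first coordinate for one in the
  second flips the sign of the second wave, so each wave is half a sum or difference of two
  derivatives of \<open>f\<close>. At order 0 there is no derivative to trade, and the oscillation
  estimate takes over.\<close>

lemma wave_sum_component_bounds:
  assumes W: "open W" "W \<subseteq> L" and Y: "compact L" "L \<subseteq> Y" and f: "smooth_on Y f"
    and G: "deriv_seq (lev 1 ` W) G" and H: "deriv_seq (lev (-1) ` W) H"
    and eq: "\<And>x. x \<in> W \<Longrightarrow> f x = wave_sum G H 0 1 x" and n: "1 \<le> n" "n \<le> r"
  shows "u \<in> lev 1 ` W \<Longrightarrow> cmod (G n u) \<le> seminorm L r f"
    and "v \<in> lev (-1) ` W \<Longrightarrow> cmod (H n v) \<le> seminorm L r f"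
proof -
  have *: "cmod (G n (lev 1 x)) \<le> seminorm L r f \<and> cmod (H n (lev (-1) x)) \<le> seminorm L r f"
    if x: "x \<in> W" for x
  proof -
    obtain \<alpha> :: "2 \<Rightarrow>\<^sub>0 nat" where \<alpha>: "Poly_Mapping.lookup \<alpha> 1 = n" "Poly_Mapping.lookup \<alpha> 2 = 0"
      using multi_index_2 by blast
    obtain \<beta> :: "2 \<Rightarrow>\<^sub>0 nat" where \<beta>: "Poly_Mapping.lookup \<beta> 1 = n - 1" "Poly_Mapping.lookup \<beta> 2 = 1"
      using multi_index_2 by blast
    have o: "mi_order \<alpha> = n" "mi_order \<beta> = n"
      using \<alpha> \<beta> n by (auto simp: mi_order_2)
    have eqn: "mi_deriv \<gamma> f x = mi_deriv \<gamma> (wave_sum G H 0 1) x" for \<gamma>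
      by (rule mi_deriv_cong_open[OF W(1) x eq])
    have a: "mi_deriv \<alpha> f x = G n (lev 1 x) + H n (lev (-1) x)"
      by (simp add: eqn mi_deriv_wave_sum[OF W(1) G H x] o \<alpha> wave_sum_def)
    have b: "mi_deriv \<beta> f x = G n (lev 1 x) - H n (lev (-1) x)"
      by (simp add: eqn mi_deriv_wave_sum[OF W(1) G H x] o \<beta> wave_sum_def)
    have ab: "cmod (mi_deriv \<alpha> f x) \<le> seminorm L r f" "cmod (mi_deriv \<beta> f x) \<le> seminorm L r f"
      using x W o n by (auto intro!: seminorm_upper[OF f Y])
    have "2 * G n (lev 1 x) = mi_deriv \<alpha> f x + mi_deriv \<beta> f x"
      by (simp add: a b)
    then have "cmod (2 * G n (lev 1 x)) \<le> cmod (mi_deriv \<alpha> f x) + cmod (mi_deriv \<beta> f x)"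
      by (simp only: norm_triangle_ineq)
    moreover have "2 * H n (lev (-1) x) = mi_deriv \<alpha> f x - mi_deriv \<beta> f x"
      by (simp add: a b)
    then have "cmod (2 * H n (lev (-1) x)) \<le> cmod (mi_deriv \<alpha> f x) + cmod (mi_deriv \<beta> f x)"
      by (simp only: norm_triangle_ineq4)
    ultimately show ?thesis
      using ab by (simp add: norm_mult)
  qed
  show "u \<in> lev 1 ` W \<Longrightarrow> cmod (G n u) \<le> seminorm L r f"
    and "v \<in> lev (-1) ` W \<Longrightarrow> cmod (H n v) \<le> seminorm L r f"
    using * by blast+
qed

text \<open>Vanishing outside the projections of \<open>W\<close> is required so that waves built
  for other components can be added without disturbing each other; \<open>C\<close> is chosen before
  \<open>f\<close> and \<epsilon>.\<close>

lemma component_approximation: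
  fixes W K L Y :: "(real^2) set" and r1 r2 :: nat
  assumes W: "open W" "connected W" "char_convex W" and K: "compact K" "K \<subseteq> W" "K \<noteq> {}"
    and L: "compact L" "L \<subseteq> Y" "W \<subseteq> L"
  shows "\<exists>C>0. \<forall>f\<in>kernel_space wave_poly Y. \<forall>\<epsilon>::real. 0 < \<epsilon> \<and> \<epsilon> < 1 \<longrightarrow> (\<exists>A B.
    deriv_seq UNIV A \<and> deriv_seq UNIV B \<and>
    (\<forall>t. t \<notin> lev 1 ` W \<longrightarrow> A 0 t = 0) \<and> (\<forall>t. t \<notin> lev (-1) ` W \<longrightarrow> B 0 t = 0) \<and>
    (\<forall>x\<in>K. \<forall>\<alpha>. mi_order \<alpha> \<le> r1 \<longrightarrow>
      cmod (mi_deriv \<alpha> (\<lambda>x. f x - wave_sum A B 0 1 x) x) \<le> \<epsilon> * seminorm L (r1 + 1) f) \<and>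
    (\<forall>n\<le>r2. \<forall>t. cmod (A n t) \<le> C / \<epsilon> ^ Suc r2 * seminorm L 0 f \<and>
      cmod (B n t) \<le> C / \<epsilon> ^ Suc r2 * seminorm L 0 f))"
proof -
  obtain x0 where x0: "x0 \<in> K" using K by auto
  then have x0W: "x0 \<in> W" using K by auto
  have lK: "compact (lev \<sigma> ` K)" "lev \<sigma> ` K \<subseteq> lev \<sigma> ` W" "lev \<sigma> ` K \<noteq> {}" for \<sigma>
    using K by (auto intro!: compact_continuous_image continuous_on_lev)
  have lW: "open (lev \<sigma> ` W)" "connected (lev \<sigma> ` W)" for \<sigma>
    using W by (auto intro!: open_lev_image connected_continuous_image continuous_on_lev)
  obtain c1 d1 \<eta>1 where m1: "0 < \<eta>1" "c1 \<le> d1" "lev 1 ` K \<subseteq> {c1 + \<eta>1<..<d1 - \<eta>1}" "{c1 - \<eta>1..d1 + \<eta>1} \<subseteq> lev 1 ` W"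
    using interval_margin[OF lW lK, of 1] by blast
  obtain c2 d2 \<eta>2 where m2: "0 < \<eta>2" "c2 \<le> d2" "lev (-1) ` K \<subseteq> {c2 + \<eta>2<..<d2 - \<eta>2}" "{c2 - \<eta>2..d2 + \<eta>2} \<subseteq> lev (-1) ` W"
    using interval_margin[OF lW lK, of "-1"] by blast
  have s1: "{c1..d1} \<subseteq> lev 1 ` W"
    by (rule order_trans[OF _ m1(4)]) (use m1 in auto)
  have s2: "{c2..d2} \<subseteq> lev (-1) ` W"
    by (rule order_trans[OF _ m2(4)]) (use m2 in auto)
  have u0: "lev 1 x0 \<in> {c1..d1}"
    using imageI[OF x0, of "lev 1"] m1 by auto
  have v0: "lev (-1) x0 \<in> {c2..d2}"
    using imageI[OF x0, of "lev (-1)"] m2 by auto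
  obtain E1 where E1: "E1 \<ge> 0" and osc1: "\<And>a b S u v. 0 \<le> S \<Longrightarrow> \<forall>x\<in>W. cmod (a (lev 1 x) + b (lev (- 1) x)) \<le> S \<Longrightarrow>
      u \<in> {c1..d1} \<Longrightarrow> v \<in> {c1..d1} \<Longrightarrow> cmod (a u - a v) \<le> E1 * S"
    using level_oscillation[of 1, OF _ W(1) m1(2) s1] by auto
  obtain E2 where E2: "E2 \<ge> 0" and osc2: "\<And>a b S u v. 0 \<le> S \<Longrightarrow> \<forall>x\<in>W. cmod (a (lev (-1) x) + b (lev (- (-1)) x)) \<le> S \<Longrightarrow>
      u \<in> {c2..d2} \<Longrightarrow> v \<in> {c2..d2} \<Longrightarrow> cmod (a u - a v) \<le> E2 * S"
    using level_oscillation[of "-1", OF _ W(1) m2(2) s2] by auto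
  obtain BB :: "nat \<Rightarrow> real" where BB: "\<And>n. 0 \<le> BB n" and moll:
    "\<And>T a c d \<delta>. deriv_seq T a \<Longrightarrow> {c..d} \<subseteq> T \<Longrightarrow> c \<le> d \<Longrightarrow> 0 < \<delta> \<Longrightarrow> \<exists>A. deriv_seq UNIV A \<and>
      (\<forall>n x. x \<notin> {c - \<delta><..<d + \<delta>} \<longrightarrow> A n x = 0) \<and>
      (\<forall>n x S. (\<forall>s\<in>{c..d}. cmod (a 0 s) \<le> S) \<longrightarrow> cmod (A n x) \<le> (d - c) * BB n * S / \<delta> ^ Suc n) \<and>
      (\<forall>n x S. x \<in> {c + \<delta><..<d - \<delta>} \<longrightarrow> (\<forall>s\<in>{c..d}. cmod (a (Suc n) s) \<le> S) \<longrightarrow>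
        cmod (A n x - a n x) \<le> \<delta> * S)"
    by (rule mollify) blast
  \<comment> \<open>The margins keep the mollification scale admissible on both axes; the bound 1/2
    compensates for the two waves each contributing an error.\<close>
  define \<theta> where "\<theta> = min (min \<eta>1 \<eta>2) (1/2)"
  have \<theta>: "0 < \<theta>" "\<theta> \<le> \<eta>1" "\<theta> \<le> \<eta>2" "\<theta> \<le> 1/2"
    using m1 m2 by (auto simp: \<theta>_def)
  \<comment> \<open>Total interval length, bump constants of all orders up to \<open>r2\<close>, and
    a common factor bounding both waves by the supremum of \<open>f\<close>. The summand 1 in
    \<open>C\<close> makes it positive.\<close>
  define D where "D = (d1 - c1 + (d2 - c2)) * (\<Sum>n\<le>r2. BB n) * (E1 + E2 + 1)"
  define C where "C = D / \<theta> ^ Suc r2 + 1"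
  have D: "0 \<le> D"
    unfolding D_def using m1 m2 E1 E2 BB by (intro mult_nonneg_nonneg sum_nonneg) auto
  have C: "0 < C" "D / \<theta> ^ Suc r2 \<le> C"
    using D \<theta> by (auto simp: C_def intro!: add_nonneg_pos divide_nonneg_nonneg)
  show ?thesis
  proof (intro exI[of _ C] conjI C(1) ballI allI impI)
    fix f \<epsilon> assume f: "f \<in> kernel_space wave_poly Y" and \<epsilon>: "0 < \<epsilon> \<and> \<epsilon> < (1::real)"
    have sf: "smooth_on Y f" using f by (simp add: kernel_space_wave_iff)
    define S0 where "S0 = seminorm L 0 f"
    define S1 where "S1 = seminorm L (r1 + 1) f"
    have S: "0 \<le> S0" "0 \<le> S1"
      unfolding S0_def S1_def by (rule seminorm_nonneg[OF sf L(1,2)])+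
    have fS: "cmod (f x) \<le> S0" if "x \<in> W" for x
      using seminorm_upper[OF sf L(1,2), of x 0 0] that L(3) by (auto simp: S0_def mi_deriv_zero mi_order_2)
    have "f \<in> kernel_space wave_poly W"
      using kernel_space_wave_subset[OF f] L by blast
    then obtain G H where G: "deriv_seq (lev 1 ` W) G" and H: "deriv_seq (lev (-1) ` W) H"
      and fGH: "\<And>x. x \<in> W \<Longrightarrow> f x = wave_sum G H 0 1 x" and H0: "H 0 (lev (-1) x0) = 0"
      by (rule wave_decomposition[OF W x0W]) (rule that, assumption, assumption, blast, assumption)
    have bdW: "\<forall>x\<in>W. cmod (G 0 (lev 1 x) + H 0 (lev (-1) x)) \<le> S0"
      using fS fGH by (simp add: wave_sum_def)
    then have bdW': "\<forall>x\<in>W. cmod (H 0 (lev (-1) x) + G 0 (lev (- (-1)) x)) \<le> S0"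
      by (simp add: add.commute)
    \<comment> \<open>By the normalisation of \<open>H\<close>, the first wave takes the value of
      \<open>f\<close> at \<open>x0\<close>; oscillation then bounds both waves.\<close>
    have G0: "cmod (G 0 (lev 1 x0)) \<le> S0"
      using bdW x0W H0 by force
    have Gb: "cmod (G 0 u) \<le> (E1 + E2 + 1) * S0" if "u \<in> {c1..d1}" for u
    proof -
      have "cmod (G 0 u) \<le> cmod (G 0 u - G 0 (lev 1 x0)) + cmod (G 0 (lev 1 x0))"
        using norm_triangle_ineq[of "G 0 u - G 0 (lev 1 x0)" "G 0 (lev 1 x0)"] by simp
      also have "\<dots> \<le> E1 * S0 + S0"
        using osc1[OF S(1) bdW that u0] G0 by simp
      also have "\<dots> \<le> (E1 + E2 + 1) * S0"
        using E2 S by (simp add: algebra_simps)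
      finally show ?thesis .
    qed
    have Hb: "cmod (H 0 v) \<le> (E1 + E2 + 1) * S0" if "v \<in> {c2..d2}" for v
    proof -
      have "cmod (H 0 v) \<le> E2 * S0"
        using osc2[OF S(1) bdW' that v0] H0 by simp
      also have "\<dots> \<le> (E1 + E2 + 1) * S0"
        using E1 S by (simp add: algebra_simps)
      finally show ?thesis .
    qed
    define \<delta> where "\<delta> = \<theta> * \<epsilon>"
    have \<delta>: "0 < \<delta>" "\<delta> \<le> \<theta>" "2 * \<delta> \<le> \<epsilon>" "\<delta> \<le> 1"
    proof -
      show "0 < \<delta>" using \<theta> \<epsilon> by (simp add: \<delta>_def)
      show "\<delta> \<le> \<theta>" using \<theta> \<epsilon> by (simp add: \<delta>_def mult_left_le)
      then show "\<delta> \<le> 1" using \<theta> by simp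
      show "2 * \<delta> \<le> \<epsilon>"
        using mult_right_mono[OF \<theta>(4), of \<epsilon>] \<epsilon> by (simp add: \<delta>_def)
    qed
    obtain A where A: "deriv_seq UNIV A" "\<And>n x. x \<notin> {c1 - \<delta><..<d1 + \<delta>} \<Longrightarrow> A n x = 0"
      and Ab: "\<And>n x S. \<forall>s\<in>{c1..d1}. cmod (G 0 s) \<le> S \<Longrightarrow> cmod (A n x) \<le> (d1 - c1) * BB n * S / \<delta> ^ Suc n"
      and An: "\<And>n x S. x \<in> {c1 + \<delta><..<d1 - \<delta>} \<Longrightarrow> \<forall>s\<in>{c1..d1}. cmod (G (Suc n) s) \<le> S \<Longrightarrow>
        cmod (A n x - G n x) \<le> \<delta> * S"
      using moll[OF G s1 m1(2) \<delta>(1)] by auto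
    obtain B where B: "deriv_seq UNIV B" "\<And>n x. x \<notin> {c2 - \<delta><..<d2 + \<delta>} \<Longrightarrow> B n x = 0"
      and Bb: "\<And>n x S. \<forall>s\<in>{c2..d2}. cmod (H 0 s) \<le> S \<Longrightarrow> cmod (B n x) \<le> (d2 - c2) * BB n * S / \<delta> ^ Suc n"
      and Bn: "\<And>n x S. x \<in> {c2 + \<delta><..<d2 - \<delta>} \<Longrightarrow> \<forall>s\<in>{c2..d2}. cmod (H (Suc n) s) \<le> S \<Longrightarrow>
        cmod (B n x - H n x) \<le> \<delta> * S"
      using moll[OF H s2 m2(2) \<delta>(1)] by auto
    have "A 0 t = 0" if "t \<notin> lev 1 ` W" for t
    proof -
      have "t \<notin> {c1 - \<eta>1..d1 + \<eta>1}" using m1(4) that by blast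
      then show ?thesis using A(2)[of t 0] \<delta> \<theta> by auto
    qed
    moreover have "B 0 t = 0" if "t \<notin> lev (-1) ` W" for t
    proof -
      have "t \<notin> {c2 - \<eta>2..d2 + \<eta>2}" using m2(4) that by blast
      then show ?thesis using B(2)[of t 0] \<delta> \<theta> by auto
    qed
    moreover have "cmod (mi_deriv \<alpha> (\<lambda>x. f x - wave_sum A B 0 1 x) x) \<le> \<epsilon> * S1"
      if x: "x \<in> K" and \<alpha>: "mi_order \<alpha> \<le> r1" for x \<alpha>
    proof -
      let ?n = "mi_order \<alpha>"
      let ?P = "\<lambda>n t. G n t - A n t" and ?Q = "\<lambda>n t. H n t - B n t"
      have xW: "x \<in> W" using x K by blast
      have P: "deriv_seq (lev 1 ` W) ?P" and Q: "deriv_seq (lev (-1) ` W) ?Q"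
        using G H A(1) B(1) by (auto intro!: deriv_seq_diff intro: deriv_seq_subset)
      have "mi_deriv \<alpha> (\<lambda>x. f x - wave_sum A B 0 1 x) x = mi_deriv \<alpha> (wave_sum ?P ?Q 0 1) x"
        by (rule mi_deriv_cong_open[OF W(1) xW]) (simp add: fGH wave_sum_def)
      also have "\<dots> = ?P ?n (lev 1 x) + (- 1) ^ Poly_Mapping.lookup \<alpha> 2 * ?Q ?n (lev (-1) x)"
        by (simp only: mi_deriv_wave_sum[OF W(1) P Q xW] wave_sum_def)
      also have "cmod \<dots> \<le> cmod (?P ?n (lev 1 x)) + cmod ((- 1) ^ Poly_Mapping.lookup \<alpha> 2 * ?Q ?n (lev (-1) x))"
        by (rule norm_triangle_ineq)
      also have "\<dots> = cmod (A ?n (lev 1 x) - G ?n (lev 1 x)) + cmod (B ?n (lev (-1) x) - H ?n (lev (-1) x))"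
        by (simp add: norm_mult norm_power norm_minus_commute)
      \<comment> \<open>The mollification error at order n uses the derivative of order n + 1,
        whence the seminorm of order \<open>r1 + 1\<close>.\<close>
      also have "\<dots> \<le> \<delta> * S1 + \<delta> * S1"
      proof (intro add_mono An Bn ballI)
        show "lev 1 x \<in> {c1 + \<delta><..<d1 - \<delta>}"
          using imageI[OF x, of "lev 1"] m1 \<delta> \<theta> by auto
        show "lev (-1) x \<in> {c2 + \<delta><..<d2 - \<delta>}"
          using imageI[OF x, of "lev (-1)"] m2 \<delta> \<theta> by auto
        show "cmod (G (Suc ?n) s) \<le> S1" if "s \<in> {c1..d1}" for s
          unfolding S1_def using s1 that \<alpha>
          by (intro wave_sum_component_bounds(1)[OF W(1) L(3,1,2) sf G H fGH]) auto
        show "cmod (H (Suc ?n) s) \<le> S1" if "s \<in> {c2..d2}" for s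
          unfolding S1_def using s2 that \<alpha>
          by (intro wave_sum_component_bounds(2)[OF W(1) L(3,1,2) sf G H fGH]) auto
      qed
      also have "\<dots> \<le> \<epsilon> * S1"
        using mult_right_mono[OF \<delta>(3) S(2)] by (simp add: algebra_simps)
      finally show ?thesis .
    qed
    moreover have "cmod (A n t) \<le> C / \<epsilon> ^ Suc r2 * S0 \<and> cmod (B n t) \<le> C / \<epsilon> ^ Suc r2 * S0"
      if n: "n \<le> r2" for n t
    proof -
      have bnd: "l * BB n * ((E1 + E2 + 1) * S0) / \<delta> ^ Suc n \<le> C / \<epsilon> ^ Suc r2 * S0"
        if l: "0 \<le> l" "l \<le> d1 - c1 + (d2 - c2)" for l
      proof -
        have "l * BB n * ((E1 + E2 + 1) * S0) \<le> (d1 - c1 + (d2 - c2)) * (\<Sum>n\<le>r2. BB n) * ((E1 + E2 + 1) * S0)"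
          using l BB n E1 E2 S
          by (intro mult_right_mono mult_mono member_le_sum mult_nonneg_nonneg) (auto intro: order_trans)
        also have "\<dots> = D * S0"
          by (simp add: D_def)
        finally have "l * BB n * ((E1 + E2 + 1) * S0) / \<delta> ^ Suc n \<le> D * S0 / \<delta> ^ Suc n"
          using \<delta> by (intro divide_right_mono) auto
        \<comment> \<open>Since \<delta> is at most 1, the highest order is the worst one and serves
          for all n up to \<open>r2\<close>.\<close>
        also have "\<dots> \<le> D * S0 / \<delta> ^ Suc r2"
          using \<delta> n D S by (intro divide_left_mono power_decreasing mult_pos_pos zero_less_power) auto
        also have "\<dots> = (D / \<theta> ^ Suc r2) / \<epsilon> ^ Suc r2 * S0"
          by (simp add: \<delta>_def power_mult_distrib)
        also have "\<dots> \<le> C / \<epsilon> ^ Suc r2 * S0"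
          using C(2) S \<epsilon> by (intro mult_right_mono divide_right_mono) auto
        finally show ?thesis .
      qed
      have "cmod (A n t) \<le> (d1 - c1) * BB n * ((E1 + E2 + 1) * S0) / \<delta> ^ Suc n"
        using Gb by (intro Ab) auto
      moreover have "cmod (B n t) \<le> (d2 - c2) * BB n * ((E1 + E2 + 1) * S0) / \<delta> ^ Suc n"
        using Hb by (intro Bb) auto
      ultimately show ?thesis
        using bnd[of "d1 - c1"] bnd[of "d2 - c2"] m1(2) m2(2) by auto
    qed
    ultimately show "\<exists>A B. deriv_seq UNIV A \<and> deriv_seq UNIV B \<and>
      (\<forall>t. t \<notin> lev 1 ` W \<longrightarrow> A 0 t = 0) \<and> (\<forall>t. t \<notin> lev (-1) ` W \<longrightarrow> B 0 t = 0) \<and>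
      (\<forall>x\<in>K. \<forall>\<alpha>. mi_order \<alpha> \<le> r1 \<longrightarrow>
        cmod (mi_deriv \<alpha> (\<lambda>x. f x - wave_sum A B 0 1 x) x) \<le> \<epsilon> * seminorm L (r1 + 1) f) \<and>
      (\<forall>n\<le>r2. \<forall>t. cmod (A n t) \<le> C / \<epsilon> ^ Suc r2 * seminorm L 0 f \<and>
        cmod (B n t) \<le> C / \<epsilon> ^ Suc r2 * seminorm L 0 f)"
      using A(1) B(1) unfolding S0_def S1_def by (intro exI[of _ A] exI[of _ B]) simp
  qed
qed

section \<open>The approximation theorem\<close>

text \<open>Near each point both second derivatives equal the same wave sum, the two sign changes
  cancelling. The waves may differ from point to point, as they do on different components of
  \<open>X\<close>.\<close>

lemma kernel_space_wave_locally:
  assumes "\<And>z. z \<in> X \<Longrightarrow> \<exists>N A B. open N \<and> z \<in> N \<and> deriv_seq UNIV A \<and> deriv_seq UNIV B \<and>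
    (\<forall>x\<in>N. h x = wave_sum A B 0 1 x)"
  shows "h \<in> kernel_space wave_poly X"
proof -
  have loc: "\<exists>N. open N \<and> z \<in> N \<and> (\<forall>k. Ck_on k N h) \<and>
      partial_deriv 1 (partial_deriv 1 h) z = partial_deriv 2 (partial_deriv 2 h) z" if z: "z \<in> X" for z
  proof -
    obtain N A B where N: "open N" "z \<in> N" and A: "deriv_seq UNIV A" and B: "deriv_seq UNIV B"
      and h: "\<And>x. x \<in> N \<Longrightarrow> h x = wave_sum A B 0 1 x"
      using assms[OF z] by blast
    have A': "deriv_seq (lev 1 ` N) A" and B': "deriv_seq (lev (-1) ` N) B"
      using A B by (auto intro: deriv_seq_subset)
    have "smooth_on N h"
      using smooth_on_cong_open[OF N(1) h] smooth_on_wave_sum[OF N(1) A' B'] by simp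
    moreover have "partial_deriv i (partial_deriv i h) z = wave_sum A B 2 1 z" if i: "i = 1 \<or> i = 2" for i
    proof -
      have "(partial_deriv i ^^ 2) h z = (partial_deriv i ^^ 2) (wave_sum A B 0 1) z"
        by (rule iterated_partial_deriv_cong_open[OF N h])
      also have "\<dots> = wave_sum A B 2 1 z"
        using i iterated_partial_deriv_wave_sum[OF N(1) A' B' N(2), of 2 0 0 1]
          iterated_partial_deriv_wave_sum[OF N(1) A' B' N(2), of 0 2 0 1] by (auto simp: numeral_2_eq_2)
      finally show ?thesis
        by (simp add: numeral_2_eq_2)
    qed
    ultimately show ?thesis
      using N unfolding smooth_on_def by (intro exI[of _ N]) simp
  qed
  have "Ck_on k X h" for k
    by (rule Ck_on_local) (use loc in blast)
  then have "smooth_on X h"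
    by (simp add: smooth_on_def)
  moreover have "partial_deriv 1 (partial_deriv 1 h) z = partial_deriv 2 (partial_deriv 2 h) z" if "z \<in> X" for z
    using loc[OF that] by blast
  ultimately show ?thesis
    by (simp add: kernel_space_wave_iff)
qed

theorem theorem1p4:
  fixes X Y K :: "(real^2) set"
  assumes "open X" and "P_convex_for_supports wave_poly X"
    and "compact K" and "K \<subseteq> X"
    and "open Y" and "K \<subseteq> Y" and "Y \<subseteq> X"
    and "\<not> (\<exists>(x::real^2) A.
           (A \<in> components ((- Y) \<inter> {vector [x$1 + s, x$2 + s] | s. True}) \<or>
            A \<in> components ((- Y) \<inter> {vector [x$1 - s, x$2 + s] | s. True})) \<and>
           compact A \<and> A \<subseteq> X)"
  shows "\<forall>L M r1 r2.
           compact L \<and> L \<subseteq> Y \<and> L = closure (interior L) \<and> K \<subseteq> interior L \<and>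
           \<not> (\<exists>(x::real^2) A.
                (A \<in> components ((- L) \<inter> {vector [x$1 + s, x$2 + s] | s. True}) \<or>
                 A \<in> components ((- L) \<inter> {vector [x$1 - s, x$2 + s] | s. True})) \<and>
                bounded A \<and> A \<subseteq> Y) \<and>
           compact M \<and> M \<subseteq> X \<longrightarrow>
           (\<exists>(s::real) (C::real). s > 0 \<and> C > 0 \<and>
             (\<forall>f\<in>kernel_space wave_poly Y. \<forall>\<epsilon>::real. 0 < \<epsilon> \<and> \<epsilon> < 1 \<longrightarrow>
               (\<exists>h\<in>kernel_space wave_poly X.
                  seminorm K r1 (\<lambda>x. f x - h x) \<le> \<epsilon> * seminorm L (r1 + 1) f \<and>
                  seminorm M r2 h \<le> C / \<epsilon> powr s * seminorm L 0 f)))"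
proof (intro allI impI)
  fix L M :: "(real^2) set" and r1 r2 :: nat
  assume A: "compact L \<and> L \<subseteq> Y \<and> L = closure (interior L) \<and> K \<subseteq> interior L \<and>
    \<not> (\<exists>(x::real^2) A.
      (A \<in> components ((- L) \<inter> {vector [x$1 + s, x$2 + s] | s. True}) \<or>
       A \<in> components ((- L) \<inter> {vector [x$1 - s, x$2 + s] | s. True})) \<and>
      bounded A \<and> A \<subseteq> Y) \<and>
    compact M \<and> M \<subseteq> X"
  then have L: "compact L" "L \<subseteq> Y" and KL: "K \<subseteq> interior L" and M: "M \<subseteq> X"
    by simp_all
  have gapL: False if "\<tau> = 1 \<or> \<tau> = -1" "A \<in> components (- L \<inter> {y. lev \<tau> y = lev \<tau> x})" "bounded A" "A \<subseteq> Y"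
    for \<tau> x A
    using A that unfolding char_line_1 char_line_2 by blast
  have gapY: False if "\<tau> = 1 \<or> \<tau> = -1" "A \<in> components (- Y \<inter> {y. lev \<tau> y = lev \<tau> x})" "compact A" "A \<subseteq> X"
    for \<tau> x A
    using assms(8) that unfolding char_line_1 char_line_2 by blast
  note seg = interior_char_segment[OF assms(1,2,5,7) L(2) gapY gapL]
  let ?I = "interior L"
  have IX: "?I \<subseteq> X"
    using interior_subset[of L] L(2) assms(7) by blast
  have comp_open: "open W" if "W \<in> components ?I" for W
    using that open_components open_interior by blast
  have comp_sub: "W \<subseteq> ?I" if "W \<in> components ?I" for W
    using that by (rule in_components_subset)
  have comp_conn: "connected W" if "W \<in> components ?I" for W
    using that by (rule in_components_connected)
  have comp_max: "closed_segment p q \<subseteq> W"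
    if "W \<in> components ?I" "p \<in> W" "closed_segment p q \<subseteq> ?I" for W p q
    using that by (intro components_maximal[of W ?I]) auto
  have comp_disj: "W = V" if "W \<in> components ?I" "V \<in> components ?I" "x \<in> W" "x \<in> V" for W V x
    using components_nonoverlap[OF that(1,2)] that(3,4) by blast
  have conv: "char_convex W" if W: "W \<in> components ?I" for W
    unfolding char_convex_def
  proof (intro ballI impI)
    fix \<sigma> p q assume \<sigma>: "\<sigma> \<in> {1, -1 :: real}" and pq: "p \<in> W" "q \<in> W" "lev \<sigma> p = lev \<sigma> q"
    have "closed_segment p q \<subseteq> ?I"
      by (rule seg[where \<sigma> = \<sigma> and C = W]) (use \<sigma> pq comp_sub[OF W] comp_conn[OF W] IX in auto)
    then show "closed_segment p q \<subseteq> W"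
      by (rule comp_max[OF W pq(1)])
  qed
  text \<open>Different components of the interior of \<open>L\<close> inside one component of \<open>X\<close> have disjoint
    projections along the characteristics, so their approximations do not interfere.\<close>
  have sep: "W = V" if W: "W \<in> components ?I" "p \<in> W" and V: "V \<in> components ?I" "q \<in> V"
    and \<sigma>: "\<sigma> = 1 \<or> \<sigma> = -1" and l: "lev \<sigma> p = lev \<sigma> q" and c: "connected_component X p q" for W V p q \<sigma>
  proof -
    obtain C where C: "connected C" "C \<subseteq> X" "p \<in> C" "q \<in> C"
      using c unfolding connected_component_def by blast
    have "closed_segment p q \<subseteq> ?I"
      by (rule seg[where \<sigma> = \<sigma> and C = C]) (use \<sigma> l W V comp_sub[OF W(1)] comp_sub[OF V(1)] C in auto)
    then have "q \<in> W"
      using comp_max[OF W] by auto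
    then show "W = V"
      using comp_disj W V by blast
  qed
  \<comment> \<open>Components of the open set are open, so compactness of \<open>K\<close> selects
    finitely many of them.\<close>
  obtain \<C> where \<C>: "\<C> \<subseteq> components ?I" "finite \<C>" "K \<subseteq> \<Union>\<C>"
    using compactE[OF assms(3), of "components ?I"] KL comp_open by (metis Union_components)
  \<comment> \<open>Components missing \<open>K\<close> are discarded, since the normalisation needs
    a point of \<open>K\<close> in each remaining one.\<close>
  define \<W> where "\<W> = {W \<in> \<C>. W \<inter> K \<noteq> {}}"
  have W: "finite \<W>" "\<W> \<subseteq> components ?I" "K \<subseteq> \<Union>\<W>"
  proof -
    show "finite \<W>" "\<W> \<subseteq> components ?I"
      using \<C> by (auto simp: \<W>_def)
    show "K \<subseteq> \<Union>\<W>"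
      using \<C>(3) unfolding \<W>_def by blast
  qed
  have KW: "compact (K \<inter> W)" if "W \<in> \<W>" for W
  proof -
    \<comment> \<open>Removing the other, open and disjoint, components from \<open>K\<close>
      exhibits this piece as compact.\<close>
    have "K \<inter> W = K - \<Union>(\<W> - {W})"
      using W comp_disj that by blast
    moreover have "open (\<Union>(\<W> - {W}))"
      using W comp_open by (intro open_Union) blast
    ultimately show ?thesis
      using compact_diff[OF assms(3)] by simp
  qed
  define app where "app W C f \<epsilon> A B \<longleftrightarrow> deriv_seq UNIV A \<and> deriv_seq UNIV B \<and>
    (\<forall>t. t \<notin> lev 1 ` W \<longrightarrow> A 0 t = 0) \<and> (\<forall>t. t \<notin> lev (-1) ` W \<longrightarrow> B 0 t = 0) \<and>
    (\<forall>x\<in>K \<inter> W. \<forall>\<alpha>. mi_order \<alpha> \<le> r1 \<longrightarrow>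
      cmod (mi_deriv \<alpha> (\<lambda>x. f x - wave_sum A B 0 1 x) x) \<le> \<epsilon> * seminorm L (r1 + 1) f) \<and>
    (\<forall>n\<le>r2. \<forall>t. cmod (A n t) \<le> C / \<epsilon> ^ Suc r2 * seminorm L 0 f \<and>
      cmod (B n t) \<le> C / \<epsilon> ^ Suc r2 * seminorm L 0 f)" for W C f \<epsilon> A B
  have "\<exists>C>0. \<forall>f\<in>kernel_space wave_poly Y. \<forall>\<epsilon>::real. 0 < \<epsilon> \<and> \<epsilon> < 1 \<longrightarrow> (\<exists>A B. app W C f \<epsilon> A B)"
    if "W \<in> \<W>" for W
  proof -
    have Wc: "W \<in> components ?I" using that W by blast
    have "W \<subseteq> L" "K \<inter> W \<noteq> {}"
      using comp_sub[OF Wc] interior_subset that by (auto simp: \<W>_def)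
    then show ?thesis
      unfolding app_def
      by (intro component_approximation comp_open comp_conn conv Wc KW[OF that] L) auto
  qed
  then obtain c where c: "\<And>W. W \<in> \<W> \<Longrightarrow> 0 < c W"
    and c_app: "\<And>W f \<epsilon>. W \<in> \<W> \<Longrightarrow> f \<in> kernel_space wave_poly Y \<Longrightarrow> 0 < \<epsilon> \<Longrightarrow> \<epsilon> < 1 \<Longrightarrow> \<exists>A B. app W (c W) f \<epsilon> A B"
    by metis
  \<comment> \<open>Each component contributes two waves; the summand 1 keeps the constant positive
    even when \<open>K\<close> is empty.\<close>
  define C where "C = 1 + (\<Sum>W\<in>\<W>. 2 * c W)"
  have C: "0 < C"
    unfolding C_def using c by (intro add_pos_nonneg sum_nonneg) (auto intro: less_imp_le)
  show "\<exists>(s::real) (C::real). s > 0 \<and> C > 0 \<and>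
      (\<forall>f\<in>kernel_space wave_poly Y. \<forall>\<epsilon>::real. 0 < \<epsilon> \<and> \<epsilon> < 1 \<longrightarrow>
        (\<exists>h\<in>kernel_space wave_poly X.
          seminorm K r1 (\<lambda>x. f x - h x) \<le> \<epsilon> * seminorm L (r1 + 1) f \<and>
          seminorm M r2 h \<le> C / \<epsilon> powr s * seminorm L 0 f))"
  \<comment> \<open>The exponent counts \<open>r2\<close> derivatives of the kernel and one power
    for its normalisation.\<close>
  proof (rule exI[of _ "real (Suc r2)"], rule exI[of _ C], intro conjI ballI allI impI)
    fix f \<epsilon> assume f: "f \<in> kernel_space wave_poly Y" and "0 < \<epsilon> \<and> \<epsilon> < (1::real)"
    then have \<epsilon>: "0 < \<epsilon>" "\<epsilon> < 1" by auto
    have sf: "smooth_on Y f" using f by (simp add: kernel_space_wave_iff)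
    have S: "0 \<le> seminorm L r f" for r
      by (rule seminorm_nonneg[OF sf L])
    have "\<forall>W\<in>\<W>. \<exists>A B. app W (c W) f \<epsilon> A B"
      using c_app f \<epsilon> by blast
    then obtain A B where AB: "\<And>W. W \<in> \<W> \<Longrightarrow> app W (c W) f \<epsilon> (A W) (B W)"
      by metis
    \<comment> \<open>The chosen components contained in the same component of \<open>X\<close> as
      \<open>z\<close>: as each is connected, one point decides. Only their waves are added near
      \<open>z\<close>.\<close>
    define near where "near z = {W \<in> \<W>. \<exists>y\<in>W. connected_component X y z}" for z
    define AA where "AA z n t = (\<Sum>W\<in>near z. A W n t)" for z n t
    define BB where "BB z n t = (\<Sum>W\<in>near z. B W n t)" for z n t
    define h where "h z = wave_sum (AA z) (BB z) 0 1 z" for z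
    have near: "near z \<subseteq> \<W>" for z
      by (auto simp: near_def)
    have near_eq: "near x = near z" if "connected_component X z x" for x z
      unfolding near_def using that connected_component_trans connected_component_sym by metis
    have dA: "deriv_seq UNIV (AA z)" and dB: "deriv_seq UNIV (BB z)" for z
      unfolding AA_def BB_def using near AB by (auto intro!: deriv_seq_sum simp: app_def)
    have N: "open (connected_component_set X z)" "z \<in> X \<Longrightarrow> z \<in> connected_component_set X z" for z
      using assms(1) by (auto intro: open_connected_component)
    have hN: "h x = wave_sum (AA z) (BB z) 0 1 x" if "x \<in> connected_component_set X z" for x z
      using near_eq[of z x] that by (simp add: h_def AA_def[abs_def] BB_def[abs_def])
    have hX: "h \<in> kernel_space wave_poly X"
    proof (rule kernel_space_wave_locally)
      fix z assume z: "z \<in> X"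
      show "\<exists>N A B. open N \<and> z \<in> N \<and> deriv_seq UNIV A \<and> deriv_seq UNIV B \<and>
          (\<forall>x\<in>N. h x = wave_sum A B 0 1 x)"
        by (intro exI[of _ "connected_component_set X z"] exI[of _ "AA z"] exI[of _ "BB z"] conjI ballI
            N(1) N(2)[OF z] dA dB hN)
    qed
    \<comment> \<open>On \<open>W\<close> every other summand vanishes by disjointness of
      projections. Only the values are compared here; \<open>W\<close> being open, the derivatives
      agree as well.\<close>
    have hW: "h y = wave_sum (A W) (B W) 0 1 y" if W': "W \<in> \<W>" "y \<in> W" for y W
    proof -
      have Wc: "W \<in> components ?I" using W' W by blast
      have yX: "y \<in> X" using comp_sub[OF Wc] IX W' by blast
      have fin: "finite (near y)" using finite_subset[OF near W(1)] .
      have "connected_component X y y" using yX by simp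
      then have Wn: "{W} \<subseteq> near y" using W' unfolding near_def by blast
      have z: "A V 0 (lev 1 y) = 0 \<and> B V 0 (lev (-1) y) = 0" if V: "V \<in> near y - {W}" for V
      proof -
        obtain v where v: "v \<in> V" "connected_component X v y" and VW: "V \<in> \<W>" "V \<noteq> W"
          using V by (auto simp: near_def)
        have Vc: "V \<in> components ?I" using VW W by blast
        have "lev \<sigma> y \<notin> lev \<sigma> ` V" if \<sigma>: "\<sigma> = 1 \<or> \<sigma> = -1" for \<sigma>
        proof
          assume "lev \<sigma> y \<in> lev \<sigma> ` V"
          then obtain q where q: "q \<in> V" "lev \<sigma> y = lev \<sigma> q" by auto
          have "connected_component V v q"
            using comp_conn[OF Vc] v(1) q(1) unfolding connected_component_def by blast
          then have "connected_component X v q"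
            using connected_component_of_subset comp_sub[OF Vc] IX by (metis subset_trans)
          then have "connected_component X y q"
            using v(2) connected_component_sym connected_component_trans by metis
          then show False
            using sep[OF Wc W'(2) Vc q(1) \<sigma> q(2)] VW by blast
        qed
        then show ?thesis
          using AB[OF VW(1)] by (simp add: app_def)
      qed
      have "AA y 0 (lev 1 y) = (\<Sum>W\<in>{W}. A W 0 (lev 1 y))"
        unfolding AA_def by (rule sum.mono_neutral_right[OF fin Wn]) (use z in blast)
      moreover have "BB y 0 (lev (-1) y) = (\<Sum>W\<in>{W}. B W 0 (lev (-1) y))"
        unfolding BB_def by (rule sum.mono_neutral_right[OF fin Wn]) (use z in blast)
      ultimately show ?thesis
        by (simp add: h_def wave_sum_def)
    qed
    have "seminorm K r1 (\<lambda>x. f x - h x) \<le> \<epsilon> * seminorm L (r1 + 1) f"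
    proof (rule seminorm_least)
      show "0 \<le> \<epsilon> * seminorm L (r1 + 1) f"
        using \<epsilon> S by simp
      fix x and \<alpha> :: "2 \<Rightarrow>\<^sub>0 nat" assume x: "x \<in> K" and \<alpha>: "mi_order \<alpha> \<le> r1"
      obtain W' where W': "W' \<in> \<W>" "x \<in> W'" using x W by blast
      have "open W'" using W' W comp_open by blast
      then have "mi_deriv \<alpha> (\<lambda>x. f x - h x) x = mi_deriv \<alpha> (\<lambda>x. f x - wave_sum (A W') (B W') 0 1 x) x"
        by (rule mi_deriv_cong_open[OF _ W'(2)]) (simp add: hW[OF W'(1)])
      then show "cmod (mi_deriv \<alpha> (\<lambda>x. f x - h x) x) \<le> \<epsilon> * seminorm L (r1 + 1) f"
        using AB[OF W'(1)] x W'(2) \<alpha> by (simp add: app_def)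
    qed
    moreover have "seminorm M r2 h \<le> C / \<epsilon> powr real (Suc r2) * seminorm L 0 f"
    proof (rule seminorm_least)
      let ?e = "\<epsilon> ^ Suc r2" and ?S = "seminorm L 0 f"
      have pw: "\<epsilon> powr real (Suc r2) = ?e"
        using \<epsilon> by (rule_tac powr_realpow)
      show "0 \<le> C / \<epsilon> powr real (Suc r2) * ?S"
        using C S by simp
      fix z and \<alpha> :: "2 \<Rightarrow>\<^sub>0 nat" assume z: "z \<in> M" and \<alpha>: "mi_order \<alpha> \<le> r2"
      let ?n = "mi_order \<alpha>"
      have zX: "z \<in> X" using z M by blast
      have dA': "deriv_seq (lev 1 ` connected_component_set X z) (AA z)"
        and dB': "deriv_seq (lev (-1) ` connected_component_set X z) (BB z)"
        using dA dB by (auto intro: deriv_seq_subset)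
      have "mi_deriv \<alpha> h z = mi_deriv \<alpha> (wave_sum (AA z) (BB z) 0 1) z"
        by (rule mi_deriv_cong_open[OF N(1) N(2)[OF zX] hN])
      also have "\<dots> = AA z ?n (lev 1 z) + (- 1) ^ Poly_Mapping.lookup \<alpha> 2 * BB z ?n (lev (-1) z)"
        by (simp only: mi_deriv_wave_sum[OF N(1) dA' dB' N(2)[OF zX]] wave_sum_def)
      also have "cmod \<dots> \<le> cmod (AA z ?n (lev 1 z)) + cmod ((- 1) ^ Poly_Mapping.lookup \<alpha> 2 * BB z ?n (lev (-1) z))"
        by (rule norm_triangle_ineq)
      also have "\<dots> = cmod (AA z ?n (lev 1 z)) + cmod (BB z ?n (lev (-1) z))"
        by (simp add: norm_mult norm_power)
      also have "\<dots> \<le> (\<Sum>W\<in>near z. c W / ?e * ?S) + (\<Sum>W\<in>near z. c W / ?e * ?S)"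
      proof -
        have "cmod (A W ?n t) \<le> c W / ?e * ?S" "cmod (B W ?n t) \<le> c W / ?e * ?S" if "W \<in> near z" for W t
          using AB[of W] near[of z] that \<alpha> unfolding app_def by blast+
        then show ?thesis
          unfolding AA_def BB_def by (intro add_mono sum_norm_le)
      qed
      \<comment> \<open>The two equal sums bound the two families of waves. Enlarging the index set
        to all of \<open>\<W>\<close> next makes the bound independent of \<open>z\<close>.\<close>
      also have "\<dots> = (\<Sum>W\<in>near z. 2 * c W) / ?e * ?S"
        by (simp add: sum_distrib_left sum_distrib_right sum_divide_distrib mult.assoc)
      also have "\<dots> \<le> C / ?e * ?S"
      proof -
        have "(\<Sum>W\<in>near z. 2 * c W) \<le> (\<Sum>W\<in>\<W>. 2 * c W)"
          using c by (intro sum_mono2 W near) (auto intro: less_imp_le)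
        also have "\<dots> \<le> C"
          by (simp add: C_def)
        finally show ?thesis
          using \<epsilon> S by (intro mult_right_mono divide_right_mono) auto
      qed
      finally show "cmod (mi_deriv \<alpha> h z) \<le> C / \<epsilon> powr real (Suc r2) * ?S"
        unfolding pw .
    qed
    ultimately show "\<exists>h\<in>kernel_space wave_poly X.
        seminorm K r1 (\<lambda>x. f x - h x) \<le> \<epsilon> * seminorm L (r1 + 1) f \<and>
        seminorm M r2 h \<le> C / \<epsilon> powr real (Suc r2) * seminorm L 0 f"
      using hX by blast
  qed (use C in auto)
qed

end
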